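(* Let $Z\to X\to B$ be a fiber bundle with 10-dimensional fiber $Z$, with vertical tangent bundle $TZ$ equipped with a metric $g^{TZ}$ and an associated Levi-Civita connection $\nabla^{TZ}$. Let $F_1$ (resp. $F_2$) be an $m$-dimensional (resp. $n$-dimensional) Euclidean vector bundle over $X$ with Euclidean connection $\nabla^{F_1}$ (resp. $\nabla^{F_2}$), and let $\xi$ be a rank two real oriented Euclidean vector bundle over $X$ with Euclidean connection $\nabla^\xi$ and Euler form $c=e(\xi,\nabla^\xi)$. Then the following identity of differential forms on $X$ holds: $$\begin{aligned} &\{\widehat{A}(TZ)e^{\frac{c}{2}}\mathrm{ch}(\wedge^2{F_1}_{\mathbf C})\}^{(12)}+\{\widehat{A}(TZ)e^{\frac{c}{2}}\mathrm{ch}(S^2{F_2}_{\mathbf C})\}^{(12)}-\{\widehat{A}(TZ)e^{\frac{c}{2}}\mathrm{ch}({F_1}_{\mathbf C}\otimes {F_2}_{\mathbf C})\}^{(12)}\\ &+\{\widehat{A}(TZ)e^{\frac{c}{2}}\mathrm{ch}(T_{\mathbf C} Z)\}^{(12)}+\left(\tfrac{(m-n-32)(m-n-31)}{2}-2\right)\{\widehat{A}(TZ)e^{\frac{c}{2}}\}^{(12)}\\ &-(m-n-32)\{\widehat{A}(TZ)e^{\frac{c}{2}}\mathrm{ch}({F_1}_{\mathbf C}-{F_2}_{\mathbf C})\}^{(12)}\\ &+5\{\widehat{A}(TZ)e^{\frac{c}{2}}\mathrm{ch}(\widetilde{\xi_{\mathbf C}}\otimes\widetilde{\xi_{\mathbf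 C}})\}^{(12)}+3\{\widehat{A}(TZ)e^{\frac{c}{2}}\mathrm{ch}((m-n-31-{F_1}_{\mathbf C}+{F_2}_{\mathbf C})\otimes\widetilde{\xi_{\mathbf C}})\}^{(12)}\\ =\;&(p_1(TZ)-p_1(F_1)+p_1(F_2))\\ &\cdot\left\{-\frac{e^{\frac{1}{24}(p_1(TZ)-p_1(F_1)+p_1(F_2))}-1}{p_1(TZ)-p_1(F_1)+p_1(F_2)}\widehat{A}(TZ)e^{\frac{c}{2}}\mathrm{ch}(\mathfrak{A})+e^{\frac{1}{24}(p_1(TZ)-p_1(F_1)+p_1(F_2))}\widehat{A}(TZ)e^{\frac{c}{2}}\right\}^{(8)}, \end{aligned}$$ where $$\begin{aligned}\mathfrak{A}=&\wedge^2{F_1}_{\mathbf C}+S^2{F_2}_{\mathbf C}-{F_1}_{\mathbf C}\otimes {F_2}_{\mathbf C}+T_{\mathbf C} Z+\tfrac{(m-n-32)(m-n-31)}{2}-2\\ &-(m-n-32)({F_1}_{\mathbf C}-{F_2}_{\mathbf C})+5\widetilde{\xi_{\mathbf C}}\otimes\widetilde{\xi_{\mathbf C}}+3(m-n-31-{F_1}_{\mathbf C}+{F_2}_{\mathbf C})\otimes\widetilde{\xi_{\mathbf C}}.\end{aligned}$$ If $\xi$ is trivial, the following identity holds: $$\begin{aligned} &\{\widehat{A}(TZ)\mathrm{ch}(\wedge^2{F_1}_{\mathbf C})\}^{(12)}+\{\widehat{A}(TZ)\mathrm{ch}(S^2{F_2}_{\mathbf C})\}^{(12)}-\{\widehat{A}(TZ)\mathrm{ch}({F_1}_{\mathbf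 C}\otimes {F_2}_{\mathbf C})\}^{(12)}\\ &+\{\widehat{A}(TZ)\mathrm{ch}(T_{\mathbf C} Z)\}^{(12)}+\left(\tfrac{(m-n-32)(m-n-31)}{2}-2\right)\{\widehat{A}(TZ)\}^{(12)}\\ &-(m-n-32)\{\widehat{A}(TZ)\mathrm{ch}({F_1}_{\mathbf C}-{F_2}_{\mathbf C})\}^{(12)}\\ =\;&(p_1(TZ)-p_1(F_1)+p_1(F_2))\\ &\cdot\left\{-\frac{e^{\frac{1}{24}(p_1(TZ)-p_1(F_1)+p_1(F_2))}-1}{p_1(TZ)-p_1(F_1)+p_1(F_2)}\widehat{A}(TZ)\mathrm{ch}(\mathfrak{B})+e^{\frac{1}{24}(p_1(TZ)-p_1(F_1)+p_1(F_2))}\widehat{A}(TZ)\right\}^{(8)}, \end{aligned}$$ where $$\mathfrak{B}=\wedge^2{F_1}_{\mathbf C}+S^2{F_2}_{\mathbf C}-{F_1}_{\mathbf C}\otimes {F_2}_{\mathbf C}+T_{\mathbf C} Z+\tfrac{(m-n-32)(m-n-31)}{2}-2-(m-n-32)({F_1}_{\mathbf C}-{F_2}_{\mathbf C}).$$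
   Context: For a differential form $\omega$, $\omega^{(j)}$ (or $\{\omega\}^{(j)}$) is its degree-$j$ component. For a real bundle $E$, $E_{\mathbf C}$ is its complexification with the induced Hermitian connection; $T_{\mathbf C}Z$ is the complexification of $TZ$. For a real (resp. complex) bundle $E$, $\widetilde{E}=E-\dim E$ in $KO(X)$ (resp. $K(X)$). Integers in $K(X)$ denote (virtual) trivial bundles with trivial connection; tensor products, exterior powers $\wedge^2$ and symmetric powers $S^2$ carry the induced connections, and $\mathrm{ch}$ is extended additively to virtual bundles. $\widehat{A}(TZ)=\widehat{A}(TZ,\nabla^{TZ})$, $\mathrm{ch}(\cdot)$ and $p_i(\cdot)$ denote the Chern-Weil forms (Hirzebruch $\widehat{A}$-form, Chern character form, Pontryagin forms) of the given connections, connections being suppressed from notation. They are normalized so that, if the formal Chern roots of the complexification of a real bundle are $\pm y_j$ (plus possibly $0$), then $p_1=\sum_j y_j^2$, $\widehat{A}=\prod_j \frac{y_j/2}{\sinh(y_j/2)}$, $\mathrm{ch}$ is the sum of the exponentials of the roots, and the roots of $\xi_{\mathbf C}$ are $\pm c$. The quotient $\frac{e^{x/24}-1}{x}$ is understood as the power series $\sum_{k\ge 1}\frac{x^{k-1}}{24^k k!}$. *)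

theory Defs
  imports "HOL-Analysis.Analysis" "HOL-Computational_Algebra.Formal_Power_Series"
begin

section \<open>Smooth manifolds\<close>

text \<open>Both predicates are meant for open \<open>S\<close>. The spaces here are finite-dimensional, so
  differentiability of all iterated directional derivatives is the usual notion of smoothness.\<close>

primrec times_differentiable_on ::
  "nat \<Rightarrow> 'e::real_normed_vector set \<Rightarrow> ('e \<Rightarrow> 'f::real_normed_vector) \<Rightarrow> bool" where
  "times_differentiable_on 0 S f \<longleftrightarrow> continuous_on S f"
| "times_differentiable_on (Suc k) S f \<longleftrightarrow> (\<forall>x\<in>S. f differentiable at x) \<and>
     (\<forall>w. times_differentiable_on k S (\<lambda>x. frechet_derivative f (at x) w))"

definition smooth_on ::
  "'e::real_normed_vector set \<Rightarrow> ('e \<Rightarrow> 'f::real_normed_vector) \<Rightarrow> bool" where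
  "smooth_on S f \<longleftrightarrow> (\<forall>k. times_differentiable_on k S f)"

type_synonym ('a, 'e) chart = "'a set \<times> ('a \<Rightarrow> 'e)"

record ('a, 'e) manifold =
  mtop :: "'a topology"
  atlas :: "('a, 'e) chart set"

abbreviation pts :: "('a, 'e, 'z) manifold_scheme \<Rightarrow> 'a set" where
  "pts M \<equiv> topspace (mtop M)"

text \<open>The model space is any finite-dimensional normed space rather than a \<open>euclidean_space\<close>, since
  the latter class excludes dimension 0 and the base of the fibration may be a point.\<close>

definition smooth_manifold :: "('a, 'e::real_normed_vector) manifold \<Rightarrow> bool" where
  "smooth_manifold M \<longleftrightarrow>
     (\<exists>S::'e set. finite S \<and> span S = UNIV) \<and>
     Hausdorff_space (mtop M) \<and> second_countable (mtop M) \<and>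
     pts M = \<Union> (fst ` atlas M) \<and>
     (\<forall>(U, \<phi>) \<in> atlas M. openin (mtop M) U \<and> open (\<phi> ` U) \<and>
        homeomorphic_map (subtopology (mtop M) U) (top_of_set (\<phi> ` U)) \<phi>) \<and>
     (\<forall>(U, \<phi>) \<in> atlas M. \<forall>(V, \<psi>) \<in> atlas M. smooth_on (\<phi> ` (U \<inter> V)) (\<psi> \<circ> inv_into U \<phi>))"

definition smooth_fun ::
  "('a, 'e::real_normed_vector) manifold \<Rightarrow> 'a set \<Rightarrow> ('a \<Rightarrow> real) \<Rightarrow> bool" where
  "smooth_fun M U f \<longleftrightarrow> (\<forall>(V, \<phi>) \<in> atlas M. smooth_on (\<phi> ` (U \<inter> V)) (f \<circ> inv_into V \<phi>))"

definition smooth_near ::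
  "('a, 'e::real_normed_vector) manifold \<Rightarrow> 'a \<Rightarrow> ('a \<Rightarrow> real) \<Rightarrow> bool" where
  "smooth_near M p f \<longleftrightarrow> (\<exists>U. openin (mtop M) U \<and> p \<in> U \<and> smooth_fun M U f)"

definition smooth_map :: "('a, 'e::real_normed_vector) manifold \<Rightarrow>
    ('b, 'f::real_normed_vector) manifold \<Rightarrow> ('a \<Rightarrow> 'b) \<Rightarrow> bool" where
  "smooth_map M N f \<longleftrightarrow> continuous_map (mtop M) (mtop N) f \<and>
     (\<forall>(U, \<phi>) \<in> atlas M. \<forall>(V, \<psi>) \<in> atlas N.
        smooth_on (\<phi> ` {p \<in> U. f p \<in> V}) (\<psi> \<circ> f \<circ> inv_into U \<phi>))"

definition diffeomorphism :: "('a, 'e::real_normed_vector) manifold \<Rightarrow>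
    ('b, 'f::real_normed_vector) manifold \<Rightarrow> ('a \<Rightarrow> 'b) \<Rightarrow> bool" where
  "diffeomorphism M N f \<longleftrightarrow> smooth_map M N f \<and>
     (\<exists>g. smooth_map N M g \<and> (\<forall>p \<in> pts M. g (f p) = p) \<and> (\<forall>q \<in> pts N. f (g q) = q))"

definition open_submanifold :: "('a, 'e) manifold \<Rightarrow> 'a set \<Rightarrow> ('a, 'e) manifold" where
  "open_submanifold M W =
     \<lparr>mtop = subtopology (mtop M) W, atlas = (\<lambda>(U, \<phi>). (U \<inter> W, \<phi>)) ` atlas M\<rparr>"

definition product_manifold ::
  "('a, 'e) manifold \<Rightarrow> ('b, 'f) manifold \<Rightarrow> ('a \<times> 'b, 'e \<times> 'f) manifold" where
  "product_manifold M N =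
     \<lparr>mtop = prod_topology (mtop M) (mtop N),
      atlas = (\<lambda>((U, \<phi>), (V, \<psi>)). (U \<times> V, map_prod \<phi> \<psi>)) ` (atlas M \<times> atlas N)\<rparr>"

definition smooth_fiber_bundle ::
  "('z, 'g::real_normed_vector) manifold \<Rightarrow> ('a, 'e::real_normed_vector) manifold \<Rightarrow>
   ('b, 'f::real_normed_vector) manifold \<Rightarrow> ('a \<Rightarrow> 'b) \<Rightarrow> bool" where
  "smooth_fiber_bundle Z X B \<pi> \<longleftrightarrow>
     smooth_manifold Z \<and> smooth_manifold X \<and> smooth_manifold B \<and> smooth_map X B \<pi> \<and>
     (\<forall>b \<in> pts B. \<exists>V \<Phi>. openin (mtop B) V \<and> b \<in> V \<and>
        diffeomorphism (open_submanifold X {p \<in> pts X. \<pi> p \<in> V})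
          (product_manifold (open_submanifold B V) Z) \<Phi> \<and>
        (\<forall>p \<in> pts X. \<pi> p \<in> V \<longrightarrow> fst (\<Phi> p) = \<pi> p))"

section \<open>Tangent vectors\<close>

text \<open>A tangent vector is a functional on real functions (a directional derivative), extended by 0 to
  functions that are not smooth near its base point. The type below is the real vector space of all
  functionals; the tangent spaces are subspaces of it.\<close>

typedef 'a tvec = "UNIV :: (('a \<Rightarrow> real) \<Rightarrow> real) set"
  morphisms tapply Tvec ..

setup_lifting type_definition_tvec

instantiation tvec :: (type) real_vector
begin
lift_definition zero_tvec :: "'a tvec" is "\<lambda>_. 0" .
lift_definition plus_tvec :: "'a tvec \<Rightarrow> 'a tvec \<Rightarrow> 'a tvec" is "\<lambda>v w f. v f + w f" .
lift_definition minus_tvec :: "'a tvec \<Rightarrow> 'a tvec \<Rightarrow> 'a tvec" is "\<lambda>v w f. v f - w f" .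
lift_definition uminus_tvec :: "'a tvec \<Rightarrow> 'a tvec" is "\<lambda>v f. - v f" .
lift_definition scaleR_tvec :: "real \<Rightarrow> 'a tvec \<Rightarrow> 'a tvec" is "\<lambda>r v f. r * v f" .
instance
  by standard (transfer; auto simp: algebra_simps)+
end

definition dirvec ::
  "('a, 'e::real_normed_vector) manifold \<Rightarrow> ('a, 'e) chart \<Rightarrow> 'a \<Rightarrow> 'e \<Rightarrow> 'a tvec" where
  "dirvec M c p w = Tvec (\<lambda>f. if smooth_near M p f
     then frechet_derivative (f \<circ> inv_into (fst c) (snd c)) (at (snd c p)) w else 0)"

definition tangent_space :: "('a, 'e::real_normed_vector) manifold \<Rightarrow> 'a \<Rightarrow> 'a tvec set" where
  "tangent_space M p = {dirvec M c p w | c w. c \<in> atlas M \<and> p \<in> fst c}"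

definition smooth_vector_field ::
  "('a, 'e::real_normed_vector) manifold \<Rightarrow> 'a set \<Rightarrow> ('a \<Rightarrow> 'a tvec) \<Rightarrow> bool" where
  "smooth_vector_field M U Y \<longleftrightarrow> (\<forall>p\<in>U. Y p \<in> tangent_space M p) \<and>
     (\<forall>W f. openin (mtop M) W \<and> W \<subseteq> U \<and> smooth_fun M W f \<longrightarrow>
        smooth_fun M W (\<lambda>p. tapply (Y p) f))"

definition lie_bracket :: "('a, 'e::real_normed_vector) manifold \<Rightarrow>
    ('a \<Rightarrow> 'a tvec) \<Rightarrow> ('a \<Rightarrow> 'a tvec) \<Rightarrow> 'a \<Rightarrow> 'a tvec" where
  "lie_bracket M Y W p = Tvec (\<lambda>f. if smooth_near M p f
     then tapply (Y p) (\<lambda>q. tapply (W q) f) - tapply (W p) (\<lambda>q. tapply (Y q) f) else 0)"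

definition vertical_space :: "('a, 'e::real_normed_vector) manifold \<Rightarrow>
    ('b, 'f::real_normed_vector) manifold \<Rightarrow> ('a \<Rightarrow> 'b) \<Rightarrow> 'a \<Rightarrow> 'a tvec set" where
  "vertical_space X B \<pi> p =
     {v \<in> tangent_space X p. \<forall>f. smooth_near B (\<pi> p) f \<longrightarrow> tapply v (f \<circ> \<pi>) = 0}"

definition smooth_1form ::
  "('a, 'e::real_normed_vector) manifold \<Rightarrow> 'a set \<Rightarrow> ('a \<Rightarrow> 'a tvec \<Rightarrow> real) \<Rightarrow> bool" where
  "smooth_1form M U \<alpha> \<longleftrightarrow>
     (\<forall>c \<in> atlas M. \<forall>w. smooth_fun M (U \<inter> fst c) (\<lambda>q. \<alpha> q (dirvec M c q w)))"

text \<open>Exterior derivative of a 1-form at \<open>p\<close>: extend \<open>u\<close>, \<open>v\<close> to vector fields with constant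
  coefficients in a chart around \<open>p\<close>. These commute, so the bracket term vanishes.\<close>

definition chart_at :: "('a, 'e) manifold \<Rightarrow> 'a \<Rightarrow> ('a, 'e) chart" where
  "chart_at M p = (SOME c. c \<in> atlas M \<and> p \<in> fst c)"

definition const_ext ::
  "('a, 'e::real_normed_vector) manifold \<Rightarrow> 'a \<Rightarrow> 'a tvec \<Rightarrow> 'a \<Rightarrow> 'a tvec" where
  "const_ext M p u =
     (\<lambda>q. dirvec M (chart_at M p) q (SOME w. dirvec M (chart_at M p) p w = u))"

definition ext_deriv :: "('a, 'e::real_normed_vector) manifold \<Rightarrow>
    ('a \<Rightarrow> 'a tvec \<Rightarrow> real) \<Rightarrow> 'a \<Rightarrow> 'a tvec \<Rightarrow> 'a tvec \<Rightarrow> real" where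
  "ext_deriv M \<alpha> p u v =
     tapply u (\<lambda>q. \<alpha> q (const_ext M p v q)) - tapply v (\<lambda>q. \<alpha> q (const_ext M p u q))"

section \<open>Vector bundles, metrics and connections\<close>

text \<open>The fibres are finite-dimensional subspaces of a real vector space \<open>'v\<close> (of arbitrary
  dimension and without topology, so this is no restriction); the smooth structure is given by a
  covering family of local frames with smooth transition functions.\<close>

record ('a, 'v) vbundle =
  rnk :: nat
  fiber :: "'a \<Rightarrow> 'v set"
  frames :: "('a set \<times> (nat \<Rightarrow> 'a \<Rightarrow> 'v)) set"

definition is_coord :: "nat \<Rightarrow> (nat \<Rightarrow> 'a \<Rightarrow> 'v::real_vector) \<Rightarrow> 'a \<Rightarrow> 'v \<Rightarrow> (nat \<Rightarrow> real) \<Rightarrow> bool" where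
  "is_coord r e p x a \<longleftrightarrow> (\<forall>i\<ge>r. a i = 0) \<and> x = (\<Sum>i<r. a i *\<^sub>R e i p)"

definition coord :: "nat \<Rightarrow> (nat \<Rightarrow> 'a \<Rightarrow> 'v::real_vector) \<Rightarrow> 'a \<Rightarrow> 'v \<Rightarrow> nat \<Rightarrow> real" where
  "coord r e p x = (THE a. is_coord r e p x a)"

definition frame_basis_at :: "('a, 'v::real_vector) vbundle \<Rightarrow> (nat \<Rightarrow> 'a \<Rightarrow> 'v) \<Rightarrow> 'a \<Rightarrow> bool" where
  "frame_basis_at E e p \<longleftrightarrow> (\<forall>i < rnk E. e i p \<in> fiber E p) \<and>
     (\<forall>x \<in> fiber E p. \<exists>!a. is_coord (rnk E) e p x a)"

definition smooth_section :: "('a, 'e::real_normed_vector) manifold \<Rightarrow>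
    ('a, 'v::real_vector) vbundle \<Rightarrow> 'a set \<Rightarrow> ('a \<Rightarrow> 'v) \<Rightarrow> bool" where
  "smooth_section X E U s \<longleftrightarrow> (\<forall>p\<in>U. s p \<in> fiber E p) \<and>
     (\<forall>(V, e) \<in> frames E. \<forall>i < rnk E. smooth_fun X (U \<inter> V) (\<lambda>p. coord (rnk E) e p (s p) i))"

definition vector_bundle ::
  "('a, 'e::real_normed_vector) manifold \<Rightarrow> ('a, 'v::real_vector) vbundle \<Rightarrow> bool" where
  "vector_bundle X E \<longleftrightarrow>
     (\<forall>p \<in> pts X. subspace (fiber E p)) \<and> pts X = \<Union> (fst ` frames E) \<and>
     (\<forall>(U, e) \<in> frames E. openin (mtop X) U \<and> (\<forall>p\<in>U. frame_basis_at E e p) \<and>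
        (\<forall>i < rnk E. smooth_section X E U (e i)))"

definition euclidean_metric :: "('a, 'e::real_normed_vector) manifold \<Rightarrow>
    ('a, 'v::real_vector) vbundle \<Rightarrow> ('a \<Rightarrow> 'v \<Rightarrow> 'v \<Rightarrow> real) \<Rightarrow> bool" where
  "euclidean_metric X E g \<longleftrightarrow>
     (\<forall>p \<in> pts X. \<forall>x \<in> fiber E p. \<forall>y \<in> fiber E p. \<forall>z \<in> fiber E p. \<forall>r.
        g p (r *\<^sub>R x + y) z = r * g p x z + g p y z \<and> g p x y = g p y x \<and>
        (x \<noteq> 0 \<longrightarrow> g p x x > 0)) \<and>
     (\<forall>(U, e) \<in> frames E. \<forall>i < rnk E. \<forall>j < rnk E. smooth_fun X U (\<lambda>p. g p (e i p) (e j p)))"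

text \<open>\<open>D p v s\<close> is the covariant derivative at \<open>p\<close> of the local section \<open>s\<close> in direction \<open>v\<close>. It is
  only constrained for sections that are smooth near \<open>p\<close>.\<close>

type_synonym ('a, 'v) cov_deriv = "'a \<Rightarrow> 'a tvec \<Rightarrow> ('a \<Rightarrow> 'v) \<Rightarrow> 'v"

text \<open>Entry of the connection matrix: the covariant derivative of \<open>e j\<close> is the sum over \<open>i\<close> of
  \<open>conn_matrix E D e i j\<close> times \<open>e i\<close>.\<close>

definition conn_matrix :: "('a, 'v::real_vector) vbundle \<Rightarrow> ('a, 'v) cov_deriv \<Rightarrow>
    (nat \<Rightarrow> 'a \<Rightarrow> 'v) \<Rightarrow> nat \<Rightarrow> nat \<Rightarrow> 'a \<Rightarrow> 'a tvec \<Rightarrow> real" where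
  "conn_matrix E D e i j q v = coord (rnk E) e q (D q v (e j)) i"

definition connection :: "('a, 'e::real_normed_vector) manifold \<Rightarrow>
    ('a, 'v::real_vector) vbundle \<Rightarrow> ('a, 'v) cov_deriv \<Rightarrow> bool" where
  "connection X E D \<longleftrightarrow>
     (\<forall>U p. openin (mtop X) U \<and> p \<in> U \<longrightarrow>
       (\<forall>v \<in> tangent_space X p. \<forall>s t. smooth_section X E U s \<and> smooth_section X E U t \<longrightarrow>
          D p v s \<in> fiber E p \<and>
          (\<forall>w \<in> tangent_space X p. \<forall>r. D p (r *\<^sub>R v + w) s = r *\<^sub>R D p v s + D p w s) \<and>
          D p v (\<lambda>q. s q + t q) = D p v s + D p v t \<and>
          (\<forall>f. smooth_fun X U f \<longrightarrow>
             D p v (\<lambda>q. f q *\<^sub>R s q) = tapply v f *\<^sub>R s p + f p *\<^sub>R D p v s)) \<and>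
       (\<forall>v \<in> tangent_space X p. \<forall>s t. smooth_section X E U s \<and> (\<forall>q\<in>U. s q = t q) \<longrightarrow>
          D p v s = D p v t)) \<and>
     (\<forall>(U, e) \<in> frames E. \<forall>i < rnk E. \<forall>j < rnk E. smooth_1form X U (conn_matrix E D e i j))"

definition metric_compatible :: "('a, 'e::real_normed_vector) manifold \<Rightarrow>
    ('a, 'v::real_vector) vbundle \<Rightarrow> ('a \<Rightarrow> 'v \<Rightarrow> 'v \<Rightarrow> real) \<Rightarrow> ('a, 'v) cov_deriv \<Rightarrow> bool" where
  "metric_compatible X E g D \<longleftrightarrow>
     (\<forall>U p s t. openin (mtop X) U \<and> p \<in> U \<and> smooth_section X E U s \<and> smooth_section X E U t \<longrightarrow>
        (\<forall>v \<in> tangent_space X p.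
           tapply v (\<lambda>q. g q (s q) (t q)) = g p (D p v s) (t p) + g p (s p) (D p v t)))"

definition euclidean_bundle :: "('a, 'e::real_normed_vector) manifold \<Rightarrow> nat \<Rightarrow>
    ('a, 'v::real_vector) vbundle \<Rightarrow> ('a \<Rightarrow> 'v \<Rightarrow> 'v \<Rightarrow> real) \<Rightarrow> ('a, 'v) cov_deriv \<Rightarrow> bool" where
  "euclidean_bundle X r E g D \<longleftrightarrow> rnk E = r \<and> vector_bundle X E \<and>
     euclidean_metric X E g \<and> connection X E D \<and> metric_compatible X E g D"

text \<open>Orientation of a plane bundle: the frames of the bundle are the positively oriented ones.\<close>

definition oriented_rank2 :: "('a, 'v::real_vector) vbundle \<Rightarrow> bool" where
  "oriented_rank2 E \<longleftrightarrow> rnk E = 2 \<and>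
     (\<forall>(U, e) \<in> frames E. \<forall>(V, e') \<in> frames E. \<forall>p \<in> U \<inter> V.
        coord 2 e p (e' 0 p) 0 * coord 2 e p (e' 1 p) 1
          - coord 2 e p (e' 1 p) 0 * coord 2 e p (e' 0 p) 1 > 0)"

definition trivial_bundle ::
  "('a, 'e::real_normed_vector) manifold \<Rightarrow> ('a, 'v::real_vector) vbundle \<Rightarrow> bool" where
  "trivial_bundle X E \<longleftrightarrow> (\<exists>e. (\<forall>i < rnk E. smooth_section X E (pts X) (e i)) \<and>
     (\<forall>p \<in> pts X. frame_basis_at E e p))"

definition vertical_tangent_bundle :: "('a, 'e::real_normed_vector) manifold \<Rightarrow>
    ('b, 'f::real_normed_vector) manifold \<Rightarrow> ('a \<Rightarrow> 'b) \<Rightarrow> ('a, 'a tvec) vbundle \<Rightarrow> bool" where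
  "vertical_tangent_bundle X B \<pi> TZ \<longleftrightarrow> vector_bundle X TZ \<and>
     (\<forall>p \<in> pts X. fiber TZ p = vertical_space X B \<pi> p) \<and>
     (\<forall>(U, e) \<in> frames TZ. \<forall>i < rnk TZ. smooth_vector_field X U (e i))"

text \<open>Vanishing torsion on pairs of vertical fields. Together with metric compatibility this says that
  the connection restricts to the Levi-Civita connection of the induced metric on every fibre.\<close>

definition fiberwise_torsion_free :: "('a, 'e::real_normed_vector) manifold \<Rightarrow>
    ('a, 'a tvec) vbundle \<Rightarrow> ('a, 'a tvec) cov_deriv \<Rightarrow> bool" where
  "fiberwise_torsion_free X TZ D \<longleftrightarrow>
     (\<forall>U p Y W. openin (mtop X) U \<and> p \<in> U \<and> smooth_section X TZ U Y \<and> smooth_section X TZ U W \<longrightarrow>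
        D p (Y p) W - D p (W p) Y = lie_bracket X Y W p)"

section \<open>Forms at a point\<close>

text \<open>A (complex, inhomogeneous) form at a point is represented by its values on lists of tangent
  vectors; on lists of length \<open>k\<close> one sees its component of degree \<open>k\<close>. The type imposes neither
  multilinearity nor alternation, which all Chern-Weil forms below have on tangent spaces. The product
  is the wedge product, as a signed sum over shuffles: \<open>S\<close> is the set of positions of the arguments
  passed to the left factor.\<close>

typedef 'v mform = "UNIV :: ('v list \<Rightarrow> complex) set"
  morphisms mapply Mform ..

setup_lifting type_definition_mform

definition shuffle_sign :: "nat \<Rightarrow> nat set \<Rightarrow> complex" where
  "shuffle_sign k S = (- 1) ^ card {(i, j). i \<in> S \<and> j \<in> {..<k} - S \<and> j < i}"

instantiation mform :: (type) real_vector
begin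
lift_definition zero_mform :: "'a mform" is "\<lambda>_. 0" .
lift_definition plus_mform :: "'a mform \<Rightarrow> 'a mform \<Rightarrow> 'a mform" is "\<lambda>\<alpha> \<beta> vs. \<alpha> vs + \<beta> vs" .
lift_definition minus_mform :: "'a mform \<Rightarrow> 'a mform \<Rightarrow> 'a mform" is "\<lambda>\<alpha> \<beta> vs. \<alpha> vs - \<beta> vs" .
lift_definition uminus_mform :: "'a mform \<Rightarrow> 'a mform" is "\<lambda>\<alpha> vs. - \<alpha> vs" .
lift_definition scaleR_mform :: "real \<Rightarrow> 'a mform \<Rightarrow> 'a mform" is "\<lambda>r \<alpha> vs. r *\<^sub>R \<alpha> vs" .
instance
  by standard (transfer; auto simp: algebra_simps)+
end

instantiation mform :: (type) power
begin
lift_definition one_mform :: "'a mform" is "\<lambda>vs. if vs = [] then 1 else 0" .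
lift_definition times_mform :: "'a mform \<Rightarrow> 'a mform \<Rightarrow> 'a mform" is
  "\<lambda>\<alpha> \<beta> vs. \<Sum>S \<in> Pow {..<length vs}.
     shuffle_sign (length vs) S * \<alpha> (nths vs S) * \<beta> (nths vs (- S))" .
instance ..
end

definition deg_part :: "nat \<Rightarrow> 'v mform \<Rightarrow> 'v mform" where
  "deg_part k \<alpha> = Mform (\<lambda>vs. if length vs = k then mapply \<alpha> vs else 0)"

text \<open>The value at \<open>\<alpha>\<close> of the power series with coefficients \<open>a\<close>, for \<open>\<alpha>\<close> without component of degree
  0: then the \<open>k\<close>-th power of \<open>\<alpha>\<close> has no components of degree less than \<open>k\<close>, so the truncation loses
  nothing. The same applies to the trace of a power series in a matrix of 2-forms.\<close>

definition form_series :: "(nat \<Rightarrow> real) \<Rightarrow> 'v mform \<Rightarrow> 'v mform" where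
  "form_series a \<alpha> = Mform (\<lambda>vs. mapply (\<Sum>k\<le>length vs. a k *\<^sub>R \<alpha> ^ k) vs)"

definition form_exp :: "'v mform \<Rightarrow> 'v mform" where
  "form_exp = form_series (\<lambda>k. 1 / fact k)"

primrec matrix_power :: "nat \<Rightarrow> (nat \<Rightarrow> nat \<Rightarrow> 'v mform) \<Rightarrow> nat \<Rightarrow> nat \<Rightarrow> nat \<Rightarrow> 'v mform" where
  "matrix_power r K 0 = (\<lambda>i j. if i = j then 1 else 0)"
| "matrix_power r K (Suc k) = (\<lambda>i j. \<Sum>l<r. K i l * matrix_power r K k l j)"

definition trace_power :: "nat \<Rightarrow> (nat \<Rightarrow> nat \<Rightarrow> 'v mform) \<Rightarrow> nat \<Rightarrow> 'v mform" where
  "trace_power r K k = (\<Sum>i<r. matrix_power r K k i i)"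

definition trace_series :: "(nat \<Rightarrow> real) \<Rightarrow> nat \<Rightarrow> (nat \<Rightarrow> nat \<Rightarrow> 'v mform) \<Rightarrow> 'v mform" where
  "trace_series a r K = Mform (\<lambda>vs. mapply (\<Sum>k\<le>length vs. a k *\<^sub>R trace_power r K k) vs)"

text \<open>Equality of differential forms on \<open>X\<close>.\<close>

definition forms_eq :: "('a, 'e::real_normed_vector) manifold \<Rightarrow>
    ('a \<Rightarrow> 'a tvec mform) \<Rightarrow> ('a \<Rightarrow> 'a tvec mform) \<Rightarrow> bool" where
  "forms_eq X \<alpha> \<beta> \<longleftrightarrow>
     (\<forall>p \<in> pts X. \<forall>vs. set vs \<subseteq> tangent_space X p \<longrightarrow> mapply (\<alpha> p) vs = mapply (\<beta> p) vs)"

section \<open>Connections in local frames and Chern-Weil forms\<close>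

text \<open>A real bundle with connection, given by its rank and, for every point \<open>p\<close>, its connection matrix
  in some local frame around \<open>p\<close>. The Chern-Weil forms below are invariant polynomials in the curvature
  and so do not depend on the frame chosen at each point.\<close>

record 'a lconn =
  lrank :: nat
  lmat :: "'a \<Rightarrow> nat \<Rightarrow> nat \<Rightarrow> 'a \<Rightarrow> 'a tvec \<Rightarrow> real"

definition frame_at :: "('a, 'v) vbundle \<Rightarrow> 'a \<Rightarrow> nat \<Rightarrow> 'a \<Rightarrow> 'v" where
  "frame_at E p = (SOME e. \<exists>U. (U, e) \<in> frames E \<and> p \<in> U)"

definition local_conn ::
  "('a, 'v::real_vector) vbundle \<Rightarrow> ('a, 'v) cov_deriv \<Rightarrow> 'a lconn" where
  "local_conn E D = \<lparr>lrank = rnk E, lmat = (\<lambda>p. conn_matrix E D (frame_at E p))\<rparr>"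

definition trivial_line :: "'a lconn" where
  "trivial_line = \<lparr>lrank = 1, lmat = (\<lambda>p i j q v. 0)\<rparr>"

text \<open>Induced connections, obtained from the Leibniz rule: on the tensor product in the frame of the
  products of the two frames (index \<open>i * lrank B + j\<close>), on the exterior square in the frame of the
  wedges \<open>e i \<and> e j\<close> with \<open>i < j\<close>, and on the symmetric square in the frame of the products
  \<open>e i e j\<close> with \<open>i \<le> j\<close>, the pairs being listed in lexicographic order.\<close>

definition tensor_conn :: "'a lconn \<Rightarrow> 'a lconn \<Rightarrow> 'a lconn" where
  "tensor_conn A B = \<lparr>lrank = lrank A * lrank B,
     lmat = (\<lambda>p a b q v. let s = lrank B in
       of_bool (a mod s = b mod s) * lmat A p (a div s) (b div s) q v
       + of_bool (a div s = b div s) * lmat B p (a mod s) (b mod s) q v)\<rparr>"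

definition pairs_less :: "nat \<Rightarrow> (nat \<times> nat) list" where
  "pairs_less r = [(i, j). i \<leftarrow> [0..<r], j \<leftarrow> [Suc i..<r]]"

definition pairs_le :: "nat \<Rightarrow> (nat \<times> nat) list" where
  "pairs_le r = [(i, j). i \<leftarrow> [0..<r], j \<leftarrow> [i..<r]]"

definition wedge2_conn :: "'a lconn \<Rightarrow> 'a lconn" where
  "wedge2_conn A = \<lparr>lrank = length (pairs_less (lrank A)),
     lmat = (\<lambda>p a b q v. let (i, j) = pairs_less (lrank A) ! a; (k, l) = pairs_less (lrank A) ! b in
       of_bool (j = l) * lmat A p i k q v - of_bool (i = l) * lmat A p j k q v
       + of_bool (i = k) * lmat A p j l q v - of_bool (j = k) * lmat A p i l q v)\<rparr>"

definition sym2_conn :: "'a lconn \<Rightarrow> 'a lconn" where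
  "sym2_conn A = \<lparr>lrank = length (pairs_le (lrank A)),
     lmat = (\<lambda>p a b q v. let (i, j) = pairs_le (lrank A) ! a; (k, l) = pairs_le (lrank A) ! b in
       (of_bool (j = l) * lmat A p i k q v + of_bool (i = l) * lmat A p j k q v
        + of_bool (i = k) * lmat A p j l q v + of_bool (j = k) * lmat A p i l q v)
       / (if i = j then 2 else 1))\<rparr>"

definition curvature :: "('a, 'e::real_normed_vector) manifold \<Rightarrow> 'a lconn \<Rightarrow> 'a \<Rightarrow>
    nat \<Rightarrow> nat \<Rightarrow> 'a tvec \<Rightarrow> 'a tvec \<Rightarrow> real" where
  "curvature X A p i j u v = ext_deriv X (lmat A p i j) p u v +
     (\<Sum>k < lrank A. lmat A p i k p u * lmat A p k j p v - lmat A p i k p v * lmat A p k j p u)"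

text \<open>Matrix of the 2-forms \<open>\<i> / (2 \<pi>)\<close> times the curvature, of the complexified bundle.\<close>

definition norm_curvature :: "('a, 'e::real_normed_vector) manifold \<Rightarrow> 'a lconn \<Rightarrow> 'a \<Rightarrow>
    nat \<Rightarrow> nat \<Rightarrow> 'a tvec mform" where
  "norm_curvature X A p i j = Mform (\<lambda>vs. if length vs = 2
     then \<i> / complex_of_real (2 * pi) * complex_of_real (curvature X A p i j (vs ! 0) (vs ! 1))
     else 0)"

text \<open>Chern character of the complexification: the trace of \<open>exp (\<i> / (2 \<pi>) R)\<close>.\<close>

definition ch_conn ::
  "('a, 'e::real_normed_vector) manifold \<Rightarrow> 'a lconn \<Rightarrow> 'a \<Rightarrow> 'a tvec mform" where
  "ch_conn X A p = trace_series (\<lambda>k. 1 / fact k) (lrank A) (norm_curvature X A p)"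

text \<open>\<open>-1 / (8 \<pi>\<^sup>2)\<close> times the trace of the square of the curvature.\<close>

definition pontryagin1 ::
  "('a, 'e::real_normed_vector) manifold \<Rightarrow> 'a lconn \<Rightarrow> 'a \<Rightarrow> 'a tvec mform" where
  "pontryagin1 X A p = (1 / 2) *\<^sub>R trace_power (lrank A) (norm_curvature X A p) 2"

text \<open>The Hirzebruch A-hat form is the square root of the determinant of \<open>f (\<i> / (2 \<pi>) R)\<close> for
  \<open>f x = (x / 2) / sinh (x / 2)\<close>, where the square root of the determinant is read as
  \<open>exp (1 / 2 tr log)\<close>.\<close>

definition log_ahat_fps :: "real fps" where
  "log_ahat_fps = fps_ln 1 oo (fps_X / (fps_exp (1 / 2) - fps_exp (- 1 / 2)) - 1)"

definition ahat ::
  "('a, 'e::real_normed_vector) manifold \<Rightarrow> 'a lconn \<Rightarrow> 'a \<Rightarrow> 'a tvec mform" where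
  "ahat X A p =
     form_exp ((1 / 2) *\<^sub>R trace_series (fps_nth log_ahat_fps) (lrank A) (norm_curvature X A p))"

text \<open>Euler form of an oriented plane bundle: the Pfaffian of the matrix \<open>g (e i) (R (e j))\<close> divided by
  \<open>2 \<pi>\<close> and by the square root of the Gram determinant. In an oriented orthonormal frame it is
  \<open>g (e 0) (R (e 1)) / (2 \<pi>)\<close>, which for the tangent bundle of a surface is the Gauss curvature times
  the area form divided by \<open>2 \<pi>\<close>.\<close>

definition euler_form :: "('a, 'e::real_normed_vector) manifold \<Rightarrow> ('a, 'v::real_vector) vbundle \<Rightarrow>
    ('a \<Rightarrow> 'v \<Rightarrow> 'v \<Rightarrow> real) \<Rightarrow> ('a, 'v) cov_deriv \<Rightarrow> 'a \<Rightarrow> 'a tvec mform" where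
  "euler_form X E g D p =
     (let e = frame_at E p; G = (\<lambda>i j. g p (e i p) (e j p)) in
      Mform (\<lambda>vs. if length vs = 2 then complex_of_real
        ((\<Sum>k<2. G 0 k * curvature X (local_conn E D) p k 1 (vs ! 0) (vs ! 1))
         / (2 * pi * sqrt (G 0 0 * G 1 1 - G 0 1 * G 1 0))) else 0))"

text \<open>Virtual bundles with connection: formal integral combinations of bundles with connection.\<close>

datatype 'a virt = Virt (summands: "(int \<times> 'a lconn) list")

definition vb :: "'a lconn \<Rightarrow> 'a virt" where
  "vb A = Virt [(1, A)]"

definition triv :: "int \<Rightarrow> 'a virt" where
  "triv k = Virt [(k, trivial_line)]"

instantiation virt :: (type) "{plus, minus, times}"
begin
definition "V + W = Virt (summands V @ summands W)"
definition "V - W = Virt (summands V @ [(- l, B). (l, B) \<leftarrow> summands W])"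
definition "V * W = Virt [(k * l, tensor_conn A B). (k, A) \<leftarrow> summands V, (l, B) \<leftarrow> summands W]"
instance ..
end

definition reduced_vb :: "'a lconn \<Rightarrow> 'a virt" where
  "reduced_vb A = vb A - triv (int (lrank A))"

definition ch ::
  "('a, 'e::real_normed_vector) manifold \<Rightarrow> 'a virt \<Rightarrow> 'a \<Rightarrow> 'a tvec mform" where
  "ch X V p = (\<Sum>(k, A) \<leftarrow> summands V. of_int k *\<^sub>R ch_conn X A p)"

section \<open>The bundles and forms of the anomaly cancellation formula\<close>

definition virt_B :: "'a lconn \<Rightarrow> 'a lconn \<Rightarrow> 'a lconn \<Rightarrow> 'a virt" where
  "virt_B T F1 F2 = (let d = int (lrank F1) - int (lrank F2) in
     vb (wedge2_conn F1) + vb (sym2_conn F2) - vb F1 * vb F2 + vb T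
     + triv ((d - 32) * (d - 31) div 2 - 2) - triv (d - 32) * (vb F1 - vb F2))"

definition virt_A :: "'a lconn \<Rightarrow> 'a lconn \<Rightarrow> 'a lconn \<Rightarrow> 'a lconn \<Rightarrow> 'a virt" where
  "virt_A T F1 F2 \<xi> = (let d = int (lrank F1) - int (lrank F2) in
     vb (wedge2_conn F1) + vb (sym2_conn F2) - vb F1 * vb F2 + vb T
     + triv ((d - 32) * (d - 31) div 2 - 2) - triv (d - 32) * (vb F1 - vb F2)
     + triv 5 * (reduced_vb \<xi> * reduced_vb \<xi>)
     + triv 3 * ((triv (d - 31) - vb F1 + vb F2) * reduced_vb \<xi>))"

text \<open>The power series \<open>(exp (x / 24) - 1) / x\<close>.\<close>

definition exp_quot :: "'v mform \<Rightarrow> 'v mform" where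
  "exp_quot = form_series (\<lambda>k. 1 / (24 ^ (k + 1) * fact (k + 1)))"

end

theory Submission
  imports Defs
begin

text \<open>Both sides are evaluated pointwise on tangent vectors \<open>v\<^sub>1, \<dots>, v\<^sub>1\<^sub>2\<close>. Restricted to sublists of
  these vectors, forms of even degree live in the even part of a Grassmann algebra, a commutative ring,
  so Chern--Weil forms become power sums of a curvature matrix over a commutative ring. Metric
  compatibility makes this matrix skew-adjoint, which kills the odd power sums. With the virtual bundle
  \<open>G = F\<^sub>1 - F\<^sub>2 - (m - n - 32)\<close> of rank 32 and \<open>P = p\<^sub>1(TZ) - p\<^sub>1(G)\<close>, the assertion is that
  \<open>exp (P / 24) Ahat(TZ) exp (c / 2) (ch(virt_A) - P)\<close> has no component of degree 12. In the power sums
  this is a polynomial identity with rational coefficients, checked directly; the underlying reason is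
  that this component is 24 times the constant coefficient plus the \<open>q\<close>-coefficient of a modular form of
  weight 14, which is a multiple of \<open>E\<^sub>1\<^sub>4 = 1 - 24 q - \<dots>\<close>.\<close>

unbundle fps_syntax and no vec_syntax

section \<open>Even elements of a Grassmann algebra\<close>

text \<open>The constants of \<open>virt_A\<close> become transparent in terms of G. With x the
  reduced complexification of the plane bundle, \<open>virt_A\<close> is wedge^2 G + TZ - 2 + 5 x^2
  + 3 (1 - G) x, because the exterior square of the trivial bundle of rank -D has rank D (D + 1) /
  2. In degree 12 the top component of ch(G) enters with a multiple of 2 * 32 - 2^6 = 0; this is
  what rank 32 achieves. The top component of ch(TZ) enters once directly and once through log Ahat
  with factor -1/504, and the rank 496 + 10 - 2 = 504 of \<open>virt_A\<close> makes the two cancel.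
  The coefficient 3 removes c^2 times the degree 8 part of ch(G), and 5 removes c^6. The remainder
  is divisible by P, and P \<open>exp_quot\<close>(P) = exp (P / 24) - 1 converts the claim into the
  vanishing statement. The obstacle is that \<open>mform\<close> is not a commutative ring and its
  elements need not be alternating. A shuffle product evaluated on a list uses only values on
  sublists, so subsets of positions can take the place of vectors.\<close>

definition koszul_sign :: "nat set \<Rightarrow> nat set \<Rightarrow> complex" where
  "koszul_sign S T = (\<Prod>i\<in>S. \<Prod>j\<in>T. if j < i then - 1 else 1)"

lemma koszul_sign_union_left:
  assumes "finite S" "finite S'" "S \<inter> S' = {}"
  shows "koszul_sign (S \<union> S') T = koszul_sign S T * koszul_sign S' T"
  using assms by (simp add: koszul_sign_def prod.union_disjoint)

lemma koszul_sign_union_right: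
  assumes "finite T" "finite T'" "T \<inter> T' = {}"
  shows "koszul_sign S (T \<union> T') = koszul_sign S T * koszul_sign S T'"
  using assms by (simp add: koszul_sign_def prod.union_disjoint prod.distrib)

lemma koszul_sign_empty [simp]: "koszul_sign {} T = 1" "koszul_sign S {} = 1"
  by (simp_all add: koszul_sign_def)

text \<open>Swapping the roles of S and T reverses all card S * card T comparisons, an even number.
  This is where evenness produces commutativity; one even factor is enough.\<close>

lemma koszul_sign_commute:
  assumes "S \<inter> T = {}" "even (card S)"
  shows "koszul_sign S T = koszul_sign T S"
proof -
  have "koszul_sign T S = (\<Prod>i\<in>S. \<Prod>j\<in>T. if i < j then - 1 else 1)"
    unfolding koszul_sign_def by (rule prod.swap)
  also have "\<dots> = (\<Prod>i\<in>S. \<Prod>j\<in>T. (- 1) * (if j < i then - 1 else 1))"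
    using assms(1) by (intro prod.cong refl) (auto simp: not_less)
  also have "\<dots> = ((- 1) ^ card T) ^ card S * koszul_sign S T"
    unfolding prod.distrib koszul_sign_def by (simp only: prod_constant)
  also have "\<dots> = koszul_sign S T"
    using assms(2) by (simp add: power_mult[symmetric])
  finally show ?thesis by simp
qed

lemma koszul_sign_reindex:
  assumes "strict_mono_on A f" "S \<subseteq> A" "T \<subseteq> A"
  shows "koszul_sign (f ` S) (f ` T) = koszul_sign S T"
proof -
  have inj: "inj_on f S" "inj_on f T"
    using assms strict_mono_on_imp_inj_on inj_on_subset by blast+
  have "f j < f i \<longleftrightarrow> j < i" if "i \<in> A" "j \<in> A" for i j
    using assms(1) that by (metis linorder_neqE_nat not_less_iff_gr_or_eq strict_mono_on_def)
  then show ?thesis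
    unfolding koszul_sign_def using assms(2,3)
    by (simp add: prod.reindex[OF inj(1)] prod.reindex[OF inj(2)] subset_iff cong: prod.cong)
qed

text \<open>\<open>shuffle_sign\<close> puts the number of inversions into one exponent. As a
  product over pairs the sign splits over disjoint unions, which is the form that associativity of
  the wedge product needs.\<close>

lemma shuffle_sign_eq_koszul_sign:
  assumes "S \<subseteq> {..<k}"
  shows "shuffle_sign k S = koszul_sign S ({..<k} - S)"
proof -
  let ?P = "S \<times> ({..<k} - S)"
  have fin: "finite S" using assms finite_subset by blast
  have eq: "{(i, j). i \<in> S \<and> j \<in> {..<k} - S \<and> j < i} = {x \<in> ?P. snd x < fst x}"
    by auto
  have "koszul_sign S ({..<k} - S) = (\<Prod>x\<in>?P. if snd x < fst x then - 1 else 1)"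
    by (simp add: koszul_sign_def prod.cartesian_product case_prod_unfold)
  also have "\<dots> = (\<Prod>x\<in>{x \<in> ?P. snd x < fst x}. - 1)"
    using fin by (intro prod.inter_filter[symmetric]) auto
  also have "\<dots> = shuffle_sign k S"
    unfolding shuffle_sign_def eq by (simp only: prod_constant)
  finally show ?thesis by simp
qed

text \<open>A nonzero summand forces S and U - S to be finite of even size, and then so is U; hence
  the even part is closed under multiplication.\<close>

lemma grassmann_product_support:
  fixes a b :: "nat set \<Rightarrow> complex"
  assumes a: "\<forall>S. \<not> (finite S \<and> even (card S)) \<longrightarrow> a S = 0"
    and b: "\<forall>S. \<not> (finite S \<and> even (card S)) \<longrightarrow> b S = 0"
    and U: "\<not> (finite U \<and> even (card U))"
  shows "(\<Sum>S\<in>Pow U. koszul_sign S (U - S) * a S * b (U - S)) = 0"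
proof -
  have "a S = 0 \<or> b (U - S) = 0" if "S \<subseteq> U" for S
  proof (rule ccontr)
    assume "\<not> ?thesis"
    then have S: "finite S \<and> even (card S)" "finite (U - S) \<and> even (card (U - S))"
      using a b by blast+
    then have "finite U" using that by (metis finite_Diff2)
    moreover have "card U = card S + card (U - S)"
      using S that \<open>finite U\<close> by (metis card_Diff_subset card_mono le_add_diff_inverse)
    ultimately show False using U S by simp
  qed
  then show ?thesis
    by (intro sum.neutral) auto
qed

text \<open>An element assigns to a finite set S the coefficient of the product of the generators
  indexed by S, taken in increasing order. There is a generator for every natural number, so one
  ring serves vector lists of every length. Coefficients at infinite sets are 0, matching the value
  0 of a sum over an infinite \<open>Pow U\<close>.\<close>

typedef even_grassmann =
  "{a :: nat set \<Rightarrow> complex. \<forall>S. \<not> (finite S \<and> even (card S)) \<longrightarrow> a S = 0}"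
  morphisms gcoeff Grassmann
  by (rule exI[of _ "\<lambda>_. 0"]) simp

setup_lifting type_definition_even_grassmann

lemma gcoeff_eq_0: "\<not> (finite S \<and> even (card S)) \<Longrightarrow> gcoeff a S = 0"
  using gcoeff[of a] by auto

instantiation even_grassmann :: "{comm_ring_1, real_algebra_1}"
begin

lift_definition zero_even_grassmann :: even_grassmann is "\<lambda>_. 0" by simp
lift_definition one_even_grassmann :: even_grassmann is "\<lambda>S. if S = {} then 1 else 0" by auto
lift_definition plus_even_grassmann :: "even_grassmann \<Rightarrow> even_grassmann \<Rightarrow> even_grassmann"
  is "\<lambda>a b S. a S + b S" by auto
lift_definition minus_even_grassmann :: "even_grassmann \<Rightarrow> even_grassmann \<Rightarrow> even_grassmann"
  is "\<lambda>a b S. a S - b S" by auto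
lift_definition uminus_even_grassmann :: "even_grassmann \<Rightarrow> even_grassmann"
  is "\<lambda>a S. - a S" by auto
lift_definition scaleR_even_grassmann :: "real \<Rightarrow> even_grassmann \<Rightarrow> even_grassmann"
  is "\<lambda>r a S. r *\<^sub>R a S" by auto
lift_definition times_even_grassmann :: "even_grassmann \<Rightarrow> even_grassmann \<Rightarrow> even_grassmann"
  is "\<lambda>a b U. \<Sum>S\<in>Pow U. koszul_sign S (U - S) * a S * b (U - S)"
  using grassmann_product_support by blast

instance
proof
  fix a b c :: even_grassmann and r s :: real
  show "a * b * c = a * (b * c)"
  proof (rule gcoeff_inject[THEN iffD1], rule ext)
    fix U :: "nat set"
    show "gcoeff (a * b * c) U = gcoeff (a * (b * c)) U"
    proof (cases "finite U")
      case False
      then show ?thesis by (simp add: gcoeff_eq_0)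
    next
      case fin: True
      let ?f = "\<lambda>S R. koszul_sign S (U - S) * koszul_sign R (S - R) * gcoeff a R * gcoeff b (S - R) * gcoeff c (U - S)"
      let ?g = "\<lambda>R Q. koszul_sign R (U - R) * koszul_sign Q (U - R - Q) * gcoeff a R * gcoeff b Q * gcoeff c (U - R - Q)"
      have "gcoeff (a * b * c) U = (\<Sum>S\<in>Pow U. \<Sum>R\<in>Pow S. ?f S R)"
        by (simp add: times_even_grassmann.rep_eq sum_distrib_left sum_distrib_right mult.assoc)
      also have "\<dots> = (\<Sum>(S, R)\<in>(SIGMA S:Pow U. Pow S). ?f S R)"
        using fin by (intro sum.Sigma) (auto intro: finite_subset)
      \<comment> \<open>Both sides run over ordered partitions of U into three blocks, listed once
        by S = R union Q and once by R. Splitting the sign over unions shows that each of the three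
        pairs of blocks contributes once on either side.\<close>
      also have "\<dots> = (\<Sum>(R, Q)\<in>(SIGMA R:Pow U. Pow (U - R)). ?g R Q)"
      proof (rule sum.reindex_bij_witness[where i = "\<lambda>(R, Q). (R \<union> Q, R)" and j = "\<lambda>(S, R). (R, S - R)"])
        fix x assume x: "x \<in> (SIGMA S:Pow U. Pow S)"
        define S R where "S = fst x" and "R = snd x"
        have xe: "x = (S, R)" by (simp add: S_def R_def)
        with x have sub: "R \<subseteq> S" "S \<subseteq> U" by auto
        have fS: "finite S" using finite_subset[OF sub(2) fin] .
        have f: "finite R" "finite (S - R)" "finite (U - S)"
          using finite_subset[OF sub(1) fS] fS fin by simp_all
        have e: "U - R - (S - R) = U - S" "U - R = (S - R) \<union> (U - S)" "R \<union> (S - R) = S"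
          using sub by auto
        have "koszul_sign (R \<union> (S - R)) (U - S) = koszul_sign R (U - S) * koszul_sign (S - R) (U - S)"
          using f by (intro koszul_sign_union_left) auto
        moreover have "koszul_sign R ((S - R) \<union> (U - S)) = koszul_sign R (S - R) * koszul_sign R (U - S)"
          using f by (intro koszul_sign_union_right) auto
        ultimately have "koszul_sign R (U - R) * koszul_sign (S - R) (U - S)
            = koszul_sign S (U - S) * koszul_sign R (S - R)"
          unfolding e(2)[symmetric] e(3) by simp
        then show "(case case x of (S, R) \<Rightarrow> (R, S - R) of (R, Q) \<Rightarrow> ?g R Q) = (case x of (S, R) \<Rightarrow> ?f S R)"
          unfolding xe by (simp add: e(1))
      qed (use fin in \<open>auto\<close>)
      also have "\<dots> = (\<Sum>R\<in>Pow U. \<Sum>Q\<in>Pow (U - R). ?g R Q)"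
        using fin by (intro sum.Sigma[symmetric]) (auto intro: finite_subset)
      also have "\<dots> = gcoeff (a * (b * c)) U"
        by (simp add: times_even_grassmann.rep_eq sum_distrib_left mult_ac)
      finally show ?thesis .
    qed
  qed
  have comm: "a * b = b * a" for a b :: even_grassmann
  proof (rule gcoeff_inject[THEN iffD1], rule ext)
    fix U :: "nat set"
    have "(\<Sum>S\<in>Pow U. koszul_sign S (U - S) * gcoeff a S * gcoeff b (U - S))
        = (\<Sum>S\<in>Pow U. koszul_sign S (U - S) * gcoeff b S * gcoeff a (U - S))"
    proof (rule sum.reindex_bij_witness[where i = "\<lambda>S. U - S" and j = "\<lambda>S. U - S"], goal_cases)
      case (5 S)
      then have e: "U - (U - S) = S" by auto
      show ?case
      proof (cases "even (card S)")
        case True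
        then show ?thesis using koszul_sign_commute[of S "U - S"] by (simp add: e mult_ac)
      next
        case False
        then show ?thesis by (simp add: gcoeff_eq_0 e)
      qed
    qed auto
    then show "gcoeff (a * b) U = gcoeff (b * a) U" by (simp add: times_even_grassmann.rep_eq)
  qed
  show "a * b = b * a" by (rule comm)
  have one: "1 * a = a" for a :: even_grassmann
  proof (rule gcoeff_inject[THEN iffD1], rule ext)
    fix U :: "nat set"
    show "gcoeff (1 * a) U = gcoeff a U"
    proof (cases "finite U")
      case True
      have "gcoeff (1 * a) U = (\<Sum>S\<in>Pow U. if S = {} then gcoeff a U else 0)"
        by (auto simp: times_even_grassmann.rep_eq one_even_grassmann.rep_eq intro!: sum.cong)
      then show ?thesis using True by simp
    qed (simp add: gcoeff_eq_0)
  qed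
  show "1 * a = a" by (rule one)
  show "a * 1 = a" using one by (simp only: comm[of a 1])
  have distrib: "(a + b) * c = a * c + b * c" for a b c :: even_grassmann
    by transfer (simp add: algebra_simps sum.distrib)
  show "(a + b) * c = a * c + b * c" by (rule distrib)
  show "a * (b + c) = a * b + a * c" using distrib[of b c a] by (simp only: comm[of a])
  show "r *\<^sub>R a * b = r *\<^sub>R (a * b)" "a * r *\<^sub>R b = r *\<^sub>R (a * b)"
    by (transfer, simp only: scaleR_sum_right mult_scaleR_left mult_scaleR_right)+
  show "(0::even_grassmann) \<noteq> 1" by transfer (metis one_neq_zero)
  show "a + b + c = a + (b + c)" "a + b = b + a" "0 + a = a" "- a + a = 0" "a - b = a + - b"
    by (transfer, simp add: add_ac)+
  show "r *\<^sub>R (a + b) = r *\<^sub>R a + r *\<^sub>R b" "(r + s) *\<^sub>R a = r *\<^sub>R a + s *\<^sub>R a"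
    by (transfer, simp add: scaleR_add_right scaleR_add_left)+
  show "r *\<^sub>R s *\<^sub>R a = (r * s) *\<^sub>R a" "1 *\<^sub>R a = a"
    by (transfer, simp)+
qed

end

lemma gcoeff_sum: "gcoeff (sum f A) U = (\<Sum>x\<in>A. gcoeff (f x) U)"
  by (induction A rule: infinite_finite_induct) (simp_all add: zero_even_grassmann.rep_eq plus_even_grassmann.rep_eq)

section \<open>From forms at a point to Grassmann elements\<close>

definition even_form :: "'v mform \<Rightarrow> bool" where
  "even_form \<alpha> \<longleftrightarrow> (\<forall>vs. odd (length vs) \<longrightarrow> mapply \<alpha> vs = 0)"

text \<open>The form is remembered only through its values on sublists of \<open>vs\<close>, indexed
  by their positions. Odd sublists are discarded so that the result lies in the commutative even
  part.\<close>

definition pull :: "'v list \<Rightarrow> 'v mform \<Rightarrow> even_grassmann" where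
  "pull vs \<alpha> = Grassmann (\<lambda>S. if S \<subseteq> {..<length vs} \<and> even (card S) then mapply \<alpha> (nths vs S) else 0)"

lemma gcoeff_pull: "gcoeff (pull vs \<alpha>) S =
    (if S \<subseteq> {..<length vs} \<and> even (card S) then mapply \<alpha> (nths vs S) else 0)"
  unfolding pull_def by (subst Grassmann_inverse) (auto intro: finite_subset)

lemma pull_eqI:
  assumes "\<And>S. S \<subseteq> {..<length vs} \<Longrightarrow> even (card S) \<Longrightarrow> mapply \<alpha> (nths vs S) = gcoeff a S"
    and "\<And>S. \<not> S \<subseteq> {..<length vs} \<Longrightarrow> gcoeff a S = 0"
  shows "pull vs \<alpha> = a"
  using assms gcoeff_eq_0[of _ a]
  by (intro gcoeff_inject[THEN iffD1] ext) (auto simp: gcoeff_pull)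

lemma pull_0 [simp]: "pull vs 0 = 0"
  by (rule pull_eqI) (simp_all add: zero_mform.rep_eq zero_even_grassmann.rep_eq)

lemma pull_add [simp]: "pull vs (\<alpha> + \<beta>) = pull vs \<alpha> + pull vs \<beta>"
  by (rule pull_eqI) (simp_all add: plus_mform.rep_eq plus_even_grassmann.rep_eq gcoeff_pull)

lemma pull_diff [simp]: "pull vs (\<alpha> - \<beta>) = pull vs \<alpha> - pull vs \<beta>"
  by (rule pull_eqI) (simp_all add: minus_mform.rep_eq minus_even_grassmann.rep_eq gcoeff_pull)

lemma pull_uminus [simp]: "pull vs (- \<alpha>) = - pull vs \<alpha>"
  by (rule pull_eqI) (simp_all add: uminus_mform.rep_eq uminus_even_grassmann.rep_eq gcoeff_pull)

lemma pull_scaleR [simp]: "pull vs (r *\<^sub>R \<alpha>) = r *\<^sub>R pull vs \<alpha>"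
  by (rule pull_eqI) (simp_all add: scaleR_mform.rep_eq scaleR_even_grassmann.rep_eq gcoeff_pull)

lemma pull_sum [simp]: "pull vs (sum f A) = (\<Sum>x\<in>A. pull vs (f x))"
  by (induction A rule: infinite_finite_induct) simp_all

lemma length_nths_subset:
  assumes "S \<subseteq> {..<length vs}"
  shows "length (nths vs S) = card S"
proof -
  have "{i. i < length vs \<and> i \<in> S} = S" using assms by auto
  then show ?thesis by (simp add: length_nths)
qed

lemma pull_1 [simp]: "pull vs 1 = 1"
proof (rule pull_eqI)
  fix S assume S: "S \<subseteq> {..<length vs}"
  then have "nths vs S = [] \<longleftrightarrow> S = {}"
    using length_nths_subset[OF S] finite_subset[OF S] by (metis card_0_eq finite_lessThan length_0_conv)
  then show "mapply 1 (nths vs S) = gcoeff 1 S"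
    by (simp add: one_mform.rep_eq one_even_grassmann.rep_eq)
qed (auto simp: one_even_grassmann.rep_eq)

section \<open>Compatibility of \<open>pull\<close> with wedge products\<close>

definition position :: "nat set \<Rightarrow> nat \<Rightarrow> nat" where
  "position U i = card {i' \<in> U. i' < i}"

lemma strict_mono_on_position: "finite U \<Longrightarrow> strict_mono_on U (position U)"
  unfolding position_def by (auto simp: strict_mono_on_def intro!: psubset_card_mono)

lemma bij_betw_position:
  assumes "finite U"
  shows "bij_betw (position U) U {..<card U}"
proof -
  have inj: "inj_on (position U) U"
    using strict_mono_on_imp_inj_on[OF strict_mono_on_position[OF assms]] .
  have sub: "position U ` U \<subseteq> {..<card U}"
    using assms by (auto simp: position_def intro!: psubset_card_mono)
  then have "position U ` U = {..<card U}"
    by (intro card_subset_eq) (simp_all add: card_image[OF inj])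
  with inj show ?thesis by (simp add: bij_betw_def)
qed

text \<open>\<open>position U\<close> is the order isomorphism from U to the positions of
  \<open>nths vs U\<close>; it matches the shuffles of the sublist with the subsets of U and
  preserves their signs. Hence the product on any sublist is expressed by values on sublists of
  \<open>vs\<close>, with no appeal to linearity or alternation.\<close>

lemma mapply_times_nths:
  assumes U: "U \<subseteq> {..<length vs}"
  shows "mapply (\<alpha> * \<beta>) (nths vs U) =
    (\<Sum>S\<in>Pow U. koszul_sign S (U - S) * mapply \<alpha> (nths vs S) * mapply \<beta> (nths vs (U - S)))"
proof -
  have fin: "finite U" using U finite_subset by blast
  let ?r = "position U"
  note bij = bij_betw_position[OF fin]
  have inj: "inj_on ?r U" and img: "?r ` U = {..<card U}" using bij by (auto simp: bij_betw_def)
  have "mapply (\<alpha> * \<beta>) (nths vs U) = (\<Sum>T\<in>Pow (?r ` U). shuffle_sign (card U) T *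
      mapply \<alpha> (nths (nths vs U) T) * mapply \<beta> (nths (nths vs U) (- T)))"
    by (simp add: times_mform.rep_eq length_nths_subset[OF U] img)
  also have "\<dots> = (\<Sum>S\<in>Pow U. shuffle_sign (card U) (?r ` S) *
      mapply \<alpha> (nths (nths vs U) (?r ` S)) * mapply \<beta> (nths (nths vs U) (- (?r ` S))))"
    unfolding image_Pow_surj[OF refl, symmetric]
    by (rule sum.reindex[unfolded o_def]) (rule inj_on_image_Pow[OF inj])
  also have "\<dots> = (\<Sum>S\<in>Pow U. koszul_sign S (U - S) * mapply \<alpha> (nths vs S) * mapply \<beta> (nths vs (U - S)))"
  proof (rule sum.cong[OF refl])
    fix S assume "S \<in> Pow U"
    then have S: "S \<subseteq> U" by simp
    have mem: "?r i \<in> ?r ` S \<longleftrightarrow> i \<in> S" if "i \<in> U" for i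
      using inj_on_image_mem_iff[OF inj that S] .
    have 1: "nths (nths vs U) (?r ` S) = nths vs S"
      unfolding nths_nths using mem S by (intro arg_cong2[where f = nths] refl) (auto simp: position_def)
    have 2: "nths (nths vs U) (- (?r ` S)) = nths vs (U - S)"
      unfolding nths_nths using mem S by (intro arg_cong2[where f = nths] refl) (auto simp: position_def)
    have "{..<card U} - ?r ` S = ?r ` (U - S)"
      using inj_on_image_set_diff[OF inj _ S, of U] img by auto
    then have 3: "shuffle_sign (card U) (?r ` S) = koszul_sign S (U - S)"
      using shuffle_sign_eq_koszul_sign[of "?r ` S" "card U"] S img
        koszul_sign_reindex[OF strict_mono_on_position[OF fin] S, of "U - S"]
      by (metis Diff_subset image_mono)
    show "shuffle_sign (card U) (?r ` S) * mapply \<alpha> (nths (nths vs U) (?r ` S)) *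
        mapply \<beta> (nths (nths vs U) (- (?r ` S)))
      = koszul_sign S (U - S) * mapply \<alpha> (nths vs S) * mapply \<beta> (nths vs (U - S))"
      by (simp only: 1 2 3)
  qed
  finally show ?thesis .
qed

lemma card_subset_split:
  assumes "finite U" "S \<subseteq> U" shows "card U = card S + card (U - S)"
  using assms by (simp add: card_Diff_subset finite_subset card_mono)

text \<open>For U of even size the sets S and U - S have equal parity. The terms with both odd are
  invisible to \<open>pull\<close>, and they vanish because the left factor is even.\<close>

lemma pull_times:
  assumes "even_form \<alpha>"
  shows "pull vs (\<alpha> * \<beta>) = pull vs \<alpha> * pull vs \<beta>"
proof (rule pull_eqI)
  fix U assume U: "U \<subseteq> {..<length vs}" and ev: "even (card U)"
  have fin: "finite U" using U finite_subset by blast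
  show "mapply (\<alpha> * \<beta>) (nths vs U) = gcoeff (pull vs \<alpha> * pull vs \<beta>) U"
    unfolding mapply_times_nths[OF U] times_even_grassmann.rep_eq
  proof (rule sum.cong[OF refl])
    fix S assume "S \<in> Pow U"
    then have S: "S \<subseteq> U" by simp
    then have c: "card U = card S + card (U - S)" using card_subset_split[OF fin] by simp
    show "koszul_sign S (U - S) * mapply \<alpha> (nths vs S) * mapply \<beta> (nths vs (U - S))
        = koszul_sign S (U - S) * gcoeff (pull vs \<alpha>) S * gcoeff (pull vs \<beta>) (U - S)"
    proof (cases "even (card S)")
      case True
      then show ?thesis using U S ev c by (auto simp: gcoeff_pull)
    next
      case False
      then have "mapply \<alpha> (nths vs S) = 0"
        using assms length_nths_subset[of S vs] S U by (auto simp: even_form_def)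
      then show ?thesis using False by (simp add: gcoeff_pull)
    qed
  qed
next
  fix U assume U: "\<not> U \<subseteq> {..<length vs}"
  then show "gcoeff (pull vs \<alpha> * pull vs \<beta>) U = 0"
    unfolding times_even_grassmann.rep_eq by (intro sum.neutral) (auto simp: gcoeff_pull)
qed

lemma mapply_eq_gcoeff_pull:
  "even (length vs) \<Longrightarrow> mapply \<alpha> vs = gcoeff (pull vs \<alpha>) {..<length vs}"
  by (simp add: gcoeff_pull nths_all)

section \<open>Homogeneous and even forms\<close>

definition deg_form :: "nat \<Rightarrow> 'v mform \<Rightarrow> bool" where
  "deg_form k \<alpha> \<longleftrightarrow> (\<forall>vs. length vs \<noteq> k \<longrightarrow> mapply \<alpha> vs = 0)"

lemma mapply_times_nonzeroD:
  assumes "mapply (\<alpha> * \<beta>) vs \<noteq> 0"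
  shows "\<exists>us ws. length us + length ws = length vs \<and> mapply \<alpha> us \<noteq> 0 \<and> mapply \<beta> ws \<noteq> 0"
proof -
  have "mapply (\<alpha> * \<beta>) (nths vs {..<length vs}) \<noteq> 0" using assms by (simp add: nths_all)
  then obtain S where "S \<in> Pow {..<length vs}"
    "koszul_sign S ({..<length vs} - S) * mapply \<alpha> (nths vs S) * mapply \<beta> (nths vs ({..<length vs} - S)) \<noteq> 0"
    unfolding mapply_times_nths[OF subset_refl] by (rule sum.not_neutral_contains_not_neutral)
  then have S: "S \<subseteq> {..<length vs}" "mapply \<alpha> (nths vs S) \<noteq> 0"
      "mapply \<beta> (nths vs ({..<length vs} - S)) \<noteq> 0"
    by simp_all
  moreover have "length (nths vs S) + length (nths vs ({..<length vs} - S)) = length vs"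
    using card_subset_split[OF _ S(1)] by (simp add: length_nths_subset[OF S(1)] length_nths_subset)
  ultimately show ?thesis by blast
qed

lemma even_form_0 [simp]: "even_form 0" by (simp add: even_form_def zero_mform.rep_eq)
lemma even_form_1 [simp]: "even_form 1" by (auto simp: even_form_def one_mform.rep_eq)
lemma even_form_add [simp]: "even_form \<alpha> \<Longrightarrow> even_form \<beta> \<Longrightarrow> even_form (\<alpha> + \<beta>)"
  by (simp add: even_form_def plus_mform.rep_eq)
lemma even_form_diff [simp]: "even_form \<alpha> \<Longrightarrow> even_form \<beta> \<Longrightarrow> even_form (\<alpha> - \<beta>)"
  by (simp add: even_form_def minus_mform.rep_eq)
lemma even_form_uminus [simp]: "even_form \<alpha> \<Longrightarrow> even_form (- \<alpha>)"
  by (simp add: even_form_def uminus_mform.rep_eq)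
lemma even_form_scaleR [simp]: "even_form \<alpha> \<Longrightarrow> even_form (r *\<^sub>R \<alpha>)"
  by (simp add: even_form_def scaleR_mform.rep_eq)
lemma even_form_times [simp]:
  assumes "even_form \<alpha>" "even_form \<beta>"
  shows "even_form (\<alpha> * \<beta>)"
  unfolding even_form_def
proof (intro allI impI, rule ccontr)
  fix vs assume odd: "odd (length vs)" and "mapply (\<alpha> * \<beta>) vs \<noteq> 0"
  then obtain us ws where "length us + length ws = length vs" "mapply \<alpha> us \<noteq> 0" "mapply \<beta> ws \<noteq> 0"
    using mapply_times_nonzeroD by blast
  moreover from this have "even (length us)" "even (length ws)"
    using assms unfolding even_form_def by blast+
  ultimately show False using odd by (metis even_add)
qed
lemma even_form_power [simp]: "even_form \<alpha> \<Longrightarrow> even_form (\<alpha> ^ k)"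
  by (induction k) simp_all
lemma even_form_sum [simp]: "(\<And>x. x \<in> A \<Longrightarrow> even_form (f x)) \<Longrightarrow> even_form (sum f A)"
  by (induction A rule: infinite_finite_induct) simp_all

lemma deg_form_even_form: "deg_form k \<alpha> \<Longrightarrow> even k \<Longrightarrow> even_form \<alpha>"
  by (auto simp: deg_form_def even_form_def)
lemma deg_form_0: "deg_form k 0" by (simp add: deg_form_def zero_mform.rep_eq)
lemma deg_form_1: "deg_form 0 1" by (simp add: deg_form_def one_mform.rep_eq)
lemma deg_form_add: "deg_form k \<alpha> \<Longrightarrow> deg_form k \<beta> \<Longrightarrow> deg_form k (\<alpha> + \<beta>)"
  by (simp add: deg_form_def plus_mform.rep_eq)
lemma deg_form_diff: "deg_form k \<alpha> \<Longrightarrow> deg_form k \<beta> \<Longrightarrow> deg_form k (\<alpha> - \<beta>)"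
  by (simp add: deg_form_def minus_mform.rep_eq)
lemma deg_form_scaleR: "deg_form k \<alpha> \<Longrightarrow> deg_form k (r *\<^sub>R \<alpha>)"
  by (simp add: deg_form_def scaleR_mform.rep_eq)
lemma deg_form_times:
  assumes "deg_form k \<alpha>" "deg_form l \<beta>"
  shows "deg_form (k + l) (\<alpha> * \<beta>)"
  unfolding deg_form_def
proof (intro allI impI, rule ccontr)
  fix vs assume "length vs \<noteq> k + l" "mapply (\<alpha> * \<beta>) vs \<noteq> 0"
  then show False
    using mapply_times_nonzeroD[of \<alpha> \<beta> vs] assms unfolding deg_form_def by force
qed
lemma deg_form_sum: "(\<And>x. x \<in> A \<Longrightarrow> deg_form k (f x)) \<Longrightarrow> deg_form k (sum f A)"
  by (induction A rule: infinite_finite_induct) (simp_all add: deg_form_0 deg_form_add)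
lemma deg_form_deg_part: "deg_form k (deg_part k \<alpha>)"
  by (simp add: deg_form_def deg_part_def Mform_inverse)

subsection \<open>The power series of homogeneous components\<close>

text \<open>Records degree as an exponent: index k holds the component of degree 2k. Forms become
  power series over a commutative ring, and degree 12 becomes the coefficient of index 6.\<close>

definition graded :: "'v list \<Rightarrow> 'v mform \<Rightarrow> even_grassmann fps" where
  "graded vs \<alpha> = Abs_fps (\<lambda>k. pull vs (deg_part (2 * k) \<alpha>))"

lemma graded_nth: "graded vs \<alpha> $ k = pull vs (deg_part (2 * k) \<alpha>)"
  by (simp add: graded_def)

lemma deg_part_linear:
  "deg_part k (0 :: 'v mform) = 0"
  "deg_part k (\<alpha> + \<beta>) = deg_part k \<alpha> + deg_part k \<beta>"
  "deg_part k (\<alpha> - \<beta>) = deg_part k \<alpha> - deg_part k \<beta>"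
  "deg_part k (- \<alpha>) = - deg_part k \<alpha>"
  "deg_part k (r *\<^sub>R \<alpha>) = r *\<^sub>R deg_part k \<alpha>"
  unfolding deg_part_def
  by (rule mapply_inject[THEN iffD1]; simp add: fun_eq_iff Mform_inverse zero_mform.rep_eq plus_mform.rep_eq
      minus_mform.rep_eq uminus_mform.rep_eq scaleR_mform.rep_eq)+

lemma graded_linear [simp]:
  "graded vs 0 = 0"
  "graded vs (\<alpha> + \<beta>) = graded vs \<alpha> + graded vs \<beta>"
  "graded vs (\<alpha> - \<beta>) = graded vs \<alpha> - graded vs \<beta>"
  "graded vs (- \<alpha>) = - graded vs \<alpha>"
  by (simp_all add: fps_eq_iff graded_nth deg_part_linear)

lemma graded_scaleR [simp]: "graded vs (r *\<^sub>R \<alpha>) = fps_const (of_real r) * graded vs \<alpha>"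
  by (simp add: fps_eq_iff graded_nth deg_part_linear scaleR_conv_of_real)

lemma graded_nth_deg_form:
  assumes "deg_form (2 * j) \<alpha>"
  shows "graded vs \<alpha> $ k = (if k = j then pull vs \<alpha> else 0)"
  unfolding graded_nth using assms
  by (intro pull_eqI)
     (auto simp: deg_part_def Mform_inverse length_nths_subset gcoeff_pull deg_form_def zero_even_grassmann.rep_eq)

lemma graded_1 [simp]: "graded vs 1 = 1"
  using graded_nth_deg_form[of 0 1 vs] by (simp add: fps_eq_iff deg_form_1)

lemma gcoeff_graded: "gcoeff (graded vs \<alpha> $ k) S = (if card S = 2 * k then gcoeff (pull vs \<alpha>) S else 0)"
  by (auto simp: graded_nth gcoeff_pull deg_part_def Mform_inverse length_nths_subset)

text \<open>For given U the term of a subset S is seen by only one index of the Cauchy product, half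
  the size of S. The double sum therefore collapses to the product formula for coefficients at sets
  of size 2k.\<close>

lemma graded_times:
  assumes "even_form \<alpha>"
  shows "graded vs (\<alpha> * \<beta>) = graded vs \<alpha> * graded vs \<beta>"
proof (rule fps_ext, rule gcoeff_inject[THEN iffD1], rule ext)
  fix k and U :: "nat set"
  have "gcoeff ((graded vs \<alpha> * graded vs \<beta>) $ k) U
      = (\<Sum>i=0..k. \<Sum>S\<in>Pow U. koszul_sign S (U - S) * gcoeff (graded vs \<alpha> $ i) S * gcoeff (graded vs \<beta> $ (k - i)) (U - S))"
    by (simp add: fps_mult_nth gcoeff_sum times_even_grassmann.rep_eq)
  also have "\<dots> = (\<Sum>S\<in>Pow U. \<Sum>i=0..k. koszul_sign S (U - S) * gcoeff (graded vs \<alpha> $ i) S * gcoeff (graded vs \<beta> $ (k - i)) (U - S))"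
    by (rule sum.swap)
  also have "\<dots> = (\<Sum>S\<in>Pow U. if card U = 2 * k then
      koszul_sign S (U - S) * gcoeff (pull vs \<alpha>) S * gcoeff (pull vs \<beta>) (U - S) else 0)"
  proof (rule sum.cong[OF refl])
    fix S assume "S \<in> Pow U"
    then have S: "S \<subseteq> U" by simp
    let ?f = "\<lambda>i. koszul_sign S (U - S) * gcoeff (graded vs \<alpha> $ i) S * gcoeff (graded vs \<beta> $ (k - i)) (U - S)"
    let ?g = "koszul_sign S (U - S) * gcoeff (pull vs \<alpha>) S * gcoeff (pull vs \<beta>) (U - S)"
    show "sum ?f {0..k} = (if card U = 2 * k then ?g else 0)"
    proof (cases "?g = 0")
      case True
      then have "?f i = 0" for i by (auto simp: gcoeff_graded)
      then have "sum ?f {0..k} = 0" by (intro sum.neutral) blast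
      then show ?thesis unfolding True by simp
    next
      case False
      then have ev: "finite S" "even (card S)" "finite (U - S)" "even (card (U - S))"
        using gcoeff_eq_0 by (metis mult_zero_left mult_zero_right)+
      then obtain a b where ab: "card S = 2 * a" "card (U - S) = 2 * b" by (meson evenE)
      have "finite U" using ev S by (metis finite_Diff2)
      then have c: "card U = 2 * (a + b)" using card_subset_split S ab by fastforce
      have "sum ?f {0..k} = (\<Sum>i=0..k. if i = a then (if k - a = b then ?g else 0) else 0)"
        by (intro sum.cong) (auto simp: gcoeff_graded ab)
      also have "\<dots> = (if card U = 2 * k then ?g else 0)"
        by (auto simp: c)
      finally show ?thesis .
    qed
  qed
  also have "\<dots> = gcoeff (graded vs (\<alpha> * \<beta>) $ k) U"
    by (simp add: gcoeff_graded pull_times[OF assms] times_even_grassmann.rep_eq)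
  finally show "gcoeff (graded vs (\<alpha> * \<beta>) $ k) U = gcoeff ((graded vs \<alpha> * graded vs \<beta>) $ k) U"
    by simp
qed

lemma graded_power: "even_form \<alpha> \<Longrightarrow> graded vs (\<alpha> ^ k) = graded vs \<alpha> ^ k"
  by (induction k) (simp_all add: graded_times)

lemma even_form_form_series:
  assumes "even_form \<alpha>"
  shows "even_form (form_series a \<alpha>)"
proof -
  have "even_form (\<Sum>k\<le>n. a k *\<^sub>R \<alpha> ^ k)" for n :: nat
    using assms by simp
  then show ?thesis
    unfolding even_form_def form_series_def by (simp add: Mform_inverse)
qed

text \<open>\<open>form_series\<close> stops at the length of the argument list, here 2k, while the
  coefficient of index k of a composition stops at k. The powers in between start beyond index k
  because the series has no constant term.\<close>

lemma graded_form_series: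
  assumes ev: "even_form \<alpha>" and 0: "graded vs \<alpha> $ 0 = 0"
  shows "graded vs (form_series a \<alpha>) = Abs_fps (\<lambda>k. of_real (a k)) oo graded vs \<alpha>"
proof (rule fps_ext)
  fix k
  have "graded vs (form_series a \<alpha>) $ k = pull vs (deg_part (2 * k) (\<Sum>j\<le>2 * k. a j *\<^sub>R \<alpha> ^ j))"
    unfolding graded_nth by (rule arg_cong[of _ _ "pull vs"]) (auto simp: deg_part_def form_series_def Mform_inverse fun_eq_iff intro!: arg_cong[of _ _ Mform])
  also have "\<dots> = graded vs (\<Sum>j\<le>2 * k. a j *\<^sub>R \<alpha> ^ j) $ k"
    by (simp add: graded_nth)
  also have "graded vs (\<Sum>j\<le>n. a j *\<^sub>R \<alpha> ^ j) = (\<Sum>j\<le>n. fps_const (of_real (a j)) * graded vs \<alpha> ^ j)" for n :: nat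
    by (induction n) (simp_all add: graded_power[OF ev] graded_times[OF ev])
  also have "(\<Sum>j\<le>2 * k. fps_const (of_real (a j)) * graded vs \<alpha> ^ j) $ k
      = (\<Sum>j\<le>2 * k. of_real (a j) * (graded vs \<alpha> ^ j) $ k)"
    by (simp add: fps_sum_nth)
  also have "\<dots> = (\<Sum>j\<in>{0..k}. of_real (a j) * (graded vs \<alpha> ^ j) $ k)"
    using startsby_zero_power_prefix[OF 0] by (intro sum.mono_neutral_right) auto
  also have "\<dots> = (Abs_fps (\<lambda>k. of_real (a k)) oo graded vs \<alpha>) $ k"
    by (simp add: fps_compose_nth)
  finally show "graded vs (form_series a \<alpha>) $ k = (Abs_fps (\<lambda>k. of_real (a k)) oo graded vs \<alpha>) $ k" .
qed

section \<open>Traces of powers of matrices\<close>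

primrec mpow :: "nat \<Rightarrow> (nat \<Rightarrow> nat \<Rightarrow> 'r::comm_ring_1) \<Rightarrow> nat \<Rightarrow> nat \<Rightarrow> nat \<Rightarrow> 'r" where
  "mpow r K 0 = (\<lambda>i j. if i = j then 1 else 0)"
| "mpow r K (Suc k) = (\<lambda>i j. \<Sum>l<r. K i l * mpow r K k l j)"

definition tr_pow :: "nat \<Rightarrow> (nat \<Rightarrow> nat \<Rightarrow> 'r::comm_ring_1) \<Rightarrow> nat \<Rightarrow> 'r" where
  "tr_pow r K k = (\<Sum>i<r. mpow r K k i i)"

definition chern :: "nat \<Rightarrow> (nat \<Rightarrow> nat \<Rightarrow> 'r::{comm_ring_1,real_algebra_1}) \<Rightarrow> 'r fps" where
  "chern r K = Abs_fps (\<lambda>k. (1 / fact k) *\<^sub>R tr_pow r K k)"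

lemma chern_nth: "chern r K $ k = (1 / fact k) *\<^sub>R tr_pow r K k"
  by (simp add: chern_def)

lemma tr_pow_0: "tr_pow r K 0 = of_nat r"
  by (simp add: tr_pow_def)

lemma sum_if_eq:
  fixes f :: "nat \<Rightarrow> 'r::comm_ring_1"
  assumes "i < r"
  shows "(\<Sum>l<r. (if i = l then 1 else 0) * f l) = f i" "(\<Sum>l<r. f l * (if l = i then 1 else 0)) = f i"
proof -
  have "(\<Sum>l<r. (if i = l then 1 else 0) * f l) = (\<Sum>l<r. if l = i then f l else 0)"
    by (intro sum.cong) auto
  then show "(\<Sum>l<r. (if i = l then 1 else 0) * f l) = f i" using assms by simp
  have "(\<Sum>l<r. f l * (if l = i then 1 else 0)) = (\<Sum>l<r. if l = i then f l else 0)"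
    by (intro sum.cong) auto
  then show "(\<Sum>l<r. f l * (if l = i then 1 else 0)) = f i" using assms by simp
qed

lemma mpow_add:
  assumes "i < r"
  shows "(\<Sum>l<r. mpow r K m i l * mpow r K n l j) = mpow r K (m + n) i j"
  using assms
proof (induction m arbitrary: i)
  case 0
  then show ?case using sum_if_eq(1)[of i r "\<lambda>l. mpow r K n l j"] by simp
next
  case (Suc m)
  have "(\<Sum>l<r. mpow r K (Suc m) i l * mpow r K n l j)
      = (\<Sum>l<r. \<Sum>h<r. K i h * (mpow r K m h l * mpow r K n l j))"
    by (simp add: sum_distrib_right mult.assoc)
  also have "\<dots> = (\<Sum>h<r. K i h * (\<Sum>l<r. mpow r K m h l * mpow r K n l j))"
    by (subst sum.swap) (simp add: sum_distrib_left)
  also have "\<dots> = (\<Sum>h<r. K i h * mpow r K (m + n) h j)"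
    by (intro sum.cong refl) (simp add: Suc.IH)
  finally show ?case by simp
qed

lemma mpow_1:
  assumes "j < r" shows "mpow r K (Suc 0) i j = K i j"
  using sum_if_eq(2)[OF assms, of "\<lambda>l. K i l"] by simp

lemma mpow_Suc_right:
  assumes "i < r" "j < r" shows "mpow r K (Suc k) i j = (\<Sum>l<r. mpow r K k i l * K l j)"
proof -
  have "mpow r K (k + Suc 0) i j = (\<Sum>l<r. mpow r K k i l * mpow r K (Suc 0) l j)"
    by (rule mpow_add[OF assms(1), symmetric])
  then show ?thesis by (simp add: mpow_1[OF assms(2)] del: mpow.simps)
qed

lemma mpow_cong:
  assumes "\<And>i j. i < r \<Longrightarrow> j < r \<Longrightarrow> K i j = L i j" "i < r" "j < r"
  shows "mpow r K k i j = mpow r L k i j"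
  using assms(2) by (induction k arbitrary: i) (simp_all add: assms(1))

lemma chern_cong:
  assumes "\<And>i j. i < r \<Longrightarrow> j < r \<Longrightarrow> K i j = L i j"
  shows "chern r K = chern r L"
  using mpow_cong[OF assms] by (simp add: chern_def tr_pow_def)

subsection \<open>Derivations of tensor products\<close>

text \<open>The Leibniz rule for powers of a derivation; in terms of exponential generating
  functions it is the product.\<close>

definition binom_conv :: "nat \<Rightarrow> (nat \<Rightarrow> 'r::comm_ring_1) \<Rightarrow> (nat \<Rightarrow> 'r) \<Rightarrow> 'r" where
  "binom_conv k f g = (\<Sum>m\<le>k. of_nat (k choose m) * f m * g (k - m))"

lemma binom_conv_Suc:
  "binom_conv (Suc k) f g = binom_conv k (\<lambda>m. f (Suc m)) g + binom_conv k f (\<lambda>m. g (Suc m))"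
proof -
  let ?h = "\<lambda>m. of_nat (k choose m) * f m * g (Suc k - m)"
  have "binom_conv (Suc k) f g = f 0 * g (Suc k) +
      (\<Sum>m\<le>k. of_nat (k choose m) * f (Suc m) * g (k - m) + of_nat (k choose Suc m) * f (Suc m) * g (k - m))"
    unfolding binom_conv_def sum.atMost_Suc_shift
    by (simp add: algebra_simps)
  also have "\<dots> = binom_conv k (\<lambda>m. f (Suc m)) g + (\<Sum>m\<le>Suc k. ?h m)"
    unfolding binom_conv_def sum.atMost_Suc_shift by (simp add: sum.distrib)
  also have "(\<Sum>m\<le>Suc k. ?h m) = (\<Sum>m\<le>k. ?h m)"
    by (simp add: binomial_eq_0)
  also have "\<dots> = binom_conv k f (\<lambda>m. g (Suc m))"
    unfolding binom_conv_def by (intro sum.cong) (simp_all add: Suc_diff_le)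
  finally show ?thesis .
qed

lemma binom_conv_commute: "binom_conv k f g = binom_conv k g f"
  unfolding binom_conv_def
  by (rule sum.reindex_bij_witness[where i = "\<lambda>m. k - m" and j = "\<lambda>m. k - m"])
     (auto simp: binomial_symmetric[symmetric] mult_ac)

lemma binom_conv_sum_left: "binom_conv k (\<lambda>m. \<Sum>x\<in>A. c x * f x m) g = (\<Sum>x\<in>A. c x * binom_conv k (f x) g)"
  unfolding binom_conv_def
  by (simp add: sum_distrib_left sum_distrib_right mult_ac) (rule sum.swap)

lemma binom_conv_sum_right: "binom_conv k f (\<lambda>m. \<Sum>x\<in>A. c x * g x m) = (\<Sum>x\<in>A. c x * binom_conv k f (g x))"
  using binom_conv_sum_left[of k c g A f] by (simp add: binom_conv_commute[of k f])

text \<open>The entry at row (i, j) and column (a, b) of the k-th power of K tensor 1 + 1 tensor L,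
  whose two summands commute. Keeping the pair of indices unencoded lets tensor products, exterior
  squares and symmetric squares share it.\<close>

abbreviation dpow :: "nat \<Rightarrow> (nat \<Rightarrow> nat \<Rightarrow> 'r::comm_ring_1) \<Rightarrow> nat \<Rightarrow> (nat \<Rightarrow> nat \<Rightarrow> 'r) \<Rightarrow>
    nat \<Rightarrow> nat \<Rightarrow> nat \<Rightarrow> nat \<Rightarrow> nat \<Rightarrow> 'r" where
  "dpow r K s L k i j a b \<equiv> binom_conv k (\<lambda>m. mpow r K m i a) (\<lambda>m. mpow s L m j b)"

lemma dpow_Suc: "dpow r K s L (Suc k) i j a b =
    (\<Sum>p<r. K i p * dpow r K s L k p j a b) + (\<Sum>q<s. L j q * dpow r K s L k i q a b)"
  by (simp add: binom_conv_Suc binom_conv_sum_left binom_conv_sum_right)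

lemma dpow_0: "dpow r K s L 0 i j a b = of_bool (i = a \<and> j = b)"
  by (simp add: binom_conv_def)

lemma sum_dpow_diagonal:
  "(\<Sum>i<r. \<Sum>j<s. dpow r K s L k i j i j) = binom_conv k (tr_pow r K) (tr_pow s L)"
proof -
  have "(\<Sum>i<r. \<Sum>j<s. dpow r K s L k i j i j)
      = (\<Sum>m\<le>k. \<Sum>i<r. \<Sum>j<s. of_nat (k choose m) * mpow r K m i i * mpow s L (k - m) j j)"
    unfolding binom_conv_def by (subst sum.swap[of _ _ "{..k}"])+ simp
  also have "\<dots> = binom_conv k (tr_pow r K) (tr_pow s L)"
    unfolding binom_conv_def tr_pow_def
    by (intro sum.cong refl) (simp add: sum_distrib_left sum_distrib_right mult_ac)
  finally show ?thesis .
qed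

text \<open>The trace of the k-th derivation power composed with the flip of the two factors. Each
  splitting of k gives the same trace of K^k, and the binomial coefficients add up to 2^k; this is
  the Adams operation psi^2.\<close>

lemma sum_dpow_swapped:
  "(\<Sum>i<r. \<Sum>j<r. dpow r K r K k j i i j) = 2 ^ k * tr_pow r K k"
proof -
  have "(\<Sum>i<r. \<Sum>j<r. dpow r K r K k j i i j)
      = (\<Sum>m\<le>k. \<Sum>i<r. \<Sum>j<r. of_nat (k choose m) * mpow r K m j i * mpow r K (k - m) i j)"
    unfolding binom_conv_def by (subst sum.swap[of _ _ "{..k}"])+ simp
  also have "\<dots> = (\<Sum>m\<le>k. of_nat (k choose m) * (\<Sum>i<r. \<Sum>j<r. mpow r K (k - m) i j * mpow r K m j i))"
    by (intro sum.cong refl) (simp add: sum_distrib_left mult_ac)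
  also have "\<dots> = (\<Sum>m\<le>k. of_nat (k choose m) * tr_pow r K k)"
    by (intro sum.cong refl) (simp add: tr_pow_def mpow_add)
  also have "\<dots> = of_nat (\<Sum>m\<le>k. k choose m) * tr_pow r K k"
    by (simp add: sum_distrib_right)
  also have "\<dots> = 2 ^ k * tr_pow r K k"
    by (simp add: choose_row_sum)
  finally show ?thesis .
qed

lemma chern_mult_nth:
  "(chern r K * chern s L) $ k = (1 / fact k) *\<^sub>R binom_conv k (tr_pow r K) (tr_pow s L)"
  unfolding fps_mult_nth binom_conv_def chern_nth scaleR_sum_right atLeast0AtMost
proof (intro sum.cong refl)
  fix m assume "m \<in> {..k}"
  then have "(1 / fact m :: real) * (1 / fact (k - m)) = (1 / fact k) * real (k choose m)"
    using binomial_fact[of m k, where 'a = real] by (simp add: field_simps)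
  moreover have "of_nat (k choose m) * x = real (k choose m) *\<^sub>R x" for x :: 'a
    by (simp add: scaleR_conv_of_real)
  ultimately show "(1 / fact m) *\<^sub>R tr_pow r K m * (1 / fact (k - m)) *\<^sub>R tr_pow s L (k - m)
      = (1 / fact k) *\<^sub>R (of_nat (k choose m) * tr_pow r K m * tr_pow s L (k - m))"
    by (simp only: mult_scaleR_left mult_scaleR_right scaleR_scaleR mult.assoc mult.commute[of "1 / fact (k - m)"])
qed

subsection \<open>Tensor products\<close>

definition tensor_mat :: "nat \<Rightarrow> (nat \<Rightarrow> nat \<Rightarrow> 'r::comm_ring_1) \<Rightarrow> (nat \<Rightarrow> nat \<Rightarrow> 'r) \<Rightarrow> nat \<Rightarrow> nat \<Rightarrow> 'r" where
  "tensor_mat s K L a b = of_bool (a mod s = b mod s) * K (a div s) (b div s)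
     + of_bool (a div s = b div s) * L (a mod s) (b mod s)"

lemma sum_div_mod: "(\<Sum>a<r * s. f (a div s) (a mod s)) = (\<Sum>i<r. \<Sum>j<s. f i j)" for s :: nat
proof -
  have "(\<Sum>a<r * s. f (a div s) (a mod s)) = (\<Sum>(i, j)\<in>{..<r} \<times> {..<s}. f i j)"
  proof (rule sum.reindex_bij_witness[where i = "\<lambda>(i, j). i * s + j" and j = "\<lambda>a. (a div s, a mod s)"])
    fix a assume a: "a \<in> {..<r * s}"
    then have "s > 0" by (cases s) auto
    then show "(a div s, a mod s) \<in> {..<r} \<times> {..<s}"
      using a by (auto simp: less_mult_imp_div_less)
  next
    fix b assume "b \<in> {..<r} \<times> {..<s}"
    then obtain i j where b: "b = (i, j)" "Suc i \<le> r" "j < s" by (cases b) auto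
    have "i * s + j < Suc i * s" using b(3) by simp
    also have "\<dots> \<le> r * s" using b(2) by (rule mult_le_mono1)
    finally show "(case b of (i, j) \<Rightarrow> i * s + j) \<in> {..<r * s}" by (simp add: b(1))
  qed auto
  then show ?thesis by (simp add: sum.cartesian_product)
qed

lemma sum_of_bool_mult:
  fixes f :: "nat \<Rightarrow> 'r::comm_ring_1"
  assumes "i < r"
  shows "(\<Sum>l<r. of_bool (i = l) * f l) = f i" "(\<Sum>l<r. of_bool (l = i) * f l) = f i"
    "(\<Sum>l<r. f l * of_bool (i = l)) = f i" "(\<Sum>l<r. f l * of_bool (l = i)) = f i"
  using sum_if_eq[OF assms, of f] by (simp_all add: of_bool_def mult.commute eq_commute[of i])

lemma sum_mult_of_bool:
  fixes f :: "nat \<Rightarrow> 'r::comm_ring_1"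
  assumes "i < r" shows "(\<Sum>l<r. f l * (of_bool (l = i) * x)) = f i * x"
  using sum_of_bool_mult(4)[OF assms, of f] by (simp only: mult.assoc[symmetric] sum_distrib_right[symmetric])

lemma sum_mult_of_bool_const:
  fixes f :: "nat \<Rightarrow> 'r::comm_ring_1"
  shows "(\<Sum>l<r. f l * (of_bool P * h l)) = of_bool P * (\<Sum>l<r. f l * h l)"
  by (cases P) simp_all

text \<open>Applies one derivation to a tensor n with two indices. Taking a power for n gives the
  induction step of \<open>mpow_tensor_mat\<close>; taking a second derivation for n gives the
  commutator.\<close>

lemma tensor_mat_step:
  fixes K L :: "nat \<Rightarrow> nat \<Rightarrow> 'r::comm_ring_1"
  assumes "a < r * s"
  shows "(\<Sum>c<r * s. tensor_mat s K L a c * n (c div s) (c mod s)) =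
    (\<Sum>p<r. K (a div s) p * n p (a mod s)) + (\<Sum>q<s. L (a mod s) q * n (a div s) q)"
proof -
  have s: "s > 0" using assms by (cases s) auto
  then have d: "a div s < r" "a mod s < s" using assms by (auto simp: less_mult_imp_div_less)
  have "(\<Sum>c<r * s. tensor_mat s K L a c * n (c div s) (c mod s)) =
    (\<Sum>p<r. \<Sum>q<s. (of_bool (a mod s = q) * K (a div s) p + of_bool (a div s = p) * L (a mod s) q) * n p q)"
    unfolding tensor_mat_def by (rule sum_div_mod)
  also have "\<dots> = (\<Sum>p<r. \<Sum>q<s. of_bool (a mod s = q) * (K (a div s) p * n p q))
      + (\<Sum>q<s. \<Sum>p<r. of_bool (a div s = p) * (L (a mod s) q * n p q))"
    unfolding sum.swap[of _ "{..<s}" "{..<r}"] by (simp add: sum.distrib algebra_simps)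
  finally show ?thesis by (simp add: sum_of_bool_mult d)
qed

lemma mpow_tensor_mat:
  assumes "a < r * s" "b < r * s"
  shows "mpow (r * s) (tensor_mat s K L) k a b = dpow r K s L k (a div s) (a mod s) (b div s) (b mod s)"
  using assms(1)
proof (induction k arbitrary: a)
  case 0
  have "a = b \<longleftrightarrow> a div s = b div s \<and> a mod s = b mod s"
    by (metis div_mult_mod_eq)
  then show ?case unfolding dpow_0 by simp
next
  case (Suc k)
  then show ?case
    unfolding dpow_Suc tensor_mat_step[OF Suc.prems, of K L "\<lambda>p q. dpow r K s L k p q (b div s) (b mod s)", symmetric]
    by simp
qed

lemma chern_tensor_mat: "chern (r * s) (tensor_mat s K L) = chern r K * chern s L"
proof (rule fps_ext)
  fix k
  have "tr_pow (r * s) (tensor_mat s K L) k = (\<Sum>a<r * s. dpow r K s L k (a div s) (a mod s) (a div s) (a mod s))"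
    unfolding tr_pow_def by (intro sum.cong refl) (simp add: mpow_tensor_mat)
  also have "\<dots> = binom_conv k (tr_pow r K) (tr_pow s L)"
    unfolding sum_div_mod[of "\<lambda>i j. dpow r K s L k i j i j"] sum_dpow_diagonal ..
  finally show "chern (r * s) (tensor_mat s K L) $ k = (chern r K * chern s L) $ k"
    by (simp add: chern_mult_nth chern_nth)
qed

text \<open>Sending (K, L) to K tensor 1 + 1 tensor L respects commutators, as the mixed terms
  cancel. This handles the quadratic part of the curvature; \<open>wedge2_mat_commutator\<close> and
  \<open>sym2_mat_commutator\<close> do the same for the squares.\<close>

lemma tensor_mat_commutator:
  fixes K L K' L' :: "nat \<Rightarrow> nat \<Rightarrow> 'r::comm_ring_1"
  assumes "a < r * s" "b < r * s"
  shows "(\<Sum>c<r * s. tensor_mat s K L a c * tensor_mat s K' L' c b - tensor_mat s K' L' a c * tensor_mat s K L c b)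
    = tensor_mat s (\<lambda>i j. \<Sum>l<r. K i l * K' l j - K' i l * K l j) (\<lambda>i j. \<Sum>l<s. L i l * L' l j - L' i l * L l j) a b"
proof -
  have s: "s > 0" using assms by (cases s) auto
  then have d: "a div s < r" "a mod s < s" "b div s < r" "b mod s < s"
    using assms by (auto simp: less_mult_imp_div_less)
  have prod: "(\<Sum>c<r * s. tensor_mat s K L a c * tensor_mat s K' L' c b)
     = (\<Sum>p<r. K (a div s) p * (of_bool (a mod s = b mod s) * K' p (b div s) + of_bool (p = b div s) * L' (a mod s) (b mod s)))
     + (\<Sum>q<s. L (a mod s) q * (of_bool (q = b mod s) * K' (a div s) (b div s) + of_bool (a div s = b div s) * L' q (b mod s)))"
    for K L K' L' :: "nat \<Rightarrow> nat \<Rightarrow> 'r"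
    using tensor_mat_step[OF assms(1), of K L "\<lambda>p q. of_bool (q = b mod s) * K' p (b div s) + of_bool (p = b div s) * L' q (b mod s)"]
    by (simp add: tensor_mat_def[of s K' L'])
  have "(\<Sum>c<r * s. tensor_mat s K L a c * tensor_mat s K' L' c b)
     = of_bool (a mod s = b mod s) * (\<Sum>p<r. K (a div s) p * K' p (b div s))
      + K (a div s) (b div s) * L' (a mod s) (b mod s) + K' (a div s) (b div s) * L (a mod s) (b mod s)
      + of_bool (a div s = b div s) * (\<Sum>q<s. L (a mod s) q * L' q (b mod s))"
    for K L K' L' :: "nat \<Rightarrow> nat \<Rightarrow> 'r"
    unfolding prod distrib_left sum.distrib sum_mult_of_bool[OF d(3)] sum_mult_of_bool[OF d(4)] sum_mult_of_bool_const
    by (simp only: mult.commute[of "K' _ _"] add_ac)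
  then show ?thesis
    by (simp only: sum_subtractf tensor_mat_def right_diff_distrib) (simp only: mult.commute algebra_simps)
qed

subsection \<open>Exterior and symmetric squares\<close>

definition wedge2_mat :: "nat \<Rightarrow> (nat \<Rightarrow> nat \<Rightarrow> 'r::comm_ring_1) \<Rightarrow> nat \<Rightarrow> nat \<Rightarrow> 'r" where
  "wedge2_mat r K a b = (let (i, j) = pairs_less r ! a; (k, l) = pairs_less r ! b in
     of_bool (j = l) * K i k - of_bool (i = l) * K j k + of_bool (i = k) * K j l - of_bool (j = k) * K i l)"

text \<open>For i = j the four terms count each contribution to the basis vector e_i e_i twice; the
  weight 1/2 corrects this.\<close>

definition sym2_mat :: "nat \<Rightarrow> (nat \<Rightarrow> nat \<Rightarrow> 'r::{comm_ring_1,real_algebra_1}) \<Rightarrow> nat \<Rightarrow> nat \<Rightarrow> 'r" where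
  "sym2_mat r K a b = (let (i, j) = pairs_le r ! a; (k, l) = pairs_le r ! b in
     (1 / (if i = j then 2 else 1)) *\<^sub>R
     (of_bool (j = l) * K i k + of_bool (i = l) * K j k + of_bool (i = k) * K j l + of_bool (j = k) * K i l))"

lemma set_pairs_less: "set (pairs_less r) = {(i, j). i < j \<and> j < r}"
  by (auto simp: pairs_less_def image_iff)

lemma set_pairs_le: "set (pairs_le r) = {(i, j). i \<le> j \<and> j < r}"
  by (auto simp: pairs_le_def image_iff)

lemma distinct_pairs: "distinct (concat (map (\<lambda>i. map (\<lambda>j. (i, j)) [f i..<r]) xs))" if "distinct xs"
  using that by (induction xs) (auto simp: distinct_map inj_on_def)

lemma distinct_pairs_less: "distinct (pairs_less r)"
  unfolding pairs_less_def using distinct_pairs[of "[0..<r]" Suc r] by simp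

lemma distinct_pairs_le: "distinct (pairs_le r)"
  unfolding pairs_le_def using distinct_pairs[of "[0..<r]" "\<lambda>i. i" r] by simp

lemma sum_nth_distinct: "distinct xs \<Longrightarrow> (\<Sum>c<length xs. f (xs ! c)) = sum f (set xs)"
  by (rule sum.reindex_bij_betw) (rule bij_betw_nth[OF _ refl refl])

lemma sum_square_triangle:
  fixes G :: "nat \<Rightarrow> nat \<Rightarrow> 'r::ab_group_add"
  shows "(\<Sum>(p, q)\<in>{(p, q). p < q \<and> q < r}. G p q + G q p) + (\<Sum>p<r. G p p) = (\<Sum>p<r. \<Sum>q<r. G p q)"
proof -
  let ?A = "{(p, q). p < q \<and> q < r}" and ?B = "{(p, q). q < p \<and> p < r}" and ?D = "(\<lambda>p. (p, p)) ` {..<r}"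
  have fin: "finite ?A" "finite ?B"
    by (rule finite_subset[of _ "{..<r} \<times> {..<r}"], auto)+
  have "(\<Sum>(p, q)\<in>?A. G q p) = (\<Sum>(p, q)\<in>?B. G p q)"
    by (rule sum.reindex_bij_witness[where i = prod.swap and j = prod.swap]) auto
  moreover have "(\<Sum>p<r. G p p) = (\<Sum>(p, q)\<in>?D. G p q)"
    by (simp add: sum.reindex inj_on_def)
  ultimately have "(\<Sum>(p, q)\<in>?A. G p q + G q p) + (\<Sum>p<r. G p p)
      = (\<Sum>(p, q)\<in>?A. G p q) + (\<Sum>(p, q)\<in>?B. G p q) + (\<Sum>(p, q)\<in>?D. G p q)"
    by (simp add: sum.distrib case_prod_unfold)
  also have "\<dots> = (\<Sum>(p, q)\<in>?A \<union> ?B \<union> ?D. G p q)"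
    using fin by (subst sum.union_disjoint, auto)+
  also have "?A \<union> ?B \<union> ?D = {..<r} \<times> {..<r}"
    by (auto simp: image_iff)
  finally show ?thesis by (simp add: sum.cartesian_product)
qed

text \<open>A pair p < q stands for both orders, so sums over the basis of the exterior square turn
  into sums over the full square. In \<open>sum_pairs_le\<close> the diagonal is part of the basis
  and is counted once.\<close>

lemma sum_pairs_less:
  fixes G :: "nat \<Rightarrow> nat \<Rightarrow> 'r::ab_group_add"
  assumes "\<And>p q. p < q \<Longrightarrow> q < r \<Longrightarrow> f (p, q) = G p q + G q p" "\<And>p. p < r \<Longrightarrow> G p p = 0"
  shows "(\<Sum>c<length (pairs_less r). f (pairs_less r ! c)) = (\<Sum>p<r. \<Sum>q<r. G p q)"
  unfolding sum_nth_distinct[OF distinct_pairs_less] set_pairs_less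
  using assms by (subst sum_square_triangle[symmetric]) (auto intro!: sum.cong)

lemma sum_pairs_le:
  fixes G :: "nat \<Rightarrow> nat \<Rightarrow> 'r::ab_group_add"
  assumes "\<And>p q. p < q \<Longrightarrow> q < r \<Longrightarrow> f (p, q) = G p q + G q p" "\<And>p. p < r \<Longrightarrow> f (p, p) = G p p"
  shows "(\<Sum>c<length (pairs_le r). f (pairs_le r ! c)) = (\<Sum>p<r. \<Sum>q<r. G p q)"
proof -
  let ?A = "{(p, q). p < q \<and> q < r}" and ?D = "(\<lambda>p. (p, p)) ` {..<r}"
  have "finite ?A" by (rule finite_subset[of _ "{..<r} \<times> {..<r}"]) auto
  then have "sum f (?A \<union> ?D) = sum f ?A + sum f ?D"
    by (intro sum.union_disjoint) auto
  moreover have "?A \<union> ?D = {(i, j). i \<le> j \<and> j < r}"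
    by (auto simp: image_iff)
  moreover have "sum f ?A = (\<Sum>(p, q)\<in>?A. G p q + G q p)"
    using assms(1) by (intro sum.cong) auto
  moreover have "sum f ?D = (\<Sum>p<r. G p p)"
    using assms(2) by (simp add: sum.reindex inj_on_def)
  ultimately show ?thesis
    unfolding sum_nth_distinct[OF distinct_pairs_le] set_pairs_le sum_square_triangle[symmetric] by simp
qed

lemma pairs_less_nth:
  assumes "a < length (pairs_less r)" "pairs_less r ! a = (i, j)" shows "i < j" "j < r"
  using nth_mem[OF assms(1)] unfolding assms(2) set_pairs_less by auto

lemma pairs_le_nth:
  assumes "a < length (pairs_le r)" "pairs_le r ! a = (i, j)" shows "i \<le> j" "j < r"
  using nth_mem[OF assms(1)] unfolding assms(2) set_pairs_le by auto

lemma sum_derivation: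
  fixes K :: "nat \<Rightarrow> nat \<Rightarrow> 'r::comm_ring_1"
  assumes "i < r" "j < r"
  shows "(\<Sum>p<r. \<Sum>q<r. (of_bool (j = q) * K i p + of_bool (i = p) * K j q) * N p q)
    = (\<Sum>p<r. K i p * N p j) + (\<Sum>q<r. K j q * N i q)"
proof -
  have "(\<Sum>p<r. \<Sum>q<r. (of_bool (j = q) * K i p + of_bool (i = p) * K j q) * N p q)
    = (\<Sum>p<r. \<Sum>q<r. of_bool (j = q) * (K i p * N p q)) + (\<Sum>q<r. \<Sum>p<r. of_bool (i = p) * (K j q * N p q))"
    unfolding sum.swap[of "\<lambda>q p. of_bool (i = p) * (K j q * N p q)"] by (simp add: sum.distrib algebra_simps)
  then show ?thesis by (simp add: sum_of_bool_mult assms)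
qed

text \<open>Vectors of the exterior square are written as antisymmetrised tensors; on tensors the
  matrix acts by the Leibniz rule in both slots, as in \<open>sum_derivation\<close>.\<close>

lemma wedge2_mat_step:
  fixes K :: "nat \<Rightarrow> nat \<Rightarrow> 'r::comm_ring_1"
  assumes a: "a < length (pairs_less r)" "pairs_less r ! a = (i, j)"
    and N: "\<And>c. c < length (pairs_less r) \<Longrightarrow> N c = (case pairs_less r ! c of (p, q) \<Rightarrow> n p q - n q p)"
  shows "(\<Sum>c<length (pairs_less r). wedge2_mat r K a c * N c) =
    (\<Sum>p<r. K i p * (n p j - n j p)) + (\<Sum>q<r. K j q * (n i q - n q i))"
proof -
  have ij: "i < r" "j < r" using pairs_less_nth[OF a] by auto
  have "(\<Sum>c<length (pairs_less r). wedge2_mat r K a c * N c) = (\<Sum>c<length (pairs_less r). case pairs_less r ! c of (p, q) \<Rightarrow>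
     (of_bool (j = q) * K i p - of_bool (i = q) * K j p + of_bool (i = p) * K j q - of_bool (j = p) * K i q) * (n p q - n q p))"
    by (intro sum.cong refl) (simp add: wedge2_mat_def a(2) N case_prod_unfold Let_def)
  also have "\<dots> = (\<Sum>p<r. \<Sum>q<r. (of_bool (j = q) * K i p + of_bool (i = p) * K j q) * (n p q - n q p))"
    by (rule sum_pairs_less) (simp_all add: algebra_simps)
  finally show ?thesis using sum_derivation[OF ij] by simp
qed

text \<open>The symmetric analogue of \<open>wedge2_mat_step\<close>. The symmetrised tensor has n p
  p + n p p on the diagonal, hence the weight 1/2 there.\<close>

lemma sym2_mat_step:
  fixes K :: "nat \<Rightarrow> nat \<Rightarrow> 'r::{comm_ring_1,real_algebra_1}"
  assumes a: "a < length (pairs_le r)" "pairs_le r ! a = (i, j)"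
    and N: "\<And>c. c < length (pairs_le r) \<Longrightarrow>
      N c = (case pairs_le r ! c of (p, q) \<Rightarrow> (1 / (if p = q then 2 else 1)) *\<^sub>R (n p q + n q p))"
  shows "(\<Sum>c<length (pairs_le r). sym2_mat r K a c * N c) = (1 / (if i = j then 2 else 1)) *\<^sub>R
    ((\<Sum>p<r. K i p * (n p j + n j p)) + (\<Sum>q<r. K j q * (n i q + n q i)))"
proof -
  have ij: "i < r" "j < r" using pairs_le_nth[OF a] by auto
  let ?w = "1 / (if i = j then 2 else 1) :: real"
  have half: "(1 / 2) *\<^sub>R (x + x) = x" for x :: 'r
    by (simp flip: scaleR_2)
  have "(\<Sum>c<length (pairs_le r). sym2_mat r K a c * N c) = (\<Sum>c<length (pairs_le r). ?w *\<^sub>R (case pairs_le r ! c of (p, q) \<Rightarrow>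
     (of_bool (j = q) * K i p + of_bool (i = q) * K j p + of_bool (i = p) * K j q + of_bool (j = p) * K i q)
      * ((1 / (if p = q then 2 else 1)) *\<^sub>R (n p q + n q p))))"
    by (intro sum.cong refl) (simp only: sym2_mat_def a(2) N case_prod_unfold Let_def fst_conv snd_conv
        lessThan_iff mult_scaleR_left)
  also have "\<dots> = ?w *\<^sub>R (\<Sum>c<length (pairs_le r). case pairs_le r ! c of (p, q) \<Rightarrow>
     (of_bool (j = q) * K i p + of_bool (i = q) * K j p + of_bool (i = p) * K j q + of_bool (j = p) * K i q)
      * ((1 / (if p = q then 2 else 1)) *\<^sub>R (n p q + n q p)))"
    by (rule scaleR_sum_right[symmetric])
  also have "(\<Sum>c<length (pairs_le r). case pairs_le r ! c of (p, q) \<Rightarrow>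
     (of_bool (j = q) * K i p + of_bool (i = q) * K j p + of_bool (i = p) * K j q + of_bool (j = p) * K i q)
      * ((1 / (if p = q then 2 else 1)) *\<^sub>R (n p q + n q p)))
    = (\<Sum>p<r. \<Sum>q<r. (of_bool (j = q) * K i p + of_bool (i = p) * K j q) * (n p q + n q p))"
  proof (rule sum_pairs_le)
    fix p
    show "(case (p, p) of (p, q) \<Rightarrow>
      (of_bool (j = q) * K i p + of_bool (i = q) * K j p + of_bool (i = p) * K j q + of_bool (j = p) * K i q)
        * ((1 / (if p = q then 2 else 1)) *\<^sub>R (n p q + n q p)))
      = (of_bool (j = p) * K i p + of_bool (i = p) * K j p) * (n p p + n p p)"
      by (simp only: case_prod_conv if_True refl half) (simp only: algebra_simps)
  qed (simp add: algebra_simps)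
  finally show ?thesis by (simp only: sum_derivation[OF ij, of K "\<lambda>p q. n p q + n q p"])
qed

lemma mpow_wedge2_mat:
  assumes "a < length (pairs_less r)" "b < length (pairs_less r)" "pairs_less r ! b = (k, l)"
  shows "mpow (length (pairs_less r)) (wedge2_mat r K) n a b =
    (case pairs_less r ! a of (i, j) \<Rightarrow> dpow r K r K n i j k l - dpow r K r K n j i k l)"
  using assms(1)
proof (induction n arbitrary: a)
  case 0
  obtain i j where ij: "pairs_less r ! a = (i, j)" by fastforce
  have "a = b \<longleftrightarrow> (i, j) = (k, l)"
    using nth_eq_iff_index_eq[OF distinct_pairs_less 0 assms(2)] ij assms(3) by simp
  then show ?case
    using pairs_less_nth[OF 0 ij] pairs_less_nth[OF assms(2,3)] by (auto simp: dpow_0 ij)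
next
  case (Suc n)
  obtain i j where ij: "pairs_less r ! a = (i, j)" by fastforce
  have "mpow (length (pairs_less r)) (wedge2_mat r K) (Suc n) a b
      = (\<Sum>p<r. K i p * (dpow r K r K n p j k l - dpow r K r K n j p k l))
       + (\<Sum>q<r. K j q * (dpow r K r K n i q k l - dpow r K r K n q i k l))"
    unfolding mpow.simps by (rule wedge2_mat_step[OF Suc.prems ij]) (rule Suc.IH)
  then show ?case
    by (simp add: ij dpow_Suc right_diff_distrib sum_subtractf)
qed

lemma mpow_sym2_mat:
  fixes K :: "nat \<Rightarrow> nat \<Rightarrow> 'r::{comm_ring_1,real_algebra_1}"
  assumes "a < length (pairs_le r)" "b < length (pairs_le r)" "pairs_le r ! b = (k, l)"
  shows "mpow (length (pairs_le r)) (sym2_mat r K) n a b =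
    (case pairs_le r ! a of (i, j) \<Rightarrow>
      (1 / (if i = j then 2 else 1)) *\<^sub>R (dpow r K r K n i j k l + dpow r K r K n j i k l))"
  using assms(1)
proof (induction n arbitrary: a)
  case 0
  obtain i j where ij: "pairs_le r ! a = (i, j)" by fastforce
  have "a = b \<longleftrightarrow> (i, j) = (k, l)"
    using nth_eq_iff_index_eq[OF distinct_pairs_le 0 assms(2)] ij assms(3) by simp
  \<comment> \<open>As i \<le> j and k \<le> l, a match of the swapped pairs forces i = j. Both
    terms of the symmetrisation then contribute 1, which the weight 1/2 compensates.\<close>
  moreover have swap: "j = k \<and> i = l \<longleftrightarrow> i = j \<and> i = k \<and> j = l"
    using pairs_le_nth[OF 0 ij] pairs_le_nth[OF assms(2,3)] by auto
  moreover have "(1 / 2 :: real) *\<^sub>R (2 :: 'r) = 1"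
    using scaleR_scaleR[of "1 / 2" 2 "1 :: 'r"] by (simp add: scaleR_2)
  ultimately show ?case
    by (auto simp: ij dpow_0 of_bool_def)
next
  case (Suc n)
  obtain i j where ij: "pairs_le r ! a = (i, j)" by fastforce
  have "mpow (length (pairs_le r)) (sym2_mat r K) (Suc n) a b
      = (1 / (if i = j then 2 else 1)) *\<^sub>R ((\<Sum>p<r. K i p * (dpow r K r K n p j k l + dpow r K r K n j p k l))
       + (\<Sum>q<r. K j q * (dpow r K r K n i q k l + dpow r K r K n q i k l)))"
    unfolding mpow.simps by (rule sym2_mat_step[OF Suc.prems ij]) (rule Suc.IH)
  then show ?case
    by (simp add: ij dpow_Suc distrib_left sum.distrib add_ac)
qed

lemma dpow_swap: "dpow r K r K n j i l k = dpow r K r K n i j k l"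
  by (rule binom_conv_commute)

lemma sum_double: "(\<Sum>x\<in>A. f x + f x) = 2 * sum f A" for f :: "'i \<Rightarrow> 'r::comm_ring_1"
  by (simp only: sum.distrib mult_2)

text \<open>The projection of the tensor square onto the exterior square is (1 - flip) / 2, so the
  trace is half the difference of \<open>sum_dpow_diagonal\<close> and
  \<open>sum_dpow_swapped\<close>. For the symmetric square the sign of the flip changes.\<close>

lemma tr_pow_wedge2_mat:
  "2 * tr_pow (length (pairs_less r)) (wedge2_mat r K) n = binom_conv n (tr_pow r K) (tr_pow r K) - 2 ^ n * tr_pow r K n"
proof -
  let ?G = "\<lambda>i j. dpow r K r K n i j i j - dpow r K r K n j i i j"
  have "2 * tr_pow (length (pairs_less r)) (wedge2_mat r K) n
      = (\<Sum>a<length (pairs_less r). case pairs_less r ! a of (i, j) \<Rightarrow> ?G i j + ?G i j)"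
    unfolding tr_pow_def sum_double[symmetric]
    by (intro sum.cong refl) (simp add: mpow_wedge2_mat[OF _ _ prod.collapse[symmetric]] case_prod_unfold)
  also have "\<dots> = (\<Sum>p<r. \<Sum>q<r. ?G p q)"
    by (rule sum_pairs_less) (simp_all add: dpow_swap)
  finally show ?thesis
    by (simp add: sum_subtractf sum_dpow_diagonal sum_dpow_swapped)
qed

lemma tr_pow_sym2_mat:
  "2 * tr_pow (length (pairs_le r)) (sym2_mat r K) n = binom_conv n (tr_pow r K) (tr_pow r K) + 2 ^ n * tr_pow r K n"
proof -
  let ?G = "\<lambda>i j. dpow r K r K n i j i j + dpow r K r K n j i i j"
  let ?f = "\<lambda>(i, j). (1 / (if i = j then 2 else 1)) *\<^sub>R ?G i j"
  have "2 * tr_pow (length (pairs_le r)) (sym2_mat r K) n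
      = (\<Sum>a<length (pairs_le r). ?f (pairs_le r ! a) + ?f (pairs_le r ! a))"
    unfolding tr_pow_def sum_double[symmetric]
    by (intro sum.cong refl) (simp add: mpow_sym2_mat[OF _ _ prod.collapse[symmetric]] case_prod_unfold)
  also have "\<dots> = (\<Sum>p<r. \<Sum>q<r. ?G p q)"
    by (rule sum_pairs_le) (simp_all add: dpow_swap flip: scaleR_2)
  finally show ?thesis
    by (simp add: sum.distrib sum_dpow_diagonal sum_dpow_swapped)
qed

lemma fps_two_mult_nth: "(2 * F) $ k = 2 * F $ k" for F :: "'r::comm_ring_1 fps"
  by (simp only: mult_2 fps_add_nth)

text \<open>The second series is psi^2 ch: the Adams operation doubles the Chern roots, which scales
  index k by 2^k.\<close>

lemma chern_wedge2_mat:
  "2 * chern (length (pairs_less r)) (wedge2_mat r K) = chern r K ^ 2 - Abs_fps (\<lambda>k. 2 ^ k * chern r K $ k)"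
  by (rule fps_ext) (simp only: fps_two_mult_nth fps_sub_nth fps_nth_Abs_fps power2_eq_square chern_mult_nth chern_nth
      mult_scaleR_right tr_pow_wedge2_mat scaleR_diff_right)

lemma chern_sym2_mat:
  "2 * chern (length (pairs_le r)) (sym2_mat r K) = chern r K ^ 2 + Abs_fps (\<lambda>k. 2 ^ k * chern r K $ k)"
  by (rule fps_ext) (simp only: fps_two_mult_nth fps_add_nth fps_nth_Abs_fps power2_eq_square chern_mult_nth chern_nth
      mult_scaleR_right tr_pow_sym2_mat scaleR_add_right)

lemma wedge2_mat_commutator:
  fixes K L :: "nat \<Rightarrow> nat \<Rightarrow> 'r::comm_ring_1"
  assumes "a < length (pairs_less r)" "b < length (pairs_less r)"
  shows "(\<Sum>c<length (pairs_less r). wedge2_mat r K a c * wedge2_mat r L c b - wedge2_mat r L a c * wedge2_mat r K c b)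
    = wedge2_mat r (\<lambda>i j. \<Sum>l<r. K i l * L l j - L i l * K l j) a b"
proof -
  obtain i j where ij: "pairs_less r ! a = (i, j)" by fastforce
  obtain k l where kl: "pairs_less r ! b = (k, l)" by fastforce
  have d: "k < r" "l < r" using pairs_less_nth[OF assms(2) kl] by auto
  have "(\<Sum>c<length (pairs_less r). wedge2_mat r K a c * wedge2_mat r L c b)
    = of_bool (j = l) * (\<Sum>p<r. K i p * L p k) + K i k * L j l - K i l * L j k - of_bool (j = k) * (\<Sum>p<r. K i p * L p l)
      + (K j l * L i k + of_bool (i = k) * (\<Sum>q<r. K j q * L q l) - of_bool (i = l) * (\<Sum>q<r. K j q * L q k) - K j k * L i l)"
    for K L :: "nat \<Rightarrow> nat \<Rightarrow> 'r"
  proof -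
    let ?n = "\<lambda>p q. of_bool (q = l) * L p k + of_bool (p = k) * L q l"
    have "(\<Sum>c<length (pairs_less r). wedge2_mat r K a c * wedge2_mat r L c b)
      = (\<Sum>p<r. K i p * (?n p j - ?n j p)) + (\<Sum>q<r. K j q * (?n i q - ?n q i))"
      by (rule wedge2_mat_step[OF assms(1) ij]) (simp only: wedge2_mat_def kl case_prod_unfold Let_def fst_conv snd_conv algebra_simps)
    then show ?thesis
      unfolding distrib_left right_diff_distrib sum.distrib sum_subtractf sum_mult_of_bool[OF d(1)] sum_mult_of_bool[OF d(2)] sum_mult_of_bool_const
      by (simp only: algebra_simps)
  qed
  then show ?thesis
    by (simp only: sum_subtractf wedge2_mat_def ij kl case_prod_conv Let_def right_diff_distrib)
       (simp only: mult.commute algebra_simps)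
qed

lemma sym2_mat_commutator:
  fixes K L :: "nat \<Rightarrow> nat \<Rightarrow> 'r::{comm_ring_1,real_algebra_1}"
  assumes "a < length (pairs_le r)" "b < length (pairs_le r)"
  shows "(\<Sum>c<length (pairs_le r). sym2_mat r K a c * sym2_mat r L c b - sym2_mat r L a c * sym2_mat r K c b)
    = sym2_mat r (\<lambda>i j. \<Sum>l<r. K i l * L l j - L i l * K l j) a b"
proof -
  obtain i j where ij: "pairs_le r ! a = (i, j)" by fastforce
  obtain k l where kl: "pairs_le r ! b = (k, l)" by fastforce
  have d: "k < r" "l < r" using pairs_le_nth[OF assms(2) kl] by auto
  have "(\<Sum>c<length (pairs_le r). sym2_mat r K a c * sym2_mat r L c b)
    = (1 / (if i = j then 2 else 1)) *\<^sub>R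
     (of_bool (j = l) * (\<Sum>p<r. K i p * L p k) + K i k * L j l + K i l * L j k + of_bool (j = k) * (\<Sum>p<r. K i p * L p l)
      + (K j l * L i k + of_bool (i = k) * (\<Sum>q<r. K j q * L q l) + of_bool (i = l) * (\<Sum>q<r. K j q * L q k) + K j k * L i l))"
    for K L :: "nat \<Rightarrow> nat \<Rightarrow> 'r"
  proof -
    let ?n = "\<lambda>p q. of_bool (q = l) * L p k + of_bool (p = k) * L q l"
    have "(\<Sum>c<length (pairs_le r). sym2_mat r K a c * sym2_mat r L c b)
      = (1 / (if i = j then 2 else 1)) *\<^sub>R
        ((\<Sum>p<r. K i p * (?n p j + ?n j p)) + (\<Sum>q<r. K j q * (?n i q + ?n q i)))"
      by (rule sym2_mat_step[OF assms(1) ij]) (simp only: sym2_mat_def kl case_prod_unfold Let_def fst_conv snd_conv add_ac)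
    then show ?thesis
      unfolding distrib_left sum.distrib sum_mult_of_bool[OF d(1)] sum_mult_of_bool[OF d(2)] sum_mult_of_bool_const
      by (simp only: add_ac)
  qed
  then show ?thesis
    by (simp only: sum_subtractf sym2_mat_def ij kl case_prod_conv Let_def right_diff_distrib scaleR_diff_right[symmetric])
       (simp only: mult.commute algebra_simps)
qed

subsection \<open>Skew-adjoint matrices\<close>

lemma eq_neg_self_iff: "x = - x \<longleftrightarrow> x = 0" for x :: "'r::real_vector"
proof
  assume "x = - x"
  then have "2 *\<^sub>R x = 0" by (simp add: scaleR_2) (metis add.right_inverse)
  then show "x = 0" by simp
qed simp

text \<open>G is a Gram matrix, H its inverse, and K satisfies G K = - K^T G. Then G K^n = (-1)^n
  (K^n)^T G, so conjugation by G gives tr K^n = (-1)^n tr K^n, and for odd n the trace is its own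
  negative. This replaces antisymmetry of K, which is available in orthonormal frames only.\<close>

lemma tr_pow_odd_skew_adjoint:
  fixes G H K :: "nat \<Rightarrow> nat \<Rightarrow> 'r::{comm_ring_1,real_algebra_1}"
  assumes sym: "\<And>i j. i < r \<Longrightarrow> j < r \<Longrightarrow> G i j = G j i"
    and inv: "\<And>i j. i < r \<Longrightarrow> j < r \<Longrightarrow> (\<Sum>l<r. G i l * H l j) = of_bool (i = j)"
    and skew: "\<And>i j. i < r \<Longrightarrow> j < r \<Longrightarrow> (\<Sum>l<r. G i l * K l j) = - (\<Sum>l<r. K l i * G l j)"
    and "odd k"
  shows "tr_pow r K k = 0"
proof -
  \<comment> \<open>The entries of H^T G H are computed in two ways: G H is the identity, and so is
    its transpose H^T G.\<close>
  have H_sym: "H i j = H j i" if "i < r" "j < r" for i j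
  proof -
    have "(\<Sum>p<r. H p i * (\<Sum>q<r. G p q * H q j)) = (\<Sum>q<r. (\<Sum>p<r. G q p * H p i) * H q j)"
      unfolding sum_distrib_left sum_distrib_right
      by (subst sum.swap) (auto intro!: sum.cong simp: sym mult_ac)
    moreover have "(\<Sum>p<r. H p i * (\<Sum>q<r. G p q * H q j)) = (\<Sum>p<r. H p i * of_bool (p = j))"
      using that by (intro sum.cong refl) (simp add: inv)
    moreover have "(\<Sum>q<r. (\<Sum>p<r. G q p * H p i) * H q j) = (\<Sum>q<r. of_bool (q = i) * H q j)"
      using that by (intro sum.cong refl) (simp add: inv)
    ultimately show ?thesis using that by (simp only: sum_of_bool_mult)
  qed
  have pow: "(\<Sum>l<r. G i l * mpow r K n l j) = (- 1) ^ n * (\<Sum>l<r. mpow r K n l i * G l j)"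
    if "i < r" "j < r" for i j n
    using that
  proof (induction n arbitrary: i j)
    case 0
    then show ?case using sum_if_eq(2)[of j r "G i"] sum_if_eq(1)[of i r "\<lambda>l. G l j"]
      by (simp add: eq_commute[of _ i] del: mult_if_delta)
  next
    case (Suc n)
    have "(\<Sum>l<r. G i l * mpow r K (Suc n) l j) = (\<Sum>l<r. \<Sum>h<r. G i l * mpow r K n l h * K h j)"
      using Suc.prems by (intro sum.cong refl) (simp add: mpow_Suc_right sum_distrib_left mult.assoc del: mpow.simps)
    also have "\<dots> = (\<Sum>h<r. (\<Sum>l<r. G i l * mpow r K n l h) * K h j)"
      by (subst sum.swap) (simp add: sum_distrib_right)
    also have "\<dots> = (\<Sum>h<r. (- 1) ^ n * (\<Sum>l<r. mpow r K n l i * G l h) * K h j)"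
      using Suc by (intro sum.cong refl) simp
    also have "\<dots> = (- 1) ^ n * (\<Sum>l<r. mpow r K n l i * (\<Sum>h<r. G l h * K h j))"
      unfolding sum_distrib_left sum_distrib_right by (subst sum.swap) (simp add: mult.assoc)
    also have "\<dots> = (- 1) ^ n * (\<Sum>l<r. mpow r K n l i * - (\<Sum>h<r. K h l * G h j))"
      using Suc.prems by (intro arg_cong[of _ _ "\<lambda>x. (- 1) ^ n * x"] sum.cong refl) (simp add: skew)
    also have "\<dots> = (- 1) ^ Suc n * (\<Sum>l<r. \<Sum>h<r. K h l * mpow r K n l i * G h j)"
      by (simp add: sum_negf sum_distrib_left mult_ac)
    also have "(\<Sum>l<r. \<Sum>h<r. K h l * mpow r K n l i * G h j) = (\<Sum>h<r. mpow r K (Suc n) h i * G h j)"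
      by (subst sum.swap) (simp add: sum_distrib_right)
    finally show ?case .
  qed
  have "tr_pow r K k = (\<Sum>i<r. \<Sum>l<r. mpow r K k l i * of_bool (l = i))"
    unfolding tr_pow_def by (intro sum.cong refl) (simp add: sum_of_bool_mult)
  also have "\<dots> = (\<Sum>i<r. \<Sum>l<r. mpow r K k l i * (\<Sum>j<r. G l j * H j i))"
    by (intro sum.cong refl) (simp add: inv)
  also have "\<dots> = (\<Sum>i<r. \<Sum>j<r. (\<Sum>l<r. mpow r K k l i * G l j) * H j i)"
    by (rule sum.cong[OF refl], unfold sum_distrib_left sum_distrib_right, subst sum.swap, simp add: mult.assoc)
  also have "\<dots> = (\<Sum>i<r. \<Sum>j<r. - (\<Sum>l<r. G i l * mpow r K k l j) * H j i)"
    using \<open>odd k\<close> by (intro sum.cong refl) (simp add: pow)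
  also have "\<dots> = - (\<Sum>i<r. \<Sum>j<r. \<Sum>l<r. mpow r K k l j * (G l i * H i j))"
    unfolding sum_negf[symmetric] mult_minus_left sum_distrib_right
    by (intro sum.cong refl) (simp add: sum_negf sym H_sym mult_ac)
  also have "\<dots> = - (\<Sum>j<r. \<Sum>l<r. \<Sum>i<r. mpow r K k l j * (G l i * H i j))"
    by (rule arg_cong[of _ _ uminus], rule trans[OF sum.swap], rule sum.cong[OF refl], rule sum.swap)
  also have "\<dots> = - (\<Sum>j<r. \<Sum>l<r. mpow r K k l j * (\<Sum>i<r. G l i * H i j))"
    by (simp only: sum_distrib_left)
  also have "\<dots> = - (\<Sum>j<r. \<Sum>l<r. mpow r K k l j * of_bool (l = j))"
    by (intro arg_cong[of _ _ uminus] sum.cong refl) (simp add: inv)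
  also have "\<dots> = - tr_pow r K k"
    unfolding tr_pow_def by (intro arg_cong[of _ _ uminus] sum.cong refl) (simp add: sum_of_bool_mult)
  finally show ?thesis by (simp only: eq_neg_self_iff)
qed

text \<open>Induction by Schur complements. The vector \<open>v\<close> has last entry 1 and is
  orthogonal to the first r basis vectors, and \<gamma> is its squared length, positive by
  definiteness.\<close>

lemma pos_def_right_inverse:
  fixes G :: "nat \<Rightarrow> nat \<Rightarrow> real"
  assumes "\<And>i j. i < r \<Longrightarrow> j < r \<Longrightarrow> G i j = G j i"
    and "\<And>v. \<exists>i<r. v i \<noteq> 0 \<Longrightarrow> (\<Sum>i<r. \<Sum>j<r. v i * G i j * v j) > 0"
  shows "\<exists>H. \<forall>i<r. \<forall>j<r. (\<Sum>l<r. G i l * H l j) = of_bool (i = j)"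
  using assms
proof (induction r)
  case (Suc r)
  have "\<exists>H. \<forall>i<r. \<forall>j<r. (\<Sum>l<r. G i l * H l j) = of_bool (i = j)"
  proof (rule Suc.IH)
    fix v :: "nat \<Rightarrow> real" assume "\<exists>i<r. v i \<noteq> 0"
    then have "(\<Sum>i<Suc r. \<Sum>j<Suc r. (v(r := 0)) i * G i j * (v(r := 0)) j) > 0"
      by (intro Suc.prems(2)) auto
    then show "(\<Sum>i<r. \<Sum>j<r. v i * G i j * v j) > 0" by simp
  qed (use Suc.prems(1) in simp)
  then obtain H where H: "\<And>i j. i < r \<Longrightarrow> j < r \<Longrightarrow> (\<Sum>l<r. G i l * H l j) = of_bool (i = j)"
    by blast
  define x where "x = (\<lambda>i. \<Sum>j<r. H i j * G j r)"
  define v where "v = (\<lambda>i. if i = r then 1 else - x i)"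
  define \<gamma> where "\<gamma> = (\<Sum>l<Suc r. G r l * v l)"
  have Gv: "(\<Sum>l<Suc r. G i l * v l) = 0" if "i < r" for i
  proof -
    have "(\<Sum>l<r. G i l * x l) = (\<Sum>j<r. (\<Sum>l<r. G i l * H l j) * G j r)"
      unfolding x_def sum_distrib_left sum_distrib_right by (subst sum.swap) (simp add: mult.assoc)
    also have "\<dots> = (\<Sum>j<r. of_bool (i = j) * G j r)"
      using that by (intro sum.cong refl) (simp add: H)
    also have "\<dots> = G i r" using that by (simp only: sum_of_bool_mult)
    finally show ?thesis by (simp add: v_def sum_negf)
  qed
  have "(\<Sum>i<Suc r. \<Sum>j<Suc r. v i * G i j * v j) > 0"
    by (rule Suc.prems(2)) (auto simp: v_def)
  also have "(\<Sum>i<Suc r. \<Sum>j<Suc r. v i * G i j * v j) = (\<Sum>i<Suc r. v i * (\<Sum>j<Suc r. G i j * v j))"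
    by (simp only: sum_distrib_left mult.assoc)
  also have "\<dots> = \<gamma>"
    using Gv by (simp add: \<gamma>_def v_def)
  finally have \<gamma>: "\<gamma> > 0" .
  \<comment> \<open>The last column is v / \<gamma>. The other columns are those of H, extended by
    0, minus the multiple of v that clears the last row of the product.\<close>
  define H' where "H' = (\<lambda>l j. if j = r then v l / \<gamma>
    else (if l = r then 0 else H l j) - (\<Sum>p<r. G r p * H p j) / \<gamma> * v l)"
  have "(\<Sum>l<Suc r. G i l * H' l j) = of_bool (i = j)" if i: "i < Suc r" and j: "j < Suc r" for i j
  proof (cases "j = r")
    case True
    then have "(\<Sum>l<Suc r. G i l * H' l j) = (\<Sum>l<Suc r. G i l * v l) / \<gamma>"
      unfolding sum_divide_distrib by (intro sum.cong) (simp_all add: H'_def)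
    then show ?thesis using Gv[of i] i \<gamma> True by (cases "i = r") (auto simp: \<gamma>_def)
  next
    case False
    then have "(\<Sum>l<Suc r. G i l * H' l j)
      = (\<Sum>l<Suc r. G i l * (if l = r then 0 else H l j)) - (\<Sum>p<r. G r p * H p j) / \<gamma> * (\<Sum>l<Suc r. G i l * v l)"
      unfolding sum_distrib_left sum_subtractf[symmetric] by (intro sum.cong) (simp_all add: H'_def algebra_simps)
    also have "(\<Sum>l<Suc r. G i l * (if l = r then 0 else H l j)) = (\<Sum>l<r. G i l * H l j)"
      by simp
    finally show ?thesis
      using Gv[of i] H[of i j] i j \<gamma> False by (cases "i = r") (auto simp: \<gamma>_def)
  qed
  then show ?case by blast
qed simp

text \<open>Used in rank two, where the square of the curvature matrix is the square of the Euler
  form times the identity.\<close>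

lemma tr_pow_scalar_square:
  assumes "\<And>i j. i < r \<Longrightarrow> j < r \<Longrightarrow> (\<Sum>l<r. K i l * K l j) = of_bool (i = j) * q"
  shows "tr_pow r K (2 * k) = of_nat r * q ^ k"
proof -
  have "mpow r K (2 * k) i j = of_bool (i = j) * q ^ k" if "i < r" "j < r" for i j
    using that
  proof (induction k arbitrary: i)
    case (Suc k)
    have "mpow r K (2 * Suc k) i j = (\<Sum>l<r. mpow r K 2 i l * mpow r K (2 * k) l j)"
      using mpow_add[OF Suc.prems(1), of K 2 "2 * k" j] by (simp del: mpow.simps)
    also have "\<dots> = (\<Sum>l<r. of_bool (i = l) * (q * (of_bool (l = j) * q ^ k)))"
    proof (intro sum.cong refl)
      fix l assume "l \<in> {..<r}"
      then have "mpow r K 2 i l = of_bool (i = l) * q"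
        using mpow_Suc_right[of i r l K 1] assms[of i l] mpow_1[of _ r K i] Suc.prems
        by (simp add: numeral_2_eq_2 del: mpow.simps)
      then show "mpow r K 2 i l * mpow r K (2 * k) l j = of_bool (i = l) * (q * (of_bool (l = j) * q ^ k))"
        using Suc \<open>l \<in> {..<r}\<close> by simp
    qed
    also have "\<dots> = q * (of_bool (i = j) * q ^ k)"
      using Suc.prems(1) by (rule sum_of_bool_mult(1))
    finally show ?case by simp
  qed simp
  then show ?thesis by (simp add: tr_pow_def)
qed

section \<open>Calculus on manifolds\<close>

lemma times_differentiable_on_mono:
  "times_differentiable_on k S f \<Longrightarrow> T \<subseteq> S \<Longrightarrow> times_differentiable_on k T f"
  by (induction k arbitrary: f) (auto intro: continuous_on_subset)

lemma times_differentiable_on_cong: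
  assumes "open S" "\<And>x. x \<in> S \<Longrightarrow> f x = g x" "times_differentiable_on k S f"
  shows "times_differentiable_on k S g"
  using assms(2,3)
proof (induction k arbitrary: f g)
  case 0
  then show ?case using continuous_on_cong[of S S f g] by simp
next
  case (Suc k)
  have "g differentiable at x" if "x \<in> S" for x
  proof -
    have "f differentiable at x" using Suc.prems(2) that by simp
    then show ?thesis
      using that assms(1) Suc.prems(1) unfolding differentiable_def by (metis has_derivative_transform_within_open)
  qed
  moreover have "times_differentiable_on k S (\<lambda>x. frechet_derivative g (at x) w)" for w
  proof (rule Suc.IH)
    show "times_differentiable_on k S (\<lambda>x. frechet_derivative f (at x) w)" using Suc.prems(2) by simp
    show "frechet_derivative f (at x) w = frechet_derivative g (at x) w" if "x \<in> S" for x
      using frechet_derivative_transform_within_open[of f x S g] Suc.prems that assms(1) by simp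
  qed
  ultimately show ?case by simp
qed

lemma times_differentiable_on_pred:
  "times_differentiable_on (Suc k) S f \<Longrightarrow> times_differentiable_on k S f"
proof (induction k arbitrary: f)
  case 0
  then show ?case
    by (auto intro!: continuous_at_imp_continuous_on differentiable_imp_continuous_within)
qed simp

lemma times_differentiable_on_const: "times_differentiable_on k S (\<lambda>x. c)"
  by (induction k arbitrary: c) (simp_all add: frechet_derivative_const)

lemma frechet_derivative_add:
  assumes "f differentiable at x" "g differentiable at x"
  shows "frechet_derivative (\<lambda>x. f x + g x) (at x) w = frechet_derivative f (at x) w + frechet_derivative g (at x) w"
proof -
  have "((\<lambda>x. f x + g x) has_derivative
      (\<lambda>w. frechet_derivative f (at x) w + frechet_derivative g (at x) w)) (at x)"
    using assms unfolding frechet_derivative_works by (rule has_derivative_add)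
  then show ?thesis by (simp add: frechet_derivative_at[symmetric])
qed

lemma times_differentiable_on_add:
  assumes "open S" "times_differentiable_on k S f" "times_differentiable_on k S g"
  shows "times_differentiable_on k S (\<lambda>x. f x + g x)"
  using assms(2,3)
proof (induction k arbitrary: f g)
  case 0
  then show ?case by (simp add: continuous_on_add)
next
  case (Suc k)
  have "times_differentiable_on k S (\<lambda>x. frechet_derivative (\<lambda>x. f x + g x) (at x) w)" for w
  proof (rule times_differentiable_on_cong[OF assms(1)])
    show "times_differentiable_on k S (\<lambda>x. frechet_derivative f (at x) w + frechet_derivative g (at x) w)"
      using Suc by simp
    show "frechet_derivative f (at x) w + frechet_derivative g (at x) w = frechet_derivative (\<lambda>x. f x + g x) (at x) w"
      if "x \<in> S" for x
      using frechet_derivative_add[of f x g w] Suc.prems that by simp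
  qed
  then show ?case using Suc.prems by simp
qed

lemma frechet_derivative_mult:
  fixes f g :: "'e::real_normed_vector \<Rightarrow> real"
  assumes "f differentiable at x" "g differentiable at x"
  shows "frechet_derivative (\<lambda>x. f x * g x) (at x) w
    = frechet_derivative f (at x) w * g x + f x * frechet_derivative g (at x) w"
proof -
  have "((\<lambda>x. f x * g x) has_derivative
      (\<lambda>w. f x * frechet_derivative g (at x) w + frechet_derivative f (at x) w * g x)) (at x)"
    using assms unfolding frechet_derivative_works by (rule has_derivative_mult)
  then show ?thesis by (simp add: frechet_derivative_at[symmetric])
qed

lemma times_differentiable_on_mult:
  fixes f g :: "'e::real_normed_vector \<Rightarrow> real"
  assumes "open S" "times_differentiable_on k S f" "times_differentiable_on k S g"
  shows "times_differentiable_on k S (\<lambda>x. f x * g x)"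
  using assms(2,3)
proof (induction k arbitrary: f g)
  case 0
  then show ?case by (simp add: continuous_on_mult)
next
  case (Suc k)
  have "times_differentiable_on k S (\<lambda>x. frechet_derivative (\<lambda>x. f x * g x) (at x) w)" for w
  proof (rule times_differentiable_on_cong[OF assms(1)])
    show "times_differentiable_on k S (\<lambda>x. frechet_derivative f (at x) w * g x + f x * frechet_derivative g (at x) w)"
      using Suc times_differentiable_on_pred[OF Suc.prems(1)] times_differentiable_on_pred[OF Suc.prems(2)]
      by (intro times_differentiable_on_add[OF assms(1)] Suc.IH) simp_all
    show "frechet_derivative f (at x) w * g x + f x * frechet_derivative g (at x) w = frechet_derivative (\<lambda>x. f x * g x) (at x) w"
      if "x \<in> S" for x
      using frechet_derivative_mult[of f x g w] Suc.prems that by simp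
  qed
  then show ?case using Suc.prems by simp
qed

text \<open>The mean value theorem is applied to h(x + t v + s u) - h(x + s u) as a function of s,
  and then in direction v to the derivative of h along u. This produces one mixed second derivative
  at an interior point of the parallelogram.\<close>

lemma second_difference:
  fixes h :: "'e::real_normed_vector \<Rightarrow> real"
  assumes "t > 0"
    and dom: "\<And>a b. 0 \<le> a \<Longrightarrow> a \<le> t \<Longrightarrow> 0 \<le> b \<Longrightarrow> b \<le> t \<Longrightarrow> x + a *\<^sub>R u + b *\<^sub>R v \<in> S"
    and h: "\<And>y. y \<in> S \<Longrightarrow> h differentiable at y"
    and h': "\<And>y. y \<in> S \<Longrightarrow> (\<lambda>y. frechet_derivative h (at y) u) differentiable at y"
  obtains a b where "0 < a" "a < t" "0 < b" "b < t"
    "h (x + t *\<^sub>R u + t *\<^sub>R v) - h (x + t *\<^sub>R u) - h (x + t *\<^sub>R v) + h x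
      = t * t * frechet_derivative (\<lambda>y. frechet_derivative h (at y) u) (at (x + a *\<^sub>R u + b *\<^sub>R v)) v"
proof -
  have line: "((\<lambda>s. f (y + s *\<^sub>R w)) has_real_derivative frechet_derivative f (at (y + s *\<^sub>R w)) w) (at s)"
    if "f differentiable at (y + s *\<^sub>R w)" for f :: "'e \<Rightarrow> real" and y w s
  proof -
    have "((\<lambda>s. y + s *\<^sub>R w) has_derivative (\<lambda>r. r *\<^sub>R w)) (at s)"
      by (auto intro!: derivative_eq_intros)
    moreover have f: "(f has_derivative frechet_derivative f (at (y + s *\<^sub>R w))) (at (y + s *\<^sub>R w))"
      using that by (simp add: frechet_derivative_works)
    ultimately have "((\<lambda>s. f (y + s *\<^sub>R w)) has_derivative
        (\<lambda>r. frechet_derivative f (at (y + s *\<^sub>R w)) (r *\<^sub>R w))) (at s)"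
      using has_derivative_compose[of "\<lambda>s. y + s *\<^sub>R w" "\<lambda>r. r *\<^sub>R w" s UNIV f] by simp
    moreover have "(\<lambda>r. frechet_derivative f (at (y + s *\<^sub>R w)) (r *\<^sub>R w))
        = (*) (frechet_derivative f (at (y + s *\<^sub>R w)) w)"
      using linear_cmul[OF has_derivative_linear[OF f]] by (simp add: fun_eq_iff)
    ultimately show ?thesis by (simp add: has_field_derivative_def)
  qed
  have 1: "((\<lambda>s. h (x + t *\<^sub>R v + s *\<^sub>R u) - h (x + s *\<^sub>R u)) has_real_derivative
      frechet_derivative h (at (x + t *\<^sub>R v + s *\<^sub>R u)) u - frechet_derivative h (at (x + s *\<^sub>R u)) u) (at s)"
    if "0 \<le> s" "s \<le> t" for s
    using that dom[of s t] dom[of s 0] assms(1)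
    by (intro DERIV_diff line h) (simp_all add: add_ac)
  from MVT2[OF assms(1) 1] obtain a where a: "0 < a" "a < t"
    "h (x + t *\<^sub>R v + t *\<^sub>R u) - h (x + t *\<^sub>R u) - (h (x + t *\<^sub>R v + 0 *\<^sub>R u) - h (x + 0 *\<^sub>R u))
      = (t - 0) * (frechet_derivative h (at (x + t *\<^sub>R v + a *\<^sub>R u)) u - frechet_derivative h (at (x + a *\<^sub>R u)) u)"
    by blast
  have 2: "((\<lambda>s. frechet_derivative h (at (x + a *\<^sub>R u + s *\<^sub>R v)) u) has_real_derivative
      frechet_derivative (\<lambda>y. frechet_derivative h (at y) u) (at (x + a *\<^sub>R u + s *\<^sub>R v)) v) (at s)"
    if "0 \<le> s" "s \<le> t" for s
    using that dom[of a s] a by (intro line h') simp_all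
  from MVT2[OF assms(1) 2] obtain b where b: "0 < b" "b < t"
    "frechet_derivative h (at (x + a *\<^sub>R u + t *\<^sub>R v)) u - frechet_derivative h (at (x + a *\<^sub>R u + 0 *\<^sub>R v)) u
      = (t - 0) * frechet_derivative (\<lambda>y. frechet_derivative h (at y) u) (at (x + a *\<^sub>R u + b *\<^sub>R v)) v"
    by blast
  show ?thesis
    by (rule that[OF a(1,2) b(1,2)]) (use a(3) b(3) in \<open>simp add: add_ac\<close>)
qed

text \<open>The second difference over a small parallelogram is symmetric in u and v, and
  \<open>second_difference\<close> equates it with a mixed derivative in either order. So the two
  orders take equal values at points arbitrarily close to x, and continuity at x gives the
  claim.\<close>

lemma second_derivative_symmetric:
  fixes h :: "'e::real_normed_vector \<Rightarrow> real"
  assumes "open S" "x \<in> S" "times_differentiable_on 2 S h"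
  shows "frechet_derivative (\<lambda>y. frechet_derivative h (at y) u) (at x) v
    = frechet_derivative (\<lambda>y. frechet_derivative h (at y) v) (at x) u"
proof -
  let ?A = "\<lambda>u v y. frechet_derivative (\<lambda>y. frechet_derivative h (at y) u) (at y) v"
  have h: "h differentiable at y" and h': "(\<lambda>y. frechet_derivative h (at y) w) differentiable at y" if "y \<in> S" for y w
    using assms(3) that by (simp_all add: numeral_2_eq_2)
  have cont: "isCont (?A u v) x" for u v
    using assms by (simp add: numeral_2_eq_2 continuous_on_eq_continuous_at)
  have close: "\<exists>y z. dist y x < d \<and> dist z x < d \<and> ?A u v y = ?A v u z" if "d > 0" for d
  proof -
    obtain e where e: "e > 0" "ball x e \<subseteq> S" using assms(1,2) by (meson openE)
    \<comment> \<open>The summand 1 keeps n positive when u = v = 0; t is then so small that the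
      whole parallelogram lies in the ball.\<close>
    define n where "n = norm u + norm v + 1"
    have n: "n > 0" by (simp add: n_def add_nonneg_pos)
    define t where "t = min d e / (2 * n)"
    have t: "t > 0" using \<open>d > 0\<close> e(1) n by (simp add: t_def)
    have "t * n = min d e / 2" using n by (simp add: t_def)
    then have tb: "t * norm u + t * norm v < min d e"
      using t \<open>d > 0\<close> e(1) by (simp add: n_def algebra_simps) linarith
    have small: "dist (x + a *\<^sub>R p + b *\<^sub>R q) x < min d e"
      if "0 \<le> a" "a \<le> t" "0 \<le> b" "b \<le> t" "{p, q} = {u, v}" for a b p q
    proof -
      have "dist (x + a *\<^sub>R p + b *\<^sub>R q) x \<le> a * norm p + b * norm q"
        using norm_triangle_ineq[of "a *\<^sub>R p" "b *\<^sub>R q"] that by (simp add: dist_norm)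
      also have "\<dots> \<le> t * norm p + t * norm q"
        using that by (intro add_mono mult_right_mono) auto
      also have "\<dots> = t * norm u + t * norm v"
        using that(5) by (auto simp: doubleton_eq_iff)
      finally show ?thesis using tb by simp
    qed
    then have S: "x + a *\<^sub>R p + b *\<^sub>R q \<in> S"
      if "0 \<le> a" "a \<le> t" "0 \<le> b" "b \<le> t" "{p, q} = {u, v}" for a b p q
      using that e(2) by (force simp: dist_commute)
    obtain a b where ab: "0 < a" "a < t" "0 < b" "b < t"
      "h (x + t *\<^sub>R u + t *\<^sub>R v) - h (x + t *\<^sub>R u) - h (x + t *\<^sub>R v) + h x = t * t * ?A u v (x + a *\<^sub>R u + b *\<^sub>R v)"
      by (rule second_difference[OF t, of x u v S h]) (use S h h' in auto)
    obtain a' b' where ab': "0 < a'" "a' < t" "0 < b'" "b' < t"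
      "h (x + t *\<^sub>R v + t *\<^sub>R u) - h (x + t *\<^sub>R v) - h (x + t *\<^sub>R u) + h x = t * t * ?A v u (x + a' *\<^sub>R v + b' *\<^sub>R u)"
      by (rule second_difference[OF t, of x v u S h]) (use S[of _ _ v u] h h' in \<open>auto simp: insert_commute\<close>)
    have "t * t * ?A u v (x + a *\<^sub>R u + b *\<^sub>R v) = t * t * ?A v u (x + a' *\<^sub>R v + b' *\<^sub>R u)"
      unfolding ab(5)[symmetric] ab'(5)[symmetric] by (simp add: algebra_simps)
    then have "?A u v (x + a *\<^sub>R u + b *\<^sub>R v) = ?A v u (x + a' *\<^sub>R v + b' *\<^sub>R u)"
      using t by simp
    then show ?thesis
      using small[of a b u v] small[of a' b' v u] ab ab' by (auto simp: insert_commute)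
  qed
  show ?thesis
  proof (rule ccontr)
    assume "?A u v x \<noteq> ?A v u x"
    define e where "e = dist (?A u v x) (?A v u x) / 2"
    have e: "e > 0" using \<open>?A u v x \<noteq> ?A v u x\<close> by (simp add: e_def)
    obtain d1 where d1: "d1 > 0" "\<And>y. dist y x < d1 \<Longrightarrow> dist (?A u v y) (?A u v x) < e"
      using cont[of u v] e unfolding continuous_at_eps_delta dist_norm by (meson dist_norm)
    obtain d2 where d2: "d2 > 0" "\<And>y. dist y x < d2 \<Longrightarrow> dist (?A v u y) (?A v u x) < e"
      using cont[of v u] e unfolding continuous_at_eps_delta dist_norm by (meson dist_norm)
    obtain y z where "dist y x < min d1 d2" "dist z x < min d1 d2" "?A u v y = ?A v u z"
      using close[of "min d1 d2"] d1(1) d2(1) by auto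
    then have "dist (?A u v x) (?A v u x) < e + e"
      using d1(2)[of y] d2(2)[of z] dist_triangle3[of "?A u v x" "?A v u x" "?A u v y"] by simp
    then show False by (simp add: e_def)
  qed
qed

section \<open>Smooth functions and tangent vectors in charts\<close>

lemma smooth_on_subset: "smooth_on S f \<Longrightarrow> T \<subseteq> S \<Longrightarrow> smooth_on T f"
  unfolding smooth_on_def using times_differentiable_on_mono by blast

lemma smooth_on_differentiable: "smooth_on S f \<Longrightarrow> x \<in> S \<Longrightarrow> f differentiable at x"
  unfolding smooth_on_def by (metis times_differentiable_on.simps(2))

lemma smooth_fun_subset: "smooth_fun M U f \<Longrightarrow> W \<subseteq> U \<Longrightarrow> smooth_fun M W f"
  unfolding smooth_fun_def by (fastforce intro: smooth_on_subset)

locale manifold_point =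
  fixes M :: "('a, 'e::real_normed_vector) manifold" and p :: 'a
  assumes manifold: "smooth_manifold M" and p: "p \<in> pts M"
begin

lemma chart_properties:
  assumes "(V, \<phi>) \<in> atlas M"
  shows "openin (mtop M) V" "V \<subseteq> pts M" "inj_on \<phi> V"
    "\<And>U. openin (mtop M) U \<Longrightarrow> open (\<phi> ` (U \<inter> V))"
proof -
  have c: "openin (mtop M) V" "open (\<phi> ` V)"
    "homeomorphic_map (subtopology (mtop M) V) (top_of_set (\<phi> ` V)) \<phi>"
    using manifold assms unfolding smooth_manifold_def by auto
  then show "openin (mtop M) V" and V: "V \<subseteq> pts M" using openin_subset by auto
  then show "inj_on \<phi> V"
    using homeomorphic_imp_injective_map[OF c(3)] by (simp add: Int_absorb1)
  show "open (\<phi> ` (U \<inter> V))" if "openin (mtop M) U" for U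
  proof -
    have "openin (subtopology (mtop M) V) (U \<inter> V)" using that by (auto simp: openin_subtopology)
    then have "openin (top_of_set (\<phi> ` V)) (\<phi> ` (U \<inter> V))"
      using homeomorphic_imp_open_map[OF c(3)] by (simp add: open_map_def)
    then show ?thesis using c(2) openin_open_eq by blast
  qed
qed

lemma smooth_fun_cong:
  assumes "openin (mtop M) U" "\<And>q. q \<in> U \<Longrightarrow> f q = g q" "smooth_fun M U f"
  shows "smooth_fun M U g"
  unfolding smooth_fun_def
proof (clarify)
  fix V \<phi> assume c: "(V, \<phi>) \<in> atlas M"
  show "smooth_on (\<phi> ` (U \<inter> V)) (g \<circ> inv_into V \<phi>)"
    unfolding smooth_on_def
  proof
    fix k
    show "times_differentiable_on k (\<phi> ` (U \<inter> V)) (g \<circ> inv_into V \<phi>)"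
    proof (rule times_differentiable_on_cong[of _ "f \<circ> inv_into V \<phi>"])
      show "open (\<phi> ` (U \<inter> V))" using chart_properties(4)[OF c assms(1)] .
      show "times_differentiable_on k (\<phi> ` (U \<inter> V)) (f \<circ> inv_into V \<phi>)"
        using assms(3) c unfolding smooth_fun_def smooth_on_def by fastforce
    qed (use assms(2) chart_properties(3)[OF c] in auto)
  qed
qed

lemma smooth_fun_add:
  assumes "openin (mtop M) U" "smooth_fun M U f" "smooth_fun M U g"
  shows "smooth_fun M U (\<lambda>q. f q + g q)"
  unfolding smooth_fun_def smooth_on_def o_def
  using assms chart_properties(4)
  by (auto simp: smooth_fun_def smooth_on_def o_def intro!: times_differentiable_on_add)

lemma smooth_fun_mult:
  assumes "openin (mtop M) U" "smooth_fun M U f" "smooth_fun M U g"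
  shows "smooth_fun M U (\<lambda>q. f q * g q)"
  unfolding smooth_fun_def smooth_on_def o_def
  using assms chart_properties(4)
  by (auto simp: smooth_fun_def smooth_on_def o_def intro!: times_differentiable_on_mult)

lemma smooth_near_common:
  assumes "smooth_near M p f" "smooth_near M p g"
  obtains U where "openin (mtop M) U" "p \<in> U" "smooth_fun M U f" "smooth_fun M U g"
proof -
  obtain U W where U: "openin (mtop M) U" "p \<in> U" "smooth_fun M U f"
    and W: "openin (mtop M) W" "p \<in> W" "smooth_fun M W g"
    using assms unfolding smooth_near_def by blast
  show ?thesis
    by (rule that[of "U \<inter> W"]) (use U W smooth_fun_subset[of M _ _ "U \<inter> W"] in auto)
qed

lemma smooth_near_const [simp]: "smooth_near M p (\<lambda>q. c)"
  unfolding smooth_near_def smooth_fun_def smooth_on_def o_def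
  using p times_differentiable_on_const by (intro exI[of _ "pts M"]) auto

lemma smooth_near_add: "smooth_near M p f \<Longrightarrow> smooth_near M p g \<Longrightarrow> smooth_near M p (\<lambda>q. f q + g q)"
  using smooth_fun_add by (metis smooth_near_common smooth_near_def)

lemma smooth_near_mult: "smooth_near M p f \<Longrightarrow> smooth_near M p g \<Longrightarrow> smooth_near M p (\<lambda>q. f q * g q)"
  using smooth_fun_mult by (metis smooth_near_common smooth_near_def)

lemma smooth_near_sum:
  "(\<And>x. x \<in> A \<Longrightarrow> smooth_near M p (f x)) \<Longrightarrow> smooth_near M p (\<lambda>q. \<Sum>x\<in>A. f x q)"
  by (induction A rule: infinite_finite_induct) (simp_all add: smooth_near_add)

lemma smooth_near_cong:
  assumes "openin (mtop M) W" "p \<in> W" "\<And>q. q \<in> W \<Longrightarrow> f q = g q" "smooth_near M p f"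
  shows "smooth_near M p g"
proof -
  obtain U where U: "openin (mtop M) U" "p \<in> U" "smooth_fun M U f"
    using assms(4) unfolding smooth_near_def by blast
  have "smooth_fun M (U \<inter> W) g"
    using U assms smooth_fun_subset[OF U(3), of "U \<inter> W"] by (intro smooth_fun_cong[of "U \<inter> W" f g]) auto
  then show ?thesis using U assms unfolding smooth_near_def by blast
qed

lemma smooth_near_chart:
  assumes "smooth_near M p f" "(V, \<phi>) \<in> atlas M" "p \<in> V"
  shows "(f \<circ> inv_into V \<phi>) differentiable at (\<phi> p)"
proof -
  obtain U where U: "openin (mtop M) U" "p \<in> U" "smooth_fun M U f"
    using assms(1) unfolding smooth_near_def by blast
  then have "smooth_on (\<phi> ` (U \<inter> V)) (f \<circ> inv_into V \<phi>)"
    using assms(2) unfolding smooth_fun_def by fastforce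
  then show ?thesis using smooth_on_differentiable U(2) assms(3) by blast
qed

lemma tapply_dirvec:
  assumes "smooth_near M p f"
  shows "tapply (dirvec M (V, \<phi>) p w) f = frechet_derivative (f \<circ> inv_into V \<phi>) (at (\<phi> p)) w"
  using assms by (simp add: dirvec_def Tvec_inverse)

lemma tangent_spaceE:
  assumes "v \<in> tangent_space M p"
  obtains V \<phi> w where "(V, \<phi>) \<in> atlas M" "p \<in> V" "v = dirvec M (V, \<phi>) p w"
  using assms unfolding tangent_space_def by (auto; fastforce)

context
  fixes v assumes v: "v \<in> tangent_space M p"
begin

lemma tapply_add:
  assumes "smooth_near M p f" "smooth_near M p g"
  shows "tapply v (\<lambda>q. f q + g q) = tapply v f + tapply v g"
proof -
  obtain V \<phi> w where c: "(V, \<phi>) \<in> atlas M" "p \<in> V" "v = dirvec M (V, \<phi>) p w"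
    using v by (rule tangent_spaceE)
  show ?thesis
    using frechet_derivative_add[OF smooth_near_chart[OF assms(1) c(1,2)] smooth_near_chart[OF assms(2) c(1,2)]]
    by (simp add: c(3) tapply_dirvec assms smooth_near_add o_def)
qed

lemma tapply_mult:
  assumes "smooth_near M p f" "smooth_near M p g"
  shows "tapply v (\<lambda>q. f q * g q) = tapply v f * g p + f p * tapply v g"
proof -
  obtain V \<phi> w where c: "(V, \<phi>) \<in> atlas M" "p \<in> V" "v = dirvec M (V, \<phi>) p w"
    using v by (rule tangent_spaceE)
  have "inv_into V \<phi> (\<phi> p) = p" using chart_properties(3)[OF c(1)] c(2) by simp
  then show ?thesis
    using frechet_derivative_mult[OF smooth_near_chart[OF assms(1) c(1,2)] smooth_near_chart[OF assms(2) c(1,2)]]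
    by (simp add: c(3) tapply_dirvec assms smooth_near_mult o_def)
qed

lemma tapply_const: "tapply v (\<lambda>q. c) = 0"
  using v by (elim tangent_spaceE) (simp add: tapply_dirvec o_def frechet_derivative_const)

lemma tapply_cmult:
  assumes "smooth_near M p f" shows "tapply v (\<lambda>q. c * f q) = c * tapply v f"
  using tapply_mult[OF smooth_near_const assms] by (simp add: tapply_const)

lemma tapply_sum:
  "(\<And>x. x \<in> A \<Longrightarrow> smooth_near M p (f x)) \<Longrightarrow> tapply v (\<lambda>q. \<Sum>x\<in>A. f x q) = (\<Sum>x\<in>A. tapply v (f x))"
  by (induction A rule: infinite_finite_induct) (simp_all add: tapply_const tapply_add smooth_near_sum)

text \<open>Tangent vectors take the value 0 on functions that are not smooth near p, so it has to
  be seen that f and g are either both smooth near p or both not.\<close>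

lemma tapply_cong:
  assumes "openin (mtop M) W" "p \<in> W" "\<And>q. q \<in> W \<Longrightarrow> f q = g q"
  shows "tapply v f = tapply v g"
proof -
  obtain V \<phi> w where c: "(V, \<phi>) \<in> atlas M" "p \<in> V" "v = dirvec M (V, \<phi>) p w"
    using v by (rule tangent_spaceE)
  have iff: "smooth_near M p f \<longleftrightarrow> smooth_near M p g"
    using smooth_near_cong[OF assms(1,2)] assms(3) by metis
  show ?thesis
  proof (cases "smooth_near M p f")
    case True
    have "frechet_derivative (f \<circ> inv_into V \<phi>) (at (\<phi> p)) = frechet_derivative (g \<circ> inv_into V \<phi>) (at (\<phi> p))"
      using smooth_near_chart[OF True c(1,2)] chart_properties(4)[OF c(1) assms(1)] assms(2,3) c(2) chart_properties(3)[OF c(1)]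
      by (intro frechet_derivative_transform_within_open[where X = "\<phi> ` (W \<inter> V)"]) auto
    then show ?thesis using True iff by (simp add: c(3) tapply_dirvec)
  next
    case False
    then show ?thesis using iff by (simp add: c(3) dirvec_def Tvec_inverse)
  qed
qed

end

section \<open>Change of charts and extensions with constant coefficients\<close>

lemma chart_at: "chart_at M p \<in> atlas M" "p \<in> fst (chart_at M p)"
proof -
  have "\<exists>c. c \<in> atlas M \<and> p \<in> fst c"
    using manifold p unfolding smooth_manifold_def by auto
  then have "chart_at M p \<in> atlas M \<and> p \<in> fst (chart_at M p)"
    unfolding chart_at_def by (rule someI_ex)
  then show "chart_at M p \<in> atlas M" "p \<in> fst (chart_at M p)" by auto
qed

text \<open>The chain rule. It is needed because a tangent vector may be presented in any chart,
  while \<open>const_ext\<close> always uses the chart \<open>chart_at\<close>.\<close>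

lemma dirvec_change_chart:
  assumes "(V, \<phi>) \<in> atlas M" "p \<in> V" "(W, \<psi>) \<in> atlas M" "p \<in> W"
  shows "dirvec M (W, \<psi>) p (frechet_derivative (\<psi> \<circ> inv_into V \<phi>) (at (\<phi> p)) w) = dirvec M (V, \<phi>) p w"
proof -
  have sm: "smooth_on (\<phi> ` (V \<inter> W)) (\<psi> \<circ> inv_into V \<phi>)"
    using manifold assms(1,3) unfolding smooth_manifold_def by fastforce
  have inv: "inv_into V \<phi> (\<phi> p) = p" using chart_properties(3)[OF assms(1)] assms(2) by simp
  have "frechet_derivative (f \<circ> inv_into W \<psi>) (at (\<psi> p)) (frechet_derivative (\<psi> \<circ> inv_into V \<phi>) (at (\<phi> p)) w)
      = frechet_derivative (f \<circ> inv_into V \<phi>) (at (\<phi> p)) w" if f: "smooth_near M p f" for f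
  proof -
    let ?h = "\<psi> \<circ> inv_into V \<phi>" and ?g = "f \<circ> inv_into W \<psi>"
    have h: "(?h has_derivative frechet_derivative ?h (at (\<phi> p))) (at (\<phi> p))"
      using smooth_on_differentiable[OF sm, of "\<phi> p"] assms by (simp add: frechet_derivative_works)
    have hp: "?h (\<phi> p) = \<psi> p" by (simp add: inv)
    have g: "(?g has_derivative frechet_derivative ?g (at (\<psi> p))) (at (?h (\<phi> p)))"
      unfolding hp using smooth_near_chart[OF f assms(3,4)] by (simp add: frechet_derivative_works)
    have "((?g \<circ> ?h) has_derivative (frechet_derivative ?g (at (\<psi> p)) \<circ> frechet_derivative ?h (at (\<phi> p)))) (at (\<phi> p))"
      by (rule diff_chain_at[OF h g])
    moreover have "(?g \<circ> ?h) x = (f \<circ> inv_into V \<phi>) x" if "x \<in> \<phi> ` (W \<inter> V)" for x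
      using that chart_properties(3)[OF assms(1)] chart_properties(3)[OF assms(3)] by auto
    ultimately have "((f \<circ> inv_into V \<phi>) has_derivative (frechet_derivative ?g (at (\<psi> p)) \<circ> frechet_derivative ?h (at (\<phi> p)))) (at (\<phi> p))"
      using has_derivative_transform_within_open[of "?g \<circ> ?h" _ "\<phi> p" UNIV "\<phi> ` (W \<inter> V)"]
        chart_properties(4)[OF assms(1) chart_properties(1)[OF assms(3)]] assms by auto
    then show ?thesis by (simp add: frechet_derivative_at[symmetric])
  qed
  then show ?thesis by (simp add: dirvec_def cong: if_cong)
qed

lemma const_ext_self:
  assumes "u \<in> tangent_space M p"
  shows "const_ext M p u p = u"
proof -
  obtain W \<psi> where c: "chart_at M p = (W, \<psi>)" by fastforce
  obtain V \<phi> w where "(V, \<phi>) \<in> atlas M" "p \<in> V" "u = dirvec M (V, \<phi>) p w"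
    using assms by (rule tangent_spaceE)
  then have "\<exists>w. dirvec M (chart_at M p) p w = u"
    using dirvec_change_chart[of V \<phi> W \<psi> w] chart_at unfolding c by auto
  then have "dirvec M (chart_at M p) p (SOME w. dirvec M (chart_at M p) p w = u) = u"
    by (rule someI_ex)
  then show ?thesis by (simp add: const_ext_def)
qed

lemma const_ext_tangent: "q \<in> fst (chart_at M p) \<Longrightarrow> const_ext M p u q \<in> tangent_space M q"
  unfolding const_ext_def tangent_space_def using chart_at(1) by blast

text \<open>In the chart chosen at p both sides are iterated directional derivatives of f, so the
  claim is the vanishing of the bracket of two fields with constant coefficients. The hypotheses
  \<open>fu\<close> and \<open>fv\<close> exclude the default value 0 of \<open>tapply\<close> on
  functions that are not smooth.\<close>

lemma const_ext_commute:
  assumes u: "u \<in> tangent_space M p" and v: "v \<in> tangent_space M p" and f: "smooth_near M p f"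
    and fu: "smooth_near M p (\<lambda>q. tapply (const_ext M p u q) f)"
    and fv: "smooth_near M p (\<lambda>q. tapply (const_ext M p v q) f)"
  shows "tapply u (\<lambda>q. tapply (const_ext M p v q) f) = tapply v (\<lambda>q. tapply (const_ext M p u q) f)"
proof -
  obtain V \<phi> where c: "chart_at M p = (V, \<phi>)" by fastforce
  have cV: "(V, \<phi>) \<in> atlas M" "p \<in> V" using chart_at unfolding c by auto
  obtain U where U: "openin (mtop M) U" "p \<in> U" "smooth_fun M U f"
    using f unfolding smooth_near_def by blast
  let ?S = "\<phi> ` (U \<inter> V)" and ?h = "f \<circ> inv_into V \<phi>"
  define w where "w = (\<lambda>u. SOME w. dirvec M (V, \<phi>) p w = u)"
  have sm: "smooth_on ?S ?h"
    using U(3) cV(1) unfolding smooth_fun_def by fastforce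
  have S: "open ?S" "\<phi> p \<in> ?S" using chart_properties(4)[OF cV(1) U(1)] U(2) cV(2) by auto
  have ext: "const_ext M p u q = dirvec M (V, \<phi>) q (w u)" for u q
    by (simp add: const_ext_def c w_def)
  have self: "u = dirvec M (V, \<phi>) p (w u)" if "u \<in> tangent_space M p" for u
    using const_ext_self[OF that] by (simp add: ext)
  have val: "((\<lambda>q. tapply (const_ext M p u q) f) \<circ> inv_into V \<phi>) x = frechet_derivative ?h (at x) (w u)"
    if "x \<in> ?S" for x u
  proof -
    from that obtain q where q: "x = \<phi> q" "q \<in> U" "q \<in> V" by auto
    then have "smooth_near M q f" using U unfolding smooth_near_def by blast
    then show ?thesis
      using q chart_properties(3)[OF cV(1)] by (simp add: ext dirvec_def Tvec_inverse)
  qed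
  have main: "tapply u (\<lambda>q. tapply (const_ext M p v q) f)
      = frechet_derivative (\<lambda>y. frechet_derivative ?h (at y) (w v)) (at (\<phi> p)) (w u)"
    if "u \<in> tangent_space M p" "smooth_near M p (\<lambda>q. tapply (const_ext M p v q) f)" for u v
  proof -
    have "frechet_derivative ((\<lambda>q. tapply (const_ext M p v q) f) \<circ> inv_into V \<phi>) (at (\<phi> p))
        = frechet_derivative (\<lambda>y. frechet_derivative ?h (at y) (w v)) (at (\<phi> p))"
      using smooth_near_chart[OF that(2) cV] S val
      by (intro frechet_derivative_transform_within_open[where X = ?S]) auto
    then show ?thesis
      using tapply_dirvec[OF that(2), of V \<phi> "w u"] self[OF that(1)] by simp
  qed
  have "times_differentiable_on 2 ?S ?h" using sm unfolding smooth_on_def by blast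
  from second_derivative_symmetric[OF S this, of "w v" "w u"]
  show ?thesis unfolding main[OF u fv] main[OF v fu] .
qed

end

section \<open>Curvature\<close>

lemma tensor_mat_add: "tensor_mat s K L a b + tensor_mat s K' L' a b
    = tensor_mat s (\<lambda>i j. K i j + K' i j) (\<lambda>i j. L i j + L' i j) a b"
  by (simp add: tensor_mat_def algebra_simps)

lemma wedge2_mat_add: "wedge2_mat r K a b + wedge2_mat r K' a b = wedge2_mat r (\<lambda>i j. K i j + K' i j) a b"
  by (simp add: wedge2_mat_def algebra_simps case_prod_unfold Let_def)

lemma sym2_mat_add: "sym2_mat r K a b + sym2_mat r K' a b = sym2_mat r (\<lambda>i j. K i j + K' i j) a b"
  by (simp add: sym2_mat_def case_prod_unfold Let_def distrib_left add_ac flip: scaleR_add_right)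

lemma lmat_tensor_conn: "lmat (tensor_conn A B) p a b q v =
    tensor_mat (lrank B) (\<lambda>i j. lmat A p i j q v) (\<lambda>i j. lmat B p i j q v) a b"
  by (simp add: tensor_conn_def tensor_mat_def Let_def)

lemma lmat_wedge2_conn: "lmat (wedge2_conn A) p a b q v = wedge2_mat (lrank A) (\<lambda>i j. lmat A p i j q v) a b"
  by (simp add: wedge2_conn_def wedge2_mat_def Let_def case_prod_unfold)

lemma lmat_sym2_conn: "lmat (sym2_conn A) p a b q v = sym2_mat (lrank A) (\<lambda>i j. lmat A p i j q v) a b"
  by (simp add: sym2_conn_def sym2_mat_def Let_def case_prod_unfold)

lemma lrank_conn [simp]:
  "lrank (tensor_conn A B) = lrank A * lrank B"
  "lrank (wedge2_conn A) = length (pairs_less (lrank A))"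
  "lrank (sym2_conn A) = length (pairs_le (lrank A))"
  "lrank trivial_line = 1"
  by (simp_all add: tensor_conn_def wedge2_conn_def sym2_conn_def trivial_line_def)

context manifold_point
begin

text \<open>Smoothness is tested on constant extensions because \<open>ext_deriv\<close> evaluates
  the form on no other fields.\<close>

definition ext_smooth :: "('a \<Rightarrow> 'a tvec \<Rightarrow> real) \<Rightarrow> bool" where
  "ext_smooth \<alpha> \<longleftrightarrow> (\<forall>v\<in>tangent_space M p. smooth_near M p (\<lambda>q. \<alpha> q (const_ext M p v q)))"

lemma ext_smooth_add: "ext_smooth \<alpha> \<Longrightarrow> ext_smooth \<beta> \<Longrightarrow> ext_smooth (\<lambda>q v. \<alpha> q v + \<beta> q v)"
  by (simp add: ext_smooth_def smooth_near_add)

lemma ext_smooth_cmult: "ext_smooth \<alpha> \<Longrightarrow> ext_smooth (\<lambda>q v. c * \<alpha> q v)"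
  by (simp add: ext_smooth_def smooth_near_mult)

context
  fixes u v assumes uv: "u \<in> tangent_space M p" "v \<in> tangent_space M p"
begin

lemma ext_deriv_add:
  assumes "ext_smooth \<alpha>" "ext_smooth \<beta>"
  shows "ext_deriv M (\<lambda>q v. \<alpha> q v + \<beta> q v) p u v = ext_deriv M \<alpha> p u v + ext_deriv M \<beta> p u v"
  using assms uv by (simp add: ext_deriv_def ext_smooth_def tapply_add)

lemma ext_deriv_cmult:
  assumes "ext_smooth \<alpha>"
  shows "ext_deriv M (\<lambda>q v. c * \<alpha> q v) p u v = c * ext_deriv M \<alpha> p u v"
  using assms uv by (simp add: ext_deriv_def ext_smooth_def tapply_cmult right_diff_distrib)

end

definition smooth_conn :: "'a lconn \<Rightarrow> bool" where
  "smooth_conn A \<longleftrightarrow> (\<forall>i<lrank A. \<forall>j<lrank A. ext_smooth (lmat A p i j))"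

lemma tensor_index:
  assumes "a < r * s" shows "a div s < r" "a mod s < (s :: nat)"
  using assms by (cases s; simp add: less_mult_imp_div_less)+

lemma lmat_tensor_eq: "lmat (tensor_conn A B) p a b = (\<lambda>q v.
    of_bool (a mod lrank B = b mod lrank B) * lmat A p (a div lrank B) (b div lrank B) q v
    + of_bool (a div lrank B = b div lrank B) * lmat B p (a mod lrank B) (b mod lrank B) q v)"
  by (intro ext) (simp add: lmat_tensor_conn tensor_mat_def)

lemma smooth_conn_tensor: "smooth_conn A \<Longrightarrow> smooth_conn B \<Longrightarrow> smooth_conn (tensor_conn A B)"
  unfolding smooth_conn_def lmat_tensor_eq
  by (intro allI impI ext_smooth_add ext_smooth_cmult) (simp_all add: tensor_index)

text \<open>The exterior derivative is linear in the connection matrix and the quadratic term is a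
  commutator; passing to the tensor product respects both. The squares below follow the same
  pattern.\<close>

lemma curvature_tensor_conn:
  assumes "smooth_conn A" "smooth_conn B" "u \<in> tangent_space M p" "v \<in> tangent_space M p"
    and a: "a < lrank A * lrank B" and b: "b < lrank A * lrank B"
  shows "curvature M (tensor_conn A B) p a b u v = tensor_mat (lrank B)
    (\<lambda>i j. curvature M A p i j u v) (\<lambda>i j. curvature M B p i j u v) a b"
proof -
  note idx = tensor_index[OF a] tensor_index[OF b]
  have s: "ext_smooth (lmat A p (a div lrank B) (b div lrank B))" "ext_smooth (lmat B p (a mod lrank B) (b mod lrank B))"
    using assms idx by (auto simp: smooth_conn_def)
  have "ext_deriv M (lmat (tensor_conn A B) p a b) p u v = tensor_mat (lrank B)
      (\<lambda>i j. ext_deriv M (lmat A p i j) p u v) (\<lambda>i j. ext_deriv M (lmat B p i j) p u v) a b"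
    unfolding lmat_tensor_eq tensor_mat_def using assms(3,4) s
    by (simp add: ext_deriv_add ext_deriv_cmult ext_smooth_cmult)
  then show ?thesis
    unfolding curvature_def lmat_tensor_conn tensor_mat_add[symmetric] lrank_conn
      tensor_mat_commutator[OF a b] by simp
qed

text \<open>The minus signs are written as scalar factors, so that the sum and scalar rules of
  \<open>ext_deriv\<close> apply.\<close>

lemma lmat_wedge2_eq:
  assumes "pairs_less (lrank A) ! a = (i, j)" "pairs_less (lrank A) ! b = (k, l)"
  shows "lmat (wedge2_conn A) p a b = (\<lambda>q v.
    of_bool (j = l) * lmat A p i k q v + (- of_bool (i = l)) * lmat A p j k q v
    + of_bool (i = k) * lmat A p j l q v + (- of_bool (j = k)) * lmat A p i l q v)"
  using assms by (intro ext) (simp add: lmat_wedge2_conn wedge2_mat_def)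

lemma curvature_wedge2_conn:
  assumes "smooth_conn A" and uv: "u \<in> tangent_space M p" "v \<in> tangent_space M p"
    and a: "a < length (pairs_less (lrank A))" and b: "b < length (pairs_less (lrank A))"
  shows "curvature M (wedge2_conn A) p a b u v = wedge2_mat (lrank A) (\<lambda>i j. curvature M A p i j u v) a b"
proof -
  obtain i j k l where e: "pairs_less (lrank A) ! a = (i, j)" "pairs_less (lrank A) ! b = (k, l)" by fastforce
  have "i < lrank A" "j < lrank A" "k < lrank A" "l < lrank A"
    using pairs_less_nth[OF a e(1)] pairs_less_nth[OF b e(2)] by auto
  then have s: "ext_smooth (lmat A p i k)" "ext_smooth (lmat A p j k)" "ext_smooth (lmat A p j l)" "ext_smooth (lmat A p i l)"
    using assms by (auto simp: smooth_conn_def)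
  have "ext_deriv M (lmat (wedge2_conn A) p a b) p u v = wedge2_mat (lrank A) (\<lambda>i j. ext_deriv M (lmat A p i j) p u v) a b"
    unfolding lmat_wedge2_eq[OF e] wedge2_mat_def e using s
    by (simp only: ext_deriv_add[OF uv] ext_deriv_cmult[OF uv] ext_smooth_cmult ext_smooth_add) simp
  then show ?thesis
    unfolding curvature_def lmat_wedge2_conn wedge2_mat_add[symmetric] lrank_conn
      wedge2_mat_commutator[OF a b] by simp
qed

lemma lmat_sym2_eq:
  assumes "pairs_le (lrank A) ! a = (i, j)" "pairs_le (lrank A) ! b = (k, l)"
  shows "lmat (sym2_conn A) p a b = (\<lambda>q v. (1 / (if i = j then 2 else 1)) *
    (of_bool (j = l) * lmat A p i k q v + of_bool (i = l) * lmat A p j k q v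
    + of_bool (i = k) * lmat A p j l q v + of_bool (j = k) * lmat A p i l q v))"
  using assms by (intro ext) (simp add: lmat_sym2_conn sym2_mat_def)

lemma curvature_sym2_conn:
  assumes "smooth_conn A" and uv: "u \<in> tangent_space M p" "v \<in> tangent_space M p"
    and a: "a < length (pairs_le (lrank A))" and b: "b < length (pairs_le (lrank A))"
  shows "curvature M (sym2_conn A) p a b u v = sym2_mat (lrank A) (\<lambda>i j. curvature M A p i j u v) a b"
proof -
  obtain i j k l where e: "pairs_le (lrank A) ! a = (i, j)" "pairs_le (lrank A) ! b = (k, l)" by fastforce
  have "i < lrank A" "j < lrank A" "k < lrank A" "l < lrank A"
    using pairs_le_nth[OF a e(1)] pairs_le_nth[OF b e(2)] by auto
  then have s: "ext_smooth (lmat A p i k)" "ext_smooth (lmat A p j k)" "ext_smooth (lmat A p j l)" "ext_smooth (lmat A p i l)"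
    using assms by (auto simp: smooth_conn_def)
  have "ext_deriv M (lmat (sym2_conn A) p a b) p u v = sym2_mat (lrank A) (\<lambda>i j. ext_deriv M (lmat A p i j) p u v) a b"
    unfolding lmat_sym2_eq[OF e] sym2_mat_def e using s
    by (simp only: ext_deriv_add[OF uv] ext_deriv_cmult[OF uv] ext_smooth_cmult ext_smooth_add) simp
  then show ?thesis
    unfolding curvature_def lmat_sym2_conn sym2_mat_add[symmetric] lrank_conn
      sym2_mat_commutator[OF a b] by simp
qed

lemma smooth_conn_trivial: "smooth_conn trivial_line"
  by (simp add: smooth_conn_def ext_smooth_def trivial_line_def)

lemma curvature_trivial: 
  assumes "u \<in> tangent_space M p" "v \<in> tangent_space M p"
  shows "curvature M trivial_line p i j u v = 0"
  using assms by (simp add: curvature_def ext_deriv_def trivial_line_def tapply_const)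

subsection \<open>Curvature of metric connections\<close>

lemma frame_at:
  assumes "vector_bundle M E"
  obtains U where "(U, frame_at E p) \<in> frames E" "p \<in> U"
proof -
  have "\<exists>e. \<exists>U. (U, e) \<in> frames E \<and> p \<in> U"
    using assms p unfolding vector_bundle_def by fastforce
  then have "\<exists>U. (U, frame_at E p) \<in> frames E \<and> p \<in> U"
    unfolding frame_at_def by (rule someI_ex)
  then show ?thesis using that by blast
qed

lemma smooth_conn_local_conn:
  assumes "vector_bundle M E" "connection M E D"
  shows "smooth_conn (local_conn E D)"
proof -
  obtain U where U: "(U, frame_at E p) \<in> frames E" "p \<in> U" using frame_at[OF assms(1)] .
  have "openin (mtop M) U" using assms(1) U(1) unfolding vector_bundle_def by auto
  moreover obtain V \<phi> where c: "chart_at M p = (V, \<phi>)" by fastforce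
  moreover have "openin (mtop M) V" using chart_properties(1) chart_at(1) unfolding c by blast
  ultimately have W: "openin (mtop M) (U \<inter> V)" "p \<in> U \<inter> V" using U(2) chart_at(2) by auto
  show ?thesis
    unfolding smooth_conn_def ext_smooth_def
  proof (intro allI impI ballI)
    fix i j v assume ij: "i < lrank (local_conn E D)" "j < lrank (local_conn E D)"
    then have "smooth_1form M U (conn_matrix E D (frame_at E p) i j)"
      using assms(2) U(1) unfolding connection_def local_conn_def by fastforce
    then have "smooth_fun M (U \<inter> V) (\<lambda>q. conn_matrix E D (frame_at E p) i j q (const_ext M p v q))"
      using chart_at(1) unfolding smooth_1form_def const_ext_def by (metis c fst_conv)
    then show "smooth_near M p (\<lambda>q. lmat (local_conn E D) p i j q (const_ext M p v q))"
      using W unfolding smooth_near_def local_conn_def by auto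
  qed
qed

end

text \<open>The matrix form of u v g_ij = v u g_ij, given dg = w^T g + g w for the connection matrix
  w. Here \<open>a\<close>, \<open>b\<close> are w(u), w(v), while \<open>du\<close>,
  \<open>dv\<close> are the derivatives along u of w(v) and along v of w(u). The products with one
  factor on either side of g cancel, which leaves g R + R^T g = 0 for the curvature R.\<close>

lemma metric_compatible_matrix:
  fixes a b du dv g :: "nat \<Rightarrow> nat \<Rightarrow> real"
  assumes sym: "\<And>i j. i < r \<Longrightarrow> j < r \<Longrightarrow> g i j = g j i"
    and eq: "(\<Sum>k<r. du k i * g k j + b k i * (\<Sum>l<r. a l k * g l j + a l j * g k l))
         + (\<Sum>k<r. du k j * g i k + b k j * (\<Sum>l<r. a l i * g l k + a l k * g i l))
       = (\<Sum>k<r. dv k i * g k j + a k i * (\<Sum>l<r. b l k * g l j + b l j * g k l))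
         + (\<Sum>k<r. dv k j * g i k + a k j * (\<Sum>l<r. b l i * g l k + b l k * g i l))"
    and ij: "i < r" "j < r"
  shows "(\<Sum>l<r. g i l * (du l j - dv l j + (\<Sum>k<r. a l k * b k j - b l k * a k j)))
    = - (\<Sum>l<r. (du l i - dv l i + (\<Sum>k<r. a l k * b k i - b l k * a k i)) * g l j)"
proof -
  let ?X = "\<lambda>a b i j. \<Sum>l<r. (\<Sum>k<r. a l k * b k i) * g l j"
  let ?Y = "\<lambda>a b i j. \<Sum>k<r. \<Sum>l<r. b k i * a l j * g k l"
  let ?D = "\<lambda>d i j. \<Sum>k<r. d k i * g k j"
  have 1: "(\<Sum>k<r. d k i * g k j + b k i * (\<Sum>l<r. a l k * g l j + a l j * g k l)) = ?D d i j + ?X a b i j + ?Y a b i j"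
    for a b d
  proof -
    have "(\<Sum>k<r. \<Sum>l<r. b k i * a l k * g l j) = ?X a b i j"
      unfolding sum_distrib_right by (subst sum.swap) (simp add: mult_ac)
    then show ?thesis
      by (simp add: sum.distrib sum_distrib_left distrib_left mult.assoc)
  qed
  have 2: "(\<Sum>k<r. d k j * g i k + b k j * (\<Sum>l<r. a l i * g l k + a l k * g i l)) = ?D d j i + ?X a b j i + ?Y b a i j"
    for a b d
  proof -
    have "(\<Sum>l<r. a l i * g l k + a l k * g i l) = (\<Sum>l<r. a l k * g l i + a l i * g l k)" for k
      using ij by (intro sum.cong refl) (simp add: sym[of i])
    then have "(\<Sum>k<r. d k j * g i k + b k j * (\<Sum>l<r. a l i * g l k + a l k * g i l))
        = (\<Sum>k<r. d k j * g k i + b k j * (\<Sum>l<r. a l k * g l i + a l i * g l k))"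
      using ij by (intro sum.cong refl) (simp add: sym[of i])
    moreover have "(\<Sum>k<r. \<Sum>l<r. b k j * a l k * g l i) = ?X a b j i"
      unfolding sum_distrib_right by (subst sum.swap) (simp add: mult_ac)
    moreover have "(\<Sum>k<r. \<Sum>l<r. b k j * a l i * g l k) = ?Y b a i j"
      by (subst sum.swap) (simp add: mult_ac)
    ultimately show ?thesis
      by (simp add: sum.distrib sum_distrib_left distrib_left mult.assoc)
  qed
  have 3: "(\<Sum>l<r. (du l i - dv l i + (\<Sum>k<r. a l k * b k i - b l k * a k i)) * g l j)
      = ?D du i j - ?D dv i j + ?X a b i j - ?X b a i j" for i j
    by (simp add: algebra_simps sum.distrib sum_subtractf)
  have "(\<Sum>l<r. g i l * (du l j - dv l j + (\<Sum>k<r. a l k * b k j - b l k * a k j)))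
      = (\<Sum>l<r. (du l j - dv l j + (\<Sum>k<r. a l k * b k j - b l k * a k j)) * g l i)"
    using ij by (intro sum.cong refl) (simp add: sym)
  then show ?thesis using eq unfolding 1 2 3 by linarith
qed


lemma coord_eqI:
  assumes "frame_basis_at E e q" "x \<in> fiber E q"
  shows "x = (\<Sum>i<rnk E. coord (rnk E) e q x i *\<^sub>R e i q)"
proof -
  have "\<exists>!a. is_coord (rnk E) e q x a" using assms unfolding frame_basis_at_def by blast
  then have "is_coord (rnk E) e q x (coord (rnk E) e q x)" unfolding coord_def by (rule theI')
  then show ?thesis unfolding is_coord_def by blast
qed

lemma euclidean_metric_sum:
  assumes g: "euclidean_metric X E g" and q: "q \<in> pts X" and E: "vector_bundle X E"
    and x: "\<And>i. i < (n::nat) \<Longrightarrow> x i \<in> fiber E q" and y: "y \<in> fiber E q"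
  shows "g q (\<Sum>i<n. a i *\<^sub>R x i) y = (\<Sum>i<n. a i * g q (x i) y)"
    "g q y (\<Sum>i<n. a i *\<^sub>R x i) = (\<Sum>i<n. a i * g q y (x i))"
proof -
  have sub: "subspace (fiber E q)" using E q unfolding vector_bundle_def by blast
  have lin: "g q (r *\<^sub>R x + x') y = r * g q x y + g q x' y" and sym: "g q x y = g q y x"
    if "x \<in> fiber E q" "x' \<in> fiber E q" "y \<in> fiber E q" for x x' y r
    using g q that unfolding euclidean_metric_def by blast+
  have in_fiber: "(\<Sum>i<n. a i *\<^sub>R x i) \<in> fiber E q" if "\<And>i. i < n \<Longrightarrow> x i \<in> fiber E q" for n
    using that by (intro subspace_sum[OF sub] subspace_scale[OF sub]) auto
  have zero: "g q 0 y = 0" using lin[of 0 0 y 1] y subspace_0[OF sub] by simp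
  show 1: "g q (\<Sum>i<n. a i *\<^sub>R x i) y = (\<Sum>i<n. a i * g q (x i) y)"
    using x
  proof (induction n)
    case (Suc n)
    then show ?case using lin[of "x n" "\<Sum>i<n. a i *\<^sub>R x i" y "a n"] in_fiber[of n] y by (simp add: add.commute)
  qed (simp add: zero)
  show "g q y (\<Sum>i<n. a i *\<^sub>R x i) = (\<Sum>i<n. a i * g q y (x i))"
  proof -
    have "g q y (\<Sum>i<n. a i *\<^sub>R x i) = g q (\<Sum>i<n. a i *\<^sub>R x i) y"
      using sym[OF y y in_fiber[OF x]] .
    also have "\<dots> = (\<Sum>i<n. a i * g q y (x i))"
      unfolding 1 by (intro sum.cong refl) (simp add: sym[OF x y y])
    finally show ?thesis .
  qed
qed

context manifold_point
begin

text \<open>The local frame need not be orthonormal, so the curvature matrix is skew relative to the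
  Gram matrix. The reason is that constant extensions of u and v commute on the functions g(e_i,
  e_j), whose first derivatives metric compatibility expresses by the connection matrix.\<close>

lemma curvature_skew:
  assumes E: "euclidean_bundle M r E g D" and uv: "u \<in> tangent_space M p" "v \<in> tangent_space M p"
    and ij: "i < r" "j < r"
  defines "G \<equiv> \<lambda>i j. g p (frame_at E p i p) (frame_at E p j p)" and "R \<equiv> \<lambda>i j. curvature M (local_conn E D) p i j u v"
  shows "(\<Sum>l<r. G i l * R l j) = - (\<Sum>l<r. R l i * G l j)"
proof -
  have r: "rnk E = r" and vb: "vector_bundle M E" and met: "euclidean_metric M E g"
    and con: "connection M E D" and comp: "metric_compatible M E g D"
    using E unfolding euclidean_bundle_def by auto
  define e where "e = frame_at E p"
  obtain U where U: "(U, e) \<in> frames E" "p \<in> U" unfolding e_def using frame_at[OF vb] .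
  have Uo: "openin (mtop M) U" and basis: "\<And>q. q \<in> U \<Longrightarrow> frame_basis_at E e q"
    and sec: "\<And>i. i < r \<Longrightarrow> smooth_section M E U (e i)"
    using vb U(1) r unfolding vector_bundle_def by auto
  have Upts: "U \<subseteq> pts M" using Uo by (rule openin_subset)
  obtain V \<phi> where c: "chart_at M p = (V, \<phi>)" by fastforce
  have V: "openin (mtop M) V" "p \<in> V" using chart_properties(1) chart_at unfolding c by auto
  let ?W = "U \<inter> V"
  have W: "openin (mtop M) ?W" "p \<in> ?W" using Uo U(2) V by auto
  let ?g = "\<lambda>i j q. g q (e i q) (e j q)"
  let ?\<omega> = "conn_matrix E D e"
  have fib: "e i q \<in> fiber E q" if "q \<in> U" "i < r" for i q
    using basis[OF that(1)] that(2) r unfolding frame_basis_at_def by auto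
  have D: "D q w (e j) = (\<Sum>k<r. ?\<omega> k j q w *\<^sub>R e k q)" if "q \<in> U" "j < r" "w \<in> tangent_space M q" for q j w
  proof -
    have "D q w (e j) \<in> fiber E q"
      using con that Uo sec[OF that(2)] unfolding connection_def by blast
    from coord_eqI[OF basis[OF that(1)] this] show ?thesis unfolding conn_matrix_def r .
  qed
  have dg: "tapply w (?g i j) = (\<Sum>k<r. ?\<omega> k i q w * ?g k j q + ?\<omega> k j q w * ?g i k q)"
    if "q \<in> U" "i < r" "j < r" "w \<in> tangent_space M q" for q i j w
  proof -
    have "tapply w (?g i j) = g q (D q w (e i)) (e j q) + g q (e i q) (D q w (e j))"
      using comp that Uo sec unfolding metric_compatible_def by blast
    then show ?thesis
      using that Upts euclidean_metric_sum[OF met _ vb fib[OF that(1)] fib[OF that(1)], where n = r]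
      by (simp add: D sum.distrib subset_iff)
  qed
  have sg: "smooth_near M p (?g i j)" if "i < r" "j < r" for i j
  proof -
    have "\<forall>(U, e)\<in>frames E. \<forall>i<r. \<forall>j<r. smooth_fun M U (\<lambda>q. g q (e i q) (e j q))"
      using met unfolding euclidean_metric_def r by (rule conjunct2)
    then have "smooth_fun M U (?g i j)" using U(1) that by fast
    then show ?thesis using U(2) Uo unfolding smooth_near_def by fast
  qed
  have s\<omega>: "smooth_near M p (\<lambda>q. ?\<omega> i j q (const_ext M p w q))" if "i < r" "j < r" "w \<in> tangent_space M p" for i j w
    using smooth_conn_local_conn[OF vb con] that r
    unfolding smooth_conn_def ext_smooth_def local_conn_def e_def by simp
  let ?h = "\<lambda>i j w q. \<Sum>k<r. ?\<omega> k i q (const_ext M p w q) * ?g k j q + ?\<omega> k j q (const_ext M p w q) * ?g i k q"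
  \<comment> \<open>The formula is established at every q in \<open>?W\<close>, not only at p,
    because it is differentiated once more.\<close>
  have h: "tapply (const_ext M p w q) (?g i j) = ?h i j w q" if "q \<in> ?W" "i < r" "j < r" for q i j w
    using dg[of q i j] const_ext_tangent[of q w] that unfolding c by simp
  have sh: "smooth_near M p (?h i j w)" if "i < r" "j < r" "w \<in> tangent_space M p" for i j w
    using that by (intro smooth_near_sum smooth_near_add smooth_near_mult s\<omega> sg) auto
  have sh': "smooth_near M p (\<lambda>q. tapply (const_ext M p w q) (?g i j))" if "i < r" "j < r" "w \<in> tangent_space M p" for i j w
    using smooth_near_cong[OF W, of "?h i j w"] sh[OF that] h that by auto
  define a b du dv where "a = (\<lambda>k l. ?\<omega> k l p u)" and "b = (\<lambda>k l. ?\<omega> k l p v)"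
    and "du = (\<lambda>k l. tapply u (\<lambda>q. ?\<omega> k l q (const_ext M p v q)))"
    and "dv = (\<lambda>k l. tapply v (\<lambda>q. ?\<omega> k l q (const_ext M p u q)))"
  have R: "R k l = du k l - dv k l + (\<Sum>m<r. a k m * b m l - b k m * a m l)" for k l
    by (simp add: R_def curvature_def ext_deriv_def local_conn_def r a_def b_def du_def dv_def e_def)
  have G: "G k l = ?g k l p" for k l by (simp add: G_def e_def)
  have expand: "tapply w (\<lambda>q. tapply (const_ext M p w' q) (?g i j))
     = (\<Sum>k<r. tapply w (\<lambda>q. ?\<omega> k i q (const_ext M p w' q)) * ?g k j p
           + ?\<omega> k i p w' * (\<Sum>l<r. ?\<omega> l k p w * ?g l j p + ?\<omega> l j p w * ?g k l p))
      + (\<Sum>k<r. tapply w (\<lambda>q. ?\<omega> k j q (const_ext M p w' q)) * ?g i k p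
           + ?\<omega> k j p w' * (\<Sum>l<r. ?\<omega> l i p w * ?g l k p + ?\<omega> l k p w * ?g i l p))"
    if w: "w \<in> tangent_space M p" "w' \<in> tangent_space M p" for w w'
  proof -
    have "tapply w (\<lambda>q. tapply (const_ext M p w' q) (?g i j)) = tapply w (?h i j w')"
      by (rule tapply_cong[OF w(1) W]) (use h ij in auto)
    also have "\<dots> = (\<Sum>k<r. tapply w (\<lambda>q. ?\<omega> k i q (const_ext M p w' q) * ?g k j q + ?\<omega> k j q (const_ext M p w' q) * ?g i k q))"
      using ij w by (intro tapply_sum[OF w(1)] smooth_near_add smooth_near_mult s\<omega> sg) auto
    also have "\<dots> = (\<Sum>k<r. (tapply w (\<lambda>q. ?\<omega> k i q (const_ext M p w' q)) * ?g k j p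
           + ?\<omega> k i p w' * (\<Sum>l<r. ?\<omega> l k p w * ?g l j p + ?\<omega> l j p w * ?g k l p))
      + (tapply w (\<lambda>q. ?\<omega> k j q (const_ext M p w' q)) * ?g i k p
           + ?\<omega> k j p w' * (\<Sum>l<r. ?\<omega> l i p w * ?g l k p + ?\<omega> l k p w * ?g i l p)))"
      using ij w U(2) by (intro sum.cong refl)
        (simp add: tapply_add tapply_mult s\<omega> sg smooth_near_mult dg const_ext_self)
    finally show ?thesis by (simp only: sum.distrib)
  qed
  have sym: "G k l = G l k" if "k < r" "l < r" for k l
    using met fib[OF U(2)] that p unfolding G euclidean_metric_def by blast
  show ?thesis
    unfolding R
  proof (rule metric_compatible_matrix[OF sym _ ij])
    have "tapply u (\<lambda>q. tapply (const_ext M p v q) (?g i j)) = tapply v (\<lambda>q. tapply (const_ext M p u q) (?g i j))"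
      using ij uv by (intro const_ext_commute sg sh')
    then show "(\<Sum>k<r. du k i * G k j + b k i * (\<Sum>l<r. a l k * G l j + a l j * G k l))
         + (\<Sum>k<r. du k j * G i k + b k j * (\<Sum>l<r. a l i * G l k + a l k * G i l))
       = (\<Sum>k<r. dv k i * G k j + a k i * (\<Sum>l<r. b l k * G l j + b l j * G k l))
         + (\<Sum>k<r. dv k j * G i k + a k j * (\<Sum>l<r. b l i * G l k + b l k * G i l))"
      unfolding expand[OF uv] expand[OF uv(2,1)] du_def dv_def a_def b_def G .
  qed
qed

text \<open>Coordinates in a frame are unique, so a nonzero coefficient vector gives a nonzero
  vector of the fibre, and definiteness of the metric passes to the Gram matrix.\<close>

lemma gram_right_inverse:
  assumes E: "euclidean_bundle M r E g D"
  defines "G \<equiv> \<lambda>i j. g p (frame_at E p i p) (frame_at E p j p)"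
  shows "\<exists>H. \<forall>i<r. \<forall>j<r. (\<Sum>l<r. G i l * H l j) = of_bool (i = j)"
    and "\<And>i j. i < r \<Longrightarrow> j < r \<Longrightarrow> G i j = G j i"
    and "\<And>a. \<exists>i<r. a i \<noteq> 0 \<Longrightarrow> (\<Sum>i<r. \<Sum>j<r. a i * G i j * a j) > 0"
proof -
  have r: "rnk E = r" and vb: "vector_bundle M E" and met: "euclidean_metric M E g"
    using E unfolding euclidean_bundle_def by auto
  define e where "e = frame_at E p"
  obtain U where U: "(U, e) \<in> frames E" "p \<in> U" unfolding e_def using frame_at[OF vb] .
  have basis: "frame_basis_at E e p" using vb U unfolding vector_bundle_def by auto
  have fib: "e i p \<in> fiber E p" if "i < r" for i
    using basis that r unfolding frame_basis_at_def by auto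
  have sub: "subspace (fiber E p)" using vb p unfolding vector_bundle_def by blast
  show sym: "G i j = G j i" if "i < r" "j < r" for i j
    using met fib that p unfolding G_def e_def[symmetric] euclidean_metric_def by blast
  show pos: "(\<Sum>i<r. \<Sum>j<r. a i * G i j * a j) > 0" if "\<exists>i<r. a i \<noteq> 0" for a
  proof -
    let ?x = "\<Sum>i<r. a i *\<^sub>R e i p"
    have x: "?x \<in> fiber E p"
      using fib by (intro subspace_sum[OF sub] subspace_scale[OF sub]) auto
    have "?x \<noteq> 0"
    proof
      assume 0: "?x = 0"
      have "is_coord r e p 0 (\<lambda>i. if i < r then a i else 0)"
        using 0 by (auto simp: is_coord_def)
      moreover have "is_coord r e p 0 (\<lambda>i. 0)" by (simp add: is_coord_def)
      moreover have "\<exists>!a. is_coord r e p 0 a"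
        using basis subspace_0[OF sub] r unfolding frame_basis_at_def by blast
      ultimately have eq: "(\<lambda>i. if i < r then a i else 0) = (\<lambda>i. 0)" by blast
      from that obtain i where i: "i < r" "a i \<noteq> 0" by blast
      from fun_cong[OF eq, of i] i show False by simp
    qed
    then have "g p ?x ?x > 0" using met x p unfolding euclidean_metric_def by blast
    also have "g p ?x ?x = (\<Sum>i<r. \<Sum>j<r. a i * G i j * a j)"
      using euclidean_metric_sum[OF met p vb fib x, where n = r] euclidean_metric_sum[OF met p vb fib fib, where n = r]
      by (simp add: G_def e_def[symmetric] sum_distrib_left mult_ac)
    finally show ?thesis .
  qed
  show "\<exists>H. \<forall>i<r. \<forall>j<r. (\<Sum>l<r. G i l * H l j) = of_bool (i = j)"
    by (rule pos_def_right_inverse[OF sym pos])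
qed

end

section \<open>Chern--Weil forms as power series\<close>

text \<open>Keeping the complex factor z separate lets real identities between curvatures pass to
  forms; z is i / (2 pi) for the Chern-Weil forms and 1 for the Euler form.\<close>

definition two_form :: "complex \<Rightarrow> ('v \<Rightarrow> 'v \<Rightarrow> real) \<Rightarrow> 'v mform" where
  "two_form z R = Mform (\<lambda>vs. if length vs = 2 then z * complex_of_real (R (vs ! 0) (vs ! 1)) else 0)"

lemma norm_curvature_eq_two_form:
  "norm_curvature X A p i j = two_form (\<i> / complex_of_real (2 * pi)) (curvature X A p i j)"
  unfolding norm_curvature_def two_form_def ..

lemma deg_form_two_form: "deg_form 2 (two_form z R)"
  by (simp add: deg_form_def two_form_def Mform_inverse)

lemma gcoeff_pull_two_form: "gcoeff (pull vs (two_form z R)) S =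
  (if S \<subseteq> {..<length vs} \<and> card S = 2 then z * complex_of_real (R (nths vs S ! 0) (nths vs S ! 1)) else 0)"
  by (auto simp: gcoeff_pull two_form_def Mform_inverse length_nths_subset)

text \<open>Only entries of \<open>vs\<close> are ever inserted, so identities valid for tangent
  vectors at p suffice.\<close>

lemma pull_two_form_cong:
  assumes "\<And>u v. u \<in> set vs \<Longrightarrow> v \<in> set vs \<Longrightarrow> R u v = R' u v"
  shows "pull vs (two_form z R) = pull vs (two_form z R')"
proof (rule gcoeff_inject[THEN iffD1], rule ext)
  fix S
  have "nths vs S ! k \<in> set vs" if "S \<subseteq> {..<length vs}" "card S = 2" "k < 2" for k
    using that nth_mem[of k "nths vs S"] set_nths_subset[of vs S] by (simp add: length_nths_subset subset_iff)
  then show "gcoeff (pull vs (two_form z R)) S = gcoeff (pull vs (two_form z R')) S"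
    using assms by (simp add: gcoeff_pull_two_form)
qed

lemma pull_two_form_linear:
  "pull vs (two_form z (\<lambda>u v. R u v + R' u v)) = pull vs (two_form z R) + pull vs (two_form z R')"
  "pull vs (two_form z (\<lambda>u v. R u v - R' u v)) = pull vs (two_form z R) - pull vs (two_form z R')"
  "pull vs (two_form z (\<lambda>u v. - R u v)) = - pull vs (two_form z R)"
  "pull vs (two_form z (\<lambda>u v. r * R u v)) = r *\<^sub>R pull vs (two_form z R)"
  "pull vs (two_form z (\<lambda>u v. 0)) = 0"
  by (rule gcoeff_inject[THEN iffD1], rule ext,
      simp add: gcoeff_pull_two_form plus_even_grassmann.rep_eq minus_even_grassmann.rep_eq
        uminus_even_grassmann.rep_eq scaleR_even_grassmann.rep_eq zero_even_grassmann.rep_eq algebra_simps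
        scaleR_conv_of_real[where 'a = complex])+

lemma of_bool_scaleR: "of_bool P *\<^sub>R x = of_bool P * x" for x :: "'r::real_algebra_1"
  by (cases P) simp_all

lemma pull_two_form_sum:
  "pull vs (two_form z (\<lambda>u v. \<Sum>x\<in>A. R x u v)) = (\<Sum>x\<in>A. pull vs (two_form z (R x)))"
  by (induction A rule: infinite_finite_induct) (simp_all add: pull_two_form_linear)

text \<open>Only the product of the two factors matters. This trades two factors i / (2 pi) for the
  real factor -1 / (4 pi^2), which acts on the real algebra by scaling.\<close>

lemma pull_two_form_mult:
  assumes "z * w = z' * w'"
  shows "pull vs (two_form z R) * pull vs (two_form w R') = pull vs (two_form z' R) * pull vs (two_form w' R')"
proof (rule gcoeff_inject[THEN iffD1], rule ext)
  fix U
  have factor: "gcoeff (pull vs (two_form z R)) S = z * gcoeff (pull vs (two_form 1 R)) S" for z R S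
    by (simp add: gcoeff_pull_two_form)
  have "k * (z * x) * (w * y) = k * (z' * x) * (w' * y)" for k x y :: complex
    using arg_cong[OF assms, of "\<lambda>t. k * t * x * y"] by (simp add: mult_ac)
  then show "gcoeff (pull vs (two_form z R) * pull vs (two_form w R')) U =
      gcoeff (pull vs (two_form z' R) * pull vs (two_form w' R')) U"
    unfolding times_even_grassmann.rep_eq factor[of z] factor[of w] factor[of z'] factor[of w'] by (intro sum.cong refl)
qed

lemma pull_two_form_scale: "pull vs (two_form (complex_of_real r * z) R) = r *\<^sub>R pull vs (two_form z R)"
  by (rule gcoeff_inject[THEN iffD1], rule ext)
     (simp add: gcoeff_pull_two_form scaleR_even_grassmann.rep_eq scaleR_conv_of_real[where 'a = complex])

lemma deg_form_matrix_power:
  assumes "\<And>i j. deg_form 2 (K i j)"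
  shows "deg_form (2 * k) (matrix_power r K k i j)"
proof (induction k arbitrary: i)
  case (Suc k)
  have "deg_form (2 + 2 * k) (K i l * matrix_power r K k l j)" for l
    using assms Suc by (rule deg_form_times)
  then show ?case by (auto intro: deg_form_sum)
qed (simp add: deg_form_0 deg_form_1)

lemma pull_matrix_power:
  assumes "\<And>i j. deg_form 2 (K i j)"
  shows "pull vs (matrix_power r K k i j) = mpow r (\<lambda>i j. pull vs (K i j)) k i j"
  by (induction k arbitrary: i) (simp_all add: pull_times deg_form_even_form[OF assms])

lemma deg_form_trace_power:
  assumes "\<And>i j. deg_form 2 (K i j)" shows "deg_form (2 * k) (trace_power r K k)"
  unfolding trace_power_def by (intro deg_form_sum deg_form_matrix_power assms)

lemma pull_trace_power:
  assumes "\<And>i j. deg_form 2 (K i j)"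
  shows "pull vs (trace_power r K k) = tr_pow r (\<lambda>i j. pull vs (K i j)) k"
  by (simp add: trace_power_def tr_pow_def pull_matrix_power[OF assms])

lemma graded_sum: "graded vs (sum f A) = (\<Sum>x\<in>A. graded vs (f x))"
  by (induction A rule: infinite_finite_induct) simp_all

lemma even_form_trace_series:
  assumes "\<And>i j. deg_form 2 (K i j)" shows "even_form (trace_series a r K)"
proof -
  have "even_form (\<Sum>k\<le>n. a k *\<^sub>R trace_power r K k)" for n :: nat
    using deg_form_even_form[OF deg_form_trace_power[OF assms]] by simp
  then show ?thesis
    unfolding even_form_def trace_series_def by (simp add: Mform_inverse)
qed

lemma graded_trace_series:
  assumes "\<And>i j. deg_form 2 (K i j)"
  shows "graded vs (trace_series a r K) $ k = a k *\<^sub>R tr_pow r (\<lambda>i j. pull vs (K i j)) k"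
proof -
  have "graded vs (trace_series a r K) $ k = pull vs (deg_part (2 * k) (\<Sum>j\<le>2 * k. a j *\<^sub>R trace_power r K j))"
    unfolding graded_nth by (rule arg_cong[of _ _ "pull vs"])
      (auto simp: deg_part_def trace_series_def Mform_inverse fun_eq_iff intro!: arg_cong[of _ _ Mform])
  also have "\<dots> = (\<Sum>j\<le>2 * k. of_real (a j) * graded vs (trace_power r K j) $ k)"
    unfolding graded_nth[symmetric] graded_sum by (simp add: fps_sum_nth)
  also have "\<dots> = (\<Sum>j\<le>2 * k. if j = k then of_real (a k) * pull vs (trace_power r K k) else 0)"
    by (intro sum.cong refl) (simp add: graded_nth_deg_form[OF deg_form_trace_power[OF assms]])
  also have "\<dots> = a k *\<^sub>R tr_pow r (\<lambda>i j. pull vs (K i j)) k"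
    by (simp add: pull_trace_power[OF assms] scaleR_conv_of_real)
  finally show ?thesis .
qed

lemma deg_form_norm_curvature: "deg_form 2 (norm_curvature X A p i j)"
  by (simp add: norm_curvature_eq_two_form deg_form_two_form)

lemma chern_zero: "chern 1 (\<lambda>i j. 0) = (1 :: 'r::{comm_ring_1,real_algebra_1} fps)"
proof -
  have "tr_pow 1 (\<lambda>i j. 0 :: 'r) k = (if k = 0 then 1 else 0)" for k
    by (cases k) (simp_all add: tr_pow_def)
  then show ?thesis by (simp add: fps_eq_iff chern_nth del: One_nat_def)
qed

text \<open>Solves G K = - K^T G for the symmetric G with rows (x, y), (y, z) and K with rows (a,
  b), (c, d). The solutions are K = \<nu> G^-1 J with J a rotation by a right angle, so a single
  element \<nu> determines the curvature.\<close>

lemma skew_rank2: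
  fixes a b c d \<nu> :: "'r::{comm_ring_1,real_algebra_1}" and x y z :: real
  assumes "of_real x * a + of_real y * c = 0" "of_real y * b + of_real z * d = 0"
    and "\<nu> = of_real x * b + of_real y * d" "\<nu> = - (of_real y * a + of_real z * c)"
    and \<Delta>: "x * z - y * y \<noteq> 0"
  shows "a = (y / (x * z - y * y)) *\<^sub>R \<nu>" "b = (z / (x * z - y * y)) *\<^sub>R \<nu>"
    "c = - (x / (x * z - y * y)) *\<^sub>R \<nu>" "d = - (y / (x * z - y * y)) *\<^sub>R \<nu>"
proof -
  let ?X = "of_real x :: 'r" and ?Y = "of_real y :: 'r" and ?Z = "of_real z :: 'r"
  have div: "e = (w / (x * z - y * y)) *\<^sub>R \<nu>" if "(?X * ?Z - ?Y * ?Y) * e = of_real w * \<nu>" for e w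
  proof -
    have "(1 / (x * z - y * y)) *\<^sub>R ((x * z - y * y) *\<^sub>R e) = (1 / (x * z - y * y)) *\<^sub>R (w *\<^sub>R \<nu>)"
      using that by (simp add: scaleR_conv_of_real)
    then show ?thesis using \<Delta> by simp
  qed
  have h4: "?Z * c = - \<nu> - ?Y * a" unfolding assms(4) by simp
  have h: "?X * a = - (?Y * c)" "?Z * d = - (?Y * b)" "?X * b = \<nu> - ?Y * d"
      "?Y * b = - (?Z * d)" "?Y * c = - (?X * a)" "?Y * d = \<nu> - ?X * b"
    using assms(1,2) by (simp_all add: eq_neg_iff_add_eq_0 assms(3) add.commute)
  have \<Delta>_left: "(?X * ?Z - ?Y * ?Y) * e = ?Z * (?X * e) - ?Y * (?Y * e)"
    and \<Delta>_right: "(?X * ?Z - ?Y * ?Y) * e = ?X * (?Z * e) - ?Y * (?Y * e)" for e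
    by (simp_all add: algebra_simps)
  show "a = (y / (x * z - y * y)) *\<^sub>R \<nu>" "b = (z / (x * z - y * y)) *\<^sub>R \<nu>"
    by (rule div, simp only: \<Delta>_left h(1,3,4) assms(4), simp add: algebra_simps)+
  show "c = - (x / (x * z - y * y)) *\<^sub>R \<nu>" "d = - (y / (x * z - y * y)) *\<^sub>R \<nu>"
    unfolding minus_divide_left
    by (rule div, simp only: \<Delta>_right h(2,5,6) h4, simp add: algebra_simps)+
qed

section \<open>Chern characters evaluated on a fixed list of tangent vectors\<close>

locale tangent_list = manifold_point M p for M :: "('a, 'e::real_normed_vector) manifold" and p +
  fixes vs :: "'a tvec list"
  assumes vs: "set vs \<subseteq> tangent_space M p"
begin

definition curv :: "'a lconn \<Rightarrow> nat \<Rightarrow> nat \<Rightarrow> even_grassmann" where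
  "curv A i j = pull vs (norm_curvature M A p i j)"

definition chern_conn :: "'a lconn \<Rightarrow> even_grassmann fps" where
  "chern_conn A = chern (lrank A) (curv A)"

lemma curv_eq: "curv A i j = pull vs (two_form (\<i> / complex_of_real (2 * pi)) (curvature M A p i j))"
  by (simp add: curv_def norm_curvature_eq_two_form)

lemma graded_ch_conn: "graded vs (ch_conn M A p) = chern_conn A"
  by (rule fps_ext) (simp add: ch_conn_def chern_conn_def chern_nth curv_def[abs_def]
      graded_trace_series deg_form_norm_curvature)

lemma chern_conn_tensor:
  assumes "smooth_conn A" "smooth_conn B"
  shows "chern_conn (tensor_conn A B) = chern_conn A * chern_conn B"
proof -
  have "curv (tensor_conn A B) a b = tensor_mat (lrank B) (curv A) (curv B) a b"
    if ab: "a < lrank A * lrank B" "b < lrank A * lrank B" for a b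
  proof -
    have "curv (tensor_conn A B) a b = pull vs (two_form (\<i> / complex_of_real (2 * pi)) (\<lambda>u v. tensor_mat (lrank B)
        (\<lambda>i j. curvature M A p i j u v) (\<lambda>i j. curvature M B p i j u v) a b))"
      unfolding curv_eq using vs by (intro pull_two_form_cong curvature_tensor_conn assms ab) auto
    then show ?thesis
      unfolding tensor_mat_def pull_two_form_linear of_bool_scaleR curv_eq[symmetric] .
  qed
  then show ?thesis
    unfolding chern_conn_def chern_tensor_mat[symmetric] lrank_conn by (rule chern_cong)
qed

lemma chern_conn_wedge2:
  assumes "smooth_conn A"
  shows "2 * chern_conn (wedge2_conn A) = chern_conn A ^ 2 - Abs_fps (\<lambda>k. 2 ^ k * chern_conn A $ k)"
proof -
  have "curv (wedge2_conn A) a b = wedge2_mat (lrank A) (curv A) a b"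
    if ab: "a < length (pairs_less (lrank A))" "b < length (pairs_less (lrank A))" for a b
  proof -
    have "curv (wedge2_conn A) a b = pull vs (two_form (\<i> / complex_of_real (2 * pi)) (\<lambda>u v. wedge2_mat (lrank A)
        (\<lambda>i j. curvature M A p i j u v) a b))"
      unfolding curv_eq using vs by (intro pull_two_form_cong curvature_wedge2_conn assms ab) auto
    then show ?thesis
      unfolding wedge2_mat_def Let_def case_prod_unfold pull_two_form_linear of_bool_scaleR curv_eq[symmetric] .
  qed
  then have "chern_conn (wedge2_conn A) = chern (length (pairs_less (lrank A))) (wedge2_mat (lrank A) (curv A))"
    unfolding chern_conn_def lrank_conn by (rule chern_cong)
  then show ?thesis by (simp only: chern_wedge2_mat chern_conn_def)
qed

lemma chern_conn_sym2:
  assumes "smooth_conn A"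
  shows "2 * chern_conn (sym2_conn A) = chern_conn A ^ 2 + Abs_fps (\<lambda>k. 2 ^ k * chern_conn A $ k)"
proof -
  have "curv (sym2_conn A) a b = sym2_mat (lrank A) (curv A) a b"
    if ab: "a < length (pairs_le (lrank A))" "b < length (pairs_le (lrank A))" for a b
  proof -
    have "curv (sym2_conn A) a b = pull vs (two_form (\<i> / complex_of_real (2 * pi)) (\<lambda>u v. sym2_mat (lrank A)
        (\<lambda>i j. curvature M A p i j u v) a b))"
      unfolding curv_eq using vs by (intro pull_two_form_cong curvature_sym2_conn assms ab) auto
    then show ?thesis
      unfolding sym2_mat_def Let_def case_prod_unfold real_scaleR_def pull_two_form_linear
        of_bool_scaleR curv_eq[symmetric] .
  qed
  then have "chern_conn (sym2_conn A) = chern (length (pairs_le (lrank A))) (sym2_mat (lrank A) (curv A))"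
    unfolding chern_conn_def lrank_conn by (rule chern_cong)
  then show ?thesis by (simp only: chern_sym2_mat chern_conn_def)
qed

lemma chern_conn_trivial: "chern_conn trivial_line = 1"
proof -
  have "curv trivial_line i j = 0" for i j
  proof -
    have "curv trivial_line i j = pull vs (two_form (\<i> / complex_of_real (2 * pi)) (\<lambda>u v. 0))"
      unfolding curv_eq using vs by (intro pull_two_form_cong curvature_trivial) auto
    then show ?thesis by (simp add: pull_two_form_linear)
  qed
  then have "curv trivial_line = (\<lambda>i j. 0)" by (intro ext)
  then show ?thesis unfolding chern_conn_def lrank_conn by (simp only: chern_zero)
qed

definition smooth_virt :: "'a virt \<Rightarrow> bool" where
  "smooth_virt V \<longleftrightarrow> (\<forall>(k, A) \<in> set (summands V). smooth_conn A)"

definition chern_virt :: "'a virt \<Rightarrow> even_grassmann fps" where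
  "chern_virt V = (\<Sum>(k, A) \<leftarrow> summands V. of_int k * chern_conn A)"

lemma graded_ch: "graded vs (ch M V p) = chern_virt V"
proof -
  have "graded vs (\<Sum>(k, A) \<leftarrow> xs. of_int k *\<^sub>R ch_conn M A p) = (\<Sum>(k, A) \<leftarrow> xs. of_int k * chern_conn A)" for xs
    by (induction xs) (auto simp: graded_ch_conn simp flip: fps_of_int)
  then show ?thesis by (simp add: ch_def chern_virt_def)
qed

lemma chern_virt_vb [simp]: "chern_virt (vb A) = chern_conn A"
  by (simp add: chern_virt_def vb_def)

lemma chern_virt_triv [simp]: "chern_virt (triv k) = of_int k"
  by (simp add: chern_virt_def triv_def chern_conn_trivial)

lemma chern_virt_add [simp]: "chern_virt (V + W) = chern_virt V + chern_virt W"
  by (simp add: chern_virt_def plus_virt_def)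

lemma chern_virt_diff [simp]: "chern_virt (V - W) = chern_virt V - chern_virt W"
proof -
  have "(\<Sum>(k, A) \<leftarrow> [(- l, B). (l, B) \<leftarrow> xs]. of_int k * chern_conn A) = - (\<Sum>(k, A) \<leftarrow> xs. of_int k * chern_conn A)" for xs
    by (induction xs) auto
  then show ?thesis by (simp add: chern_virt_def minus_virt_def)
qed

lemma smooth_virt_simps [simp]:
  "smooth_virt (vb A) \<longleftrightarrow> smooth_conn A" "smooth_virt (triv k)"
  "smooth_virt (V + W) \<longleftrightarrow> smooth_virt V \<and> smooth_virt W"
  "smooth_virt (V - W) \<longleftrightarrow> smooth_virt V \<and> smooth_virt W"
  by (auto simp: smooth_virt_def vb_def triv_def plus_virt_def minus_virt_def smooth_conn_trivial)

lemma smooth_virt_times [simp]: "smooth_virt V \<Longrightarrow> smooth_virt W \<Longrightarrow> smooth_virt (V * W)"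
  by (fastforce simp: smooth_virt_def times_virt_def intro: smooth_conn_tensor)

lemma chern_virt_times [simp]:
  assumes "smooth_virt V" "smooth_virt W"
  shows "chern_virt (V * W) = chern_virt V * chern_virt W"
proof -
  let ?s = "\<lambda>xs. \<Sum>(k, A) \<leftarrow> xs. of_int k * chern_conn A"
  have inner: "?s (map (\<lambda>(l, B). (k * l, tensor_conn A B)) ys) = of_int k * chern_conn A * ?s ys"
    if "smooth_conn A" "\<forall>(l, B) \<in> set ys. smooth_conn B" for k A ys
    using that(2) by (induction ys) (auto simp: chern_conn_tensor[OF that(1)] algebra_simps)
  have "?s (concat (map (\<lambda>(k, A). map (\<lambda>(l, B). (k * l, tensor_conn A B)) ys) xs)) = ?s xs * ?s ys"
    if "\<forall>(k, A) \<in> set xs. smooth_conn A" "\<forall>(l, B) \<in> set ys. smooth_conn B" for xs ys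
    using that(1) by (induction xs) (auto simp: inner that(2) algebra_simps simp del: map_map)
  from this[of "summands V" "summands W"] assms show ?thesis
    by (simp add: chern_virt_def times_virt_def smooth_virt_def)
qed

lemma chern_virt_reduced_vb [simp]: "chern_virt (reduced_vb A) = chern_conn A - of_nat (lrank A)"
  by (simp add: reduced_vb_def)

lemma smooth_virt_reduced_vb [simp]: "smooth_virt (reduced_vb A) \<longleftrightarrow> smooth_conn A"
  by (simp add: reduced_vb_def)

lemma curv_skew:
  fixes z :: complex
  assumes E: "euclidean_bundle M r E g D" and ij: "i < r" "j < r"
  defines "G \<equiv> \<lambda>i j. of_real (g p (frame_at E p i p) (frame_at E p j p)) :: even_grassmann"
    and "K \<equiv> \<lambda>i j. pull vs (two_form z (curvature M (local_conn E D) p i j))"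
  shows "(\<Sum>l<r. G i l * K l j) = - (\<Sum>l<r. K l i * G l j)"
proof -
  let ?g = "\<lambda>i j. g p (frame_at E p i p) (frame_at E p j p)" and ?R = "curvature M (local_conn E D) p"
  have "(\<Sum>l<r. G i l * K l j) = pull vs (two_form z (\<lambda>u v. \<Sum>l<r. ?g i l * ?R l j u v))"
    by (simp add: G_def K_def pull_two_form_sum pull_two_form_linear scaleR_conv_of_real)
  also have "\<dots> = pull vs (two_form z (\<lambda>u v. - (\<Sum>l<r. ?g l j * ?R l i u v)))"
    using curvature_skew[OF E _ _ ij] vs by (intro pull_two_form_cong) (auto simp: mult.commute)
  also have "\<dots> = - (\<Sum>l<r. K l i * G l j)"
    by (simp add: G_def K_def pull_two_form_sum pull_two_form_linear scaleR_conv_of_real) (simp add: mult.commute)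
  finally show ?thesis .
qed

text \<open>The Gram matrix makes the curvature skew-adjoint, so the odd indices vanish: the Chern
  character of a complexified real bundle lives in degrees divisible by 4.\<close>

lemma chern_conn_euclidean:
  assumes E: "euclidean_bundle M r E g D"
  shows "chern_conn (local_conn E D) $ 0 = of_nat r" "odd k \<Longrightarrow> chern_conn (local_conn E D) $ k = 0"
    "lrank (local_conn E D) = r"
proof -
  let ?g = "\<lambda>i j. g p (frame_at E p i p) (frame_at E p j p)"
  show r: "lrank (local_conn E D) = r" using E by (simp add: local_conn_def euclidean_bundle_def)
  then show "chern_conn (local_conn E D) $ 0 = of_nat r" by (simp add: chern_conn_def chern_nth tr_pow_0)
  obtain H where H: "\<forall>i<r. \<forall>j<r. (\<Sum>l<r. ?g i l * H l j) = of_bool (i = j)"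
    using gram_right_inverse(1)[OF E] by blast
  assume "odd k"
  have "tr_pow r (curv (local_conn E D)) k = 0"
  proof (rule tr_pow_odd_skew_adjoint[where G = "\<lambda>i j. of_real (?g i j)" and H = "\<lambda>i j. of_real (H i j)"])
    show "(\<Sum>l<r. of_real (?g i l) * of_real (H l j)) = (of_bool (i = j) :: even_grassmann)" if "i < r" "j < r" for i j
    proof -
      have "(\<Sum>l<r. of_real (?g i l) * of_real (H l j)) = (of_real (\<Sum>l<r. ?g i l * H l j) :: even_grassmann)" by simp
      then show ?thesis using H that by simp
    qed
    show "(\<Sum>l<r. of_real (?g i l) * curv (local_conn E D) l j) = - (\<Sum>l<r. curv (local_conn E D) l i * of_real (?g l j))"
      if "i < r" "j < r" for i j
      unfolding curv_eq by (rule curv_skew[OF E that])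
  qed (use gram_right_inverse(2)[OF E] \<open>odd k\<close> in simp_all)
  then show "chern_conn (local_conn E D) $ k = 0" by (simp add: chern_conn_def chern_nth r)
qed

lemma deg_form_euler_form: "deg_form 2 (euler_form M E g D p)"
  unfolding euler_form_def Let_def by (simp add: deg_form_def Mform_inverse)

text \<open>By \<open>skew_rank2\<close> the curvature is \<nu> G^-1 J, with square -\<nu>^2 /
  \<Delta>. The factor (i / (2 pi))^2 turns this into \<nu>^2 / (4 pi^2 \<Delta>), and the root of
  the Gram determinant in \<open>euler_form\<close> is what makes that the square of the Euler
  form.\<close>

lemma curv_rank2:
  assumes E: "euclidean_bundle M 2 E g D" and ij: "i < 2" "j < 2"
  shows "(\<Sum>l<2. curv (local_conn E D) i l * curv (local_conn E D) l j)
    = of_bool (i = j) * pull vs (euler_form M E g D p) ^ 2"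
proof -
  define G where "G = (\<lambda>i j. g p (frame_at E p i p) (frame_at E p j p))"
  define K where "K = (\<lambda>i j. pull vs (two_form 1 (curvature M (local_conn E D) p i j)))"
  define \<nu> where "\<nu> = of_real (G 0 0) * K 0 1 + of_real (G 0 1) * K 1 1"
  define \<Delta> where "\<Delta> = G 0 0 * G 1 1 - G 0 1 * G 0 1"
  have sym: "G 1 0 = G 0 1"
    using gram_right_inverse(2)[OF E, of 1 0] by (simp add: G_def)
  have pos: "(\<Sum>i<2. \<Sum>j<2. a i * G i j * a j) > 0" if "\<exists>i<2. a i \<noteq> 0" for a
    unfolding G_def by (rule gram_right_inverse(3)[OF E that])
  have G00: "G 0 0 > 0"
    using pos[of "\<lambda>i. if i = 0 then 1 else 0"] by (auto simp: numeral_2_eq_2)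
  \<comment> \<open>The test vector (- G 0 1, G 0 0) has squared length G 0 0 * \<Delta>, which
    yields positivity of the Gram determinant.\<close>
  have "(\<Sum>i<2. \<Sum>j<2. (if i = 0 then - G 0 1 else G 0 0) * G i j * (if j = 0 then - G 0 1 else G 0 0)) > 0"
    using G00 by (intro pos) (auto intro!: exI[of _ 1])
  also have "(\<Sum>i<2. \<Sum>j<2. (if i = 0 then - G 0 1 else G 0 0) * G i j * (if j = 0 then - G 0 1 else G 0 0)) = G 0 0 * \<Delta>"
    using sym by (simp add: numeral_2_eq_2 \<Delta>_def algebra_simps)
  finally have \<Delta>: "\<Delta> > 0" using G00 by (simp add: zero_less_mult_iff)
  have skew: "(\<Sum>l<2. of_real (G i l) * K l j) = - (\<Sum>l<2. K l i * of_real (G l j))" if "i < 2" "j < 2" for i j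
    unfolding G_def K_def by (rule curv_skew[OF E that])
  have "of_real (G 0 0) * K 0 0 + of_real (G 0 1) * K 1 0 = - (of_real (G 0 0) * K 0 0 + of_real (G 0 1) * K 1 0)"
    using skew[of 0 0] sym by (simp add: numeral_2_eq_2 mult.commute add.commute)
  then have 1: "of_real (G 0 0) * K 0 0 + of_real (G 0 1) * K 1 0 = 0" by (simp only: eq_neg_self_iff)
  have "of_real (G 0 1) * K 0 1 + of_real (G 1 1) * K 1 1 = - (of_real (G 0 1) * K 0 1 + of_real (G 1 1) * K 1 1)"
    using skew[of 1 1] sym by (simp add: numeral_2_eq_2 mult.commute add.commute)
  then have 2: "of_real (G 0 1) * K 0 1 + of_real (G 1 1) * K 1 1 = 0" by (simp only: eq_neg_self_iff)
  have 3: "\<nu> = - (of_real (G 0 1) * K 0 0 + of_real (G 1 1) * K 1 0)"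
    using skew[of 0 1] sym by (simp add: numeral_2_eq_2 \<nu>_def mult.commute)
  note K = skew_rank2[OF 1 2 \<nu>_def 3, folded \<Delta>_def, OF less_imp_neq[OF \<Delta>, symmetric]]
  have "\<Delta> * \<Delta> \<noteq> 0" using \<Delta> by simp
  then have coeff: "G 0 1 / \<Delta> * (G 0 1 / \<Delta>) - G 1 1 / \<Delta> * (G 0 0 / \<Delta>) = - (1 / \<Delta>)"
    by (simp add: field_simps) (simp add: \<Delta>_def algebra_simps)
  have KK: "(\<Sum>l<2. K i l * K l j) = of_bool (i = j) * (- (1 / \<Delta>)) *\<^sub>R \<nu> ^ 2"
  proof -
    have cases: "i = 0 \<or> i = 1" "j = 0 \<or> j = 1" using ij by auto
    have "K 0 0 * K 0 0 + K 0 1 * K 1 0 = (G 0 1 / \<Delta> * (G 0 1 / \<Delta>) - G 1 1 / \<Delta> * (G 0 0 / \<Delta>)) *\<^sub>R \<nu> ^ 2"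
      unfolding K by (simp add: power2_eq_square scaleR_left_diff_distrib)
    moreover have "K 1 0 * K 0 1 + K 1 1 * K 1 1 = (G 0 1 / \<Delta> * (G 0 1 / \<Delta>) - G 1 1 / \<Delta> * (G 0 0 / \<Delta>)) *\<^sub>R \<nu> ^ 2"
      unfolding K by (simp add: power2_eq_square scaleR_left_diff_distrib mult.commute)
    moreover have "K 0 0 * K 0 1 + K 0 1 * K 1 1 = 0" "K 1 0 * K 0 0 + K 1 1 * K 1 0 = 0"
      unfolding K by (simp_all add: mult.commute)
    ultimately show ?thesis
      unfolding coeff using cases by (auto simp: numeral_2_eq_2)
  qed
  have "pull vs (euler_form M E g D p) = (1 / (2 * pi * sqrt \<Delta>)) *\<^sub>R \<nu>"
  proof -
    have Gram: "g p (frame_at E p i p) (frame_at E p j p) = G i j" for i j by (simp add: G_def)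
    have "euler_form M E g D p = two_form 1 (\<lambda>u v. (1 / (2 * pi * sqrt \<Delta>)) *
        (\<Sum>k<2. G 0 k * curvature M (local_conn E D) p k 1 u v))"
      unfolding euler_form_def Let_def two_form_def \<Delta>_def Gram sym
      by (simp only: mult_1 times_divide_eq_left)
    then show ?thesis
      by (simp only: pull_two_form_linear pull_two_form_sum) (simp add: \<nu>_def K_def numeral_2_eq_2 scaleR_conv_of_real)
  qed
  then have e: "pull vs (euler_form M E g D p) ^ 2 = (1 / (4 * pi ^ 2 * \<Delta>)) *\<^sub>R \<nu> ^ 2"
    using \<Delta> by (simp add: power2_eq_square real_sqrt_mult_self abs_of_pos mult_ac)
  have "curv (local_conn E D) i l * curv (local_conn E D) l j = (- 1 / (4 * pi ^ 2)) *\<^sub>R (K i l * K l j)" for l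
  proof -
    have "curv (local_conn E D) i l * curv (local_conn E D) l j
      = pull vs (two_form (complex_of_real (- 1 / (4 * pi ^ 2)) * 1) (curvature M (local_conn E D) p i l)) * K l j"
      unfolding curv_eq K_def by (rule pull_two_form_mult) (simp add: power2_eq_square)
    then show ?thesis unfolding pull_two_form_scale by (simp add: K_def)
  qed
  then have "(\<Sum>l<2. curv (local_conn E D) i l * curv (local_conn E D) l j)
      = (- 1 / (4 * pi ^ 2)) *\<^sub>R (\<Sum>l<2. K i l * K l j)"
    by (simp only: scaleR_sum_right)
  also have "\<dots> = of_bool (i = j) * pull vs (euler_form M E g D p) ^ 2"
    unfolding KK e by simp
  finally show ?thesis .
qed

text \<open>The Chern roots are c and -c, so the Chern character is 2 cosh c.\<close>

lemma chern_conn_rank2: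
  assumes E: "euclidean_bundle M 2 E g D"
  shows "chern_conn (local_conn E D) $ (2 * k) = (2 / fact (2 * k)) *\<^sub>R pull vs (euler_form M E g D p) ^ (2 * k)"
proof -
  have "tr_pow 2 (curv (local_conn E D)) (2 * k) = of_nat 2 * (pull vs (euler_form M E g D p) ^ 2) ^ k"
    by (rule tr_pow_scalar_square) (rule curv_rank2[OF E])
  then show ?thesis
    using scaleR_scaleR[of "1 / fact (2 * k)" 2 "(pull vs (euler_form M E g D p) ^ 2) ^ k"]
    by (simp add: chern_conn_def chern_conn_euclidean(3)[OF E] chern_nth power_mult scaleR_2)
qed

end

section \<open>The degree 12 identity\<close>

text \<open>With Q = 2 sinh(x / 2) / x the series is L = - log Q, so L' Q = - Q'. Comparing
  coefficients determines those of L one after another.\<close>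

lemma log_ahat_nth:
  "fps_nth log_ahat_fps 0 = 0" "fps_nth log_ahat_fps (Suc 0) = 0" "fps_nth log_ahat_fps 2 = - 1 / 24"
  "fps_nth log_ahat_fps 3 = 0" "fps_nth log_ahat_fps 4 = 1 / 2880" "fps_nth log_ahat_fps 5 = 0"
  "fps_nth log_ahat_fps 6 = - 1 / 181440"
proof -
  define D :: "real fps" where "D = fps_exp (1 / 2) - fps_exp (- 1 / 2)"
  \<comment> \<open>The series D = 2 sinh(x / 2) starts at index 1; dividing by x gives a series
    with constant term 1, which is invertible.\<close>
  define Q where "Q = fps_shift 1 D"
  have D: "D = Q * fps_X" by (rule fps_ext) (simp add: Q_def D_def fps_X_mult_right_nth)
  have Q_nth: "Q $ k = ((1 / 2) ^ Suc k - (- 1 / 2) ^ Suc k) / fact (Suc k)" for k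
    by (simp add: Q_def D_def diff_divide_distrib del: power_Suc fact_Suc)
  have Q0: "Q $ 0 = 1" by (simp add: Q_nth)
  then have Qnz: "Q \<noteq> 0" by auto
  have inv: "Q * inverse Q = 1" using inverse_mult_eq_1'[of Q] Q0 by simp
  have "fps_X = D * inverse Q" unfolding D using inv by (simp add: mult_ac)
  moreover have "D \<noteq> 0" using Qnz by (simp add: D)
  ultimately have S: "fps_X / D = inverse Q" by (metis nonzero_mult_div_cancel_left)
  let ?S = "inverse Q - 1"
  have L: "log_ahat_fps = fps_ln 1 oo ?S" unfolding log_ahat_fps_def S[unfolded D_def] ..
  have S0: "?S $ 0 = 0" using Q0 by simp
  have "fps_deriv log_ahat_fps = (inverse (1 + fps_X) oo ?S) * fps_deriv ?S"
    unfolding L fps_compose_deriv[OF S0] fps_ln_deriv by simp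
  also have "inverse (1 + fps_X) oo ?S = inverse (inverse Q)"
    by (subst fps_inverse_compose[OF S0]) (simp_all add: fps_compose_add_distrib fps_X_fps_compose_startby0[OF S0])
  also have "inverse (inverse Q) = Q"
    using Q0 by (intro fps_inverse_idempotent) simp
  also have "fps_deriv ?S = - fps_deriv Q * inverse Q ^ 2"
    using Q0 by (simp add: fps_inverse_deriv)
  finally have "fps_deriv log_ahat_fps * Q = - fps_deriv Q * (Q * inverse Q) ^ 2"
    by (simp add: power2_eq_square mult_ac)
  then have eq: "(fps_deriv log_ahat_fps * Q) $ k = (- fps_deriv Q) $ k" for k
    by (simp add: inv)
  let ?a = "fps_nth log_ahat_fps"
  show a0: "?a 0 = 0" by (simp add: L fps_compose_nth)
  note simps = fps_mult_nth Q_nth sum.atLeast0_atMost_Suc numeral_eq_Suc fact_Suc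
  show a1: "?a (Suc 0) = 0" using eq[of 0] by (simp add: simps)
  have a2: "?a (Suc (Suc 0)) = - 1 / 24" using eq[of 1] a1 by (simp add: simps)
  have a3: "?a (Suc (Suc (Suc 0))) = 0" using eq[of 2] a1 a2 by (simp add: simps)
  have a4: "?a (Suc (Suc (Suc (Suc 0)))) = 1 / 2880" using eq[of 3] a1 a2 a3 by (simp add: simps)
  have a5: "?a (Suc (Suc (Suc (Suc (Suc 0))))) = 0" using eq[of 4] a1 a2 a3 a4 by (simp add: simps)
  have a6: "?a (Suc (Suc (Suc (Suc (Suc (Suc 0)))))) = - 1 / 181440" using eq[of 5] a1 a2 a3 a4 a5 by (simp add: simps)
  show "?a 2 = - 1 / 24" "?a 3 = 0" "?a 4 = 1 / 2880" "?a 5 = 0" "?a 6 = - 1 / 181440"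
    using a2 a3 a4 a5 a6 by (simp_all add: numeral_eq_Suc)
qed

text \<open>Index k of a graded form means degree 2k, so evenness of the series says that the form
  lives in degrees divisible by 4.\<close>

definition even_fps :: "'r::zero fps \<Rightarrow> bool" where
  "even_fps F \<longleftrightarrow> (\<forall>k. odd k \<longrightarrow> F $ k = 0)"

lemma even_fps_odd_nth:
  assumes "even_fps F" shows "F $ 1 = 0" "F $ 3 = 0" "F $ 5 = 0"
  using assms by (simp_all add: even_fps_def)

text \<open>The second factor may have odd coefficients: at even indices they meet only vanishing
  coefficients of the first. This admits exp (c / 2), which is not even in c.\<close>

lemma even_fps_mult_nth:
  fixes F G :: "'r::comm_ring_1 fps"
  assumes ev: "even_fps F"
  shows "(F * G) $ 0 = F $ 0 * G $ 0" "(F * G) $ 2 = F $ 0 * G $ 2 + F $ 2 * G $ 0"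
    "(F * G) $ 4 = F $ 0 * G $ 4 + F $ 2 * G $ 2 + F $ 4 * G $ 0"
    "(F * G) $ 6 = F $ 0 * G $ 6 + F $ 2 * G $ 4 + F $ 4 * G $ 2 + F $ 6 * G $ 0"
  using even_fps_odd_nth[OF ev] by (simp_all add: fps_mult_nth numeral_eq_Suc sum.atLeast0_atMost_Suc)

lemma even_fps_mult:
  fixes F G :: "'r::comm_ring_1 fps"
  assumes "even_fps F" "even_fps G" shows "even_fps (F * G)"
  unfolding even_fps_def fps_mult_nth
proof (intro allI impI sum.neutral ballI)
  fix k i :: nat assume "odd k" "i \<in> {0..k}"
  then have "odd i \<or> odd (k - i)" by auto
  then show "F $ i * G $ (k - i) = 0"
    using assms unfolding even_fps_def by (elim disjE) (metis mult_zero_left, metis mult_zero_right)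
qed

lemma even_fps_1: "even_fps (1 :: 'r::comm_ring_1 fps)"
  by (auto simp: even_fps_def)

lemma even_fps_power: "even_fps F \<Longrightarrow> even_fps (F ^ k)" for F :: "'r::comm_ring_1 fps"
  by (induction k) (simp_all add: even_fps_1 even_fps_mult)

lemma even_fps_compose: "even_fps F \<Longrightarrow> even_fps (a oo F)" for F :: "'r::comm_ring_1 fps"
  using even_fps_power[of F] by (simp add: even_fps_def fps_compose_nth)

text \<open>The k-th power of F starts at index 2k, so up to index 6 only three powers of F
  contribute.\<close>

lemma even_fps_compose_nth:
  fixes F :: "'r::comm_ring_1 fps"
  assumes ev: "even_fps F" and 0: "F $ 0 = 0"
  shows "(a oo F) $ 0 = a $ 0" "(a oo F) $ 2 = a $ 1 * F $ 2" "(a oo F) $ 4 = a $ 1 * F $ 4 + a $ 2 * (F $ 2) ^ 2"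
    "(a oo F) $ 6 = a $ 1 * F $ 6 + a $ 2 * (2 * F $ 2 * F $ 4) + a $ 3 * (F $ 2) ^ 3"
proof -
  note mult = even_fps_mult_nth[OF ev]
  have p2: "(F ^ 2) $ 0 = 0" "(F ^ 2) $ 2 = 0" "(F ^ 2) $ 4 = (F $ 2) ^ 2" "(F ^ 2) $ 6 = 2 * F $ 2 * F $ 4"
    by (simp_all add: power2_eq_square mult 0)
  have Suc: "F ^ 3 = F * F ^ 2" "F ^ 4 = F * F ^ 3" "F ^ 5 = F * F ^ 4" "F ^ 6 = F * F ^ 5"
    by (simp_all flip: power_Suc)
  have p3: "(F ^ 3) $ 0 = 0" "(F ^ 3) $ 2 = 0" "(F ^ 3) $ 4 = 0" "(F ^ 3) $ 6 = (F $ 2) ^ 3"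
    unfolding Suc(1) mult p2 0 by (simp_all add: power3_eq_cube power2_eq_square mult.assoc)
  have p4: "(F ^ 4) $ 0 = 0" "(F ^ 4) $ 2 = 0" "(F ^ 4) $ 4 = 0" "(F ^ 4) $ 6 = 0"
    unfolding Suc(2) mult p3 0 by simp_all
  have p5: "(F ^ 5) $ 0 = 0" "(F ^ 5) $ 2 = 0" "(F ^ 5) $ 4 = 0" "(F ^ 5) $ 6 = 0"
    unfolding Suc(3) mult p4 0 by simp_all
  have p6: "(F ^ 6) $ 6 = 0"
    unfolding Suc(4) mult p5 0 by simp
  have 6: "{0..6} = {0, 1, 2, 3, 4, 5, 6::nat}" and 4: "{0..4} = {0, 1, 2, 3, 4::nat}" and 2: "{0..2} = {0, 1, 2::nat}"
    by auto
  show "(a oo F) $ 0 = a $ 0" by (simp add: fps_compose_nth)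
  show "(a oo F) $ 2 = a $ 1 * F $ 2" by (simp add: fps_compose_nth 2 p2)
  show "(a oo F) $ 4 = a $ 1 * F $ 4 + a $ 2 * (F $ 2) ^ 2" by (simp add: fps_compose_nth 4 p2 p3 p4)
  show "(a oo F) $ 6 = a $ 1 * F $ 6 + a $ 2 * (2 * F $ 2 * F $ 4) + a $ 3 * (F $ 2) ^ 3"
    by (simp add: fps_compose_nth 6 p2 p3 p4 p5 p6)
qed

lemma numeral_scaleR: "numeral n *\<^sub>R x = numeral n * x" for x :: "'r::real_algebra_1"
  by (simp add: scaleR_conv_of_real)

text \<open>With \<open>a = t\<^sub>2 / 144\<close>, \<open>b = t\<^sub>4 / 240\<close>, \<open>e = t\<^sub>6 / 504\<close>, \<open>y = g\<^sub>2 / 144\<close>, \<open>\<rho> = c\<^sup>2 / 240\<close>, where \<open>t\<^sub>k\<close>, \<open>g\<^sub>k\<close>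
  are the components of the Chern characters of \<open>TZ\<close> and \<open>G\<close>, all coefficients become integral.\<close>

lemma anomaly_polynomial:
  fixes a b e y g4 \<rho> P :: "'r::comm_ring_1" and A E W X Q :: "'r fps"
  assumes "even_fps A" "even_fps W" "even_fps X" "even_fps Q"
    and A: "A $ 0 = 1" "A $ 2 = - 6 * a" "A $ 4 = b + 18 * a ^ 2" "A $ 6 = - e - 6 * a * b - 36 * a ^ 3"
    and E: "E $ 0 = 1" "E $ 2 = 30 * \<rho>" "E $ 4 = 150 * \<rho> ^ 2" "E $ 6 = 300 * \<rho> ^ 3"
    and W: "W $ 0 = 504" "W $ 2 = 144 * a + 4320 * y - 22320 * \<rho>"
      "2 * W $ 4 = 48 * g4 + 20736 * y ^ 2 + 480 * b - 316800 * \<rho> ^ 2 - 207360 * y * \<rho>"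
      "2 * W $ 6 = 288 * y * g4 + 1008 * e - 6 * (144 * y * (4800 * \<rho> ^ 2) + g4 * (240 * \<rho>))
        + 20 * 240 * 4800 * \<rho> ^ 3 - 186 * 38400 * \<rho> ^ 3"
    and P: "P = 144 * (a - y)"
    and Q: "P * Q $ 0 = 6 * (a - y)" "P * Q $ 2 = 18 * (a - y) ^ 2" "P * Q $ 4 = 36 * (a - y) ^ 3"
    and X: "X $ 0 = 1" "X $ 2 = 6 * (a - y)" "X $ 4 = 18 * (a - y) ^ 2"
  shows "2 * (A * E * W) $ 6 = 2 * (P * (- (Q * A * E * W) $ 4 + (X * A * E) $ 4))"
proof -
  define B where "B = A * E"
  have B: "B $ 0 = 1" "B $ 2 = 30 * \<rho> - 6 * a" "B $ 4 = 150 * \<rho> ^ 2 - 180 * a * \<rho> + b + 18 * a ^ 2"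
    "B $ 6 = 300 * \<rho> ^ 3 - 900 * a * \<rho> ^ 2 + 30 * (b + 18 * a ^ 2) * \<rho> - e - 6 * a * b - 36 * a ^ 3"
    unfolding B_def even_fps_mult_nth[OF assms(1)] A E by (simp_all add: algebra_simps)
  define C where "C = B * W"
  \<comment> \<open>E is not assumed even, so the even series W is put first to make the product
    formula applicable.\<close>
  have C: "C = W * B" by (simp add: C_def mult.commute)
  have C0: "C $ 0 = 504" and C2: "C $ 2 = 504 * (30 * \<rho> - 6 * a) + (144 * a + 4320 * y - 22320 * \<rho>)"
    unfolding C even_fps_mult_nth[OF assms(2)] B W by simp_all
  have C4: "2 * C $ 4 = 1008 * B $ 4 + 2 * W $ 2 * B $ 2 + 2 * W $ 4"
    and C6: "2 * C $ 6 = 1008 * B $ 6 + 2 * W $ 2 * B $ 4 + 2 * W $ 4 * B $ 2 + 2 * W $ 6"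
    unfolding C even_fps_mult_nth[OF assms(2)] B(1) W(1) by (simp_all add: algebra_simps)
  \<comment> \<open>The coefficients of Q have denominators that disappear after multiplication by
    P, so each of them is kept together with a factor P.\<close>
  have "2 * (P * (- (Q * A * E * W) $ 4 + (X * A * E) $ 4))
      = - ((P * Q $ 0) * (2 * C $ 4) + 2 * (P * Q $ 2) * C $ 2 + 2 * (P * Q $ 4) * C $ 0)
        + 2 * P * (X $ 0 * B $ 4 + X $ 2 * B $ 2 + X $ 4 * B $ 0)"
  proof -
    have "Q * A * E * W = Q * C" "X * A * E = X * B" by (simp_all add: B_def C_def mult.assoc)
    then show ?thesis
      unfolding fps_neg_nth \<open>Q * A * E * W = Q * C\<close> \<open>X * A * E = X * B\<close> even_fps_mult_nth[OF assms(4)] even_fps_mult_nth[OF assms(3)]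
      by (simp add: algebra_simps)
  qed
  \<comment> \<open>The terms with \<open>e\<close> cancel in 2 C_6, and those with
    \<open>g4\<close> combine to -288 g4 (a - y), which is what the product of P Q_0 with 2 C_4
    contributes on the other side.\<close>
  also have "\<dots> = 2 * C $ 6"
    unfolding C4 C6 C0 C2 Q X B W unfolding P by (simp add: algebra_simps power2_eq_square power3_eq_cube)
  finally show ?thesis by (simp add: B_def C_def)
qed

lemma two_mult_cancel: "2 * x = 2 * y \<Longrightarrow> x = y" for x y :: "'r::real_algebra_1"
  by (metis numeral_scaleR scaleR_cancel_left zero_neq_numeral)

abbreviation exp_fps :: "'r::real_algebra_1 fps" where
  "exp_fps \<equiv> Abs_fps (\<lambda>k. of_real (1 / fact k))"

lemma fps_numeral_mult_nth: "(numeral n * F) $ k = numeral n * F $ k" for F :: "'r::comm_ring_1 fps"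
  unfolding numeral_fps_const[symmetric] by simp

text \<open>The geometry is reduced to power series: \<open>t\<close>, \<open>f\<close>,
  \<open>h\<close> are the Chern characters of TZ, F1, F2, \<omega>1 and \<omega>2 those of the
  exterior and the symmetric square, \<open>xt\<close> that of the reduced plane bundle, \<beta> is
  the logarithm of \<open>A\<close>, and \<kappa> stands for c^2. Working with \<kappa> makes the
  formula without the plane bundle the case \<kappa> = 0.\<close>

lemma anomaly_fps:
  fixes t f h xt A E W \<omega>1 \<omega>2 P \<beta> :: "'r::{comm_ring_1,real_algebra_1} fps"
  assumes ev: "even_fps t" "even_fps f" "even_fps h" "even_fps xt"
    and 0: "t $ 0 = 10" "f $ 0 = of_nat m" "h $ 0 = of_nat n"
    and D: "D = int m - int n - 32" "2 * N = D * (D + 1) - 4"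
    and \<omega>: "2 * \<omega>1 = f ^ 2 - Abs_fps (\<lambda>k. 2 ^ k * f $ k)" "2 * \<omega>2 = h ^ 2 + Abs_fps (\<lambda>k. 2 ^ k * h $ k)"
    and W: "W = \<omega>1 + \<omega>2 - f * h + t + of_int N - of_int D * (f - h) + 5 * (xt * xt)
      + 3 * ((of_int (D + 1) - f + h) * xt)"
    and \<beta>: "\<And>k. \<beta> $ k = (1 / 2 * (fps_nth log_ahat_fps k * fact k)) *\<^sub>R t $ k"
    and A: "A = exp_fps oo \<beta>"
    and xt: "xt $ 0 = 0" "xt $ 2 = \<kappa>" "xt $ 4 = (1 / 12) *\<^sub>R \<kappa> ^ 2" "xt $ 6 = (1 / 360) *\<^sub>R \<kappa> ^ 3"
    and E: "E $ 0 = 1" "E $ 2 = (1 / 8) *\<^sub>R \<kappa>" "E $ 4 = (1 / 384) *\<^sub>R \<kappa> ^ 2" "E $ 6 = (1 / 46080) *\<^sub>R \<kappa> ^ 3"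
    and P: "\<And>k. P $ k = (if k = 2 then t $ 2 - f $ 2 + h $ 2 else 0)"
  shows "(A * E * W) $ 6 = P $ 2 * (- ((Abs_fps (\<lambda>k. of_real (1 / (24 ^ (k + 1) * fact (k + 1)))) oo P) * A * E * W) $ 4
    + ((exp_fps oo (fps_const (of_real (1 / 24)) * P)) * A * E) $ 4)"
proof -
  note scale = numeral_scaleR[where 'r = 'r, symmetric]
  \<comment> \<open>The denominators of \<open>b\<close> and \<open>e\<close> come from log Ahat,
    whose parts of degree 8 and 12 are t_4 / 240 and - t_6 / 504. The factor 144 gives P / 24 = 6 (a
    - y), and 240 in \<rho> clears the denominators of exp (c / 2).\<close>
  define a b e y \<rho> where "a = (1 / 144) *\<^sub>R t $ 2" and "b = (1 / 240) *\<^sub>R t $ 4" and "e = (1 / 504) *\<^sub>R t $ 6"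
    and "y = (1 / 144) *\<^sub>R (f $ 2 - h $ 2)" and "\<rho> = (1 / 240) *\<^sub>R \<kappa>"
  have scaled: "t $ 2 = 144 * a" "t $ 4 = 240 * b" "t $ 6 = 504 * e" "f $ 2 - h $ 2 = 144 * y" "\<kappa> = 240 * \<rho>"
    by (simp_all add: a_def b_def e_def y_def \<rho>_def scale)
  have ev\<beta>: "even_fps \<beta>" using ev(1) by (simp add: even_fps_def \<beta>)
  have \<beta>0: "\<beta> $ 0 = 0" by (simp add: \<beta> log_ahat_nth)
  have \<beta>n: "\<beta> $ 2 = - 6 * a" "\<beta> $ 4 = b" "\<beta> $ 6 = - e"
    unfolding \<beta> log_ahat_nth a_def b_def e_def by (simp_all add: fact_numeral scale)
  have ev': "even_fps A" "even_fps P" "even_fps (fps_const (of_real (1 / 24)) * P)"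
    using even_fps_compose[OF ev\<beta>] A P by (auto simp: even_fps_def)
  have exp_coeff: "exp_fps $ k * x = (1 / fact k) *\<^sub>R x" for k and x :: 'r
    by (simp add: scaleR_conv_of_real)
  have "(- 6 * a) ^ 2 = 36 * a ^ 2" "(- 6 * a) ^ 3 = - (216 * a ^ 3)" "2 * (- 6 * a) * b = - (12 * (a * b))"
    by (simp_all add: power2_eq_square power3_eq_cube algebra_simps)
  then have A_nth: "A $ 0 = 1" "A $ 2 = - 6 * a" "A $ 4 = b + 18 * a ^ 2" "A $ 6 = - e - 6 * a * b - 36 * a ^ 3"
    unfolding A even_fps_compose_nth[OF ev\<beta> \<beta>0] \<beta>n exp_coeff
    by (simp_all add: fact_numeral mult.assoc scale)
  have \<kappa>: "(240 * \<rho>) ^ 2 = 57600 * \<rho> ^ 2" "(240 * \<rho>) ^ 3 = 13824000 * \<rho> ^ 3"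
    by (simp_all add: power_mult_distrib)
  have E_nth: "E $ 0 = 1" "E $ 2 = 30 * \<rho>" "E $ 4 = 150 * \<rho> ^ 2" "E $ 6 = 300 * \<rho> ^ 3"
    unfolding E scaled \<kappa> by (simp_all add: scale)
  have xt_nth: "xt $ 0 = 0" "xt $ 2 = 240 * \<rho>" "xt $ 4 = 4800 * \<rho> ^ 2" "xt $ 6 = 38400 * \<rho> ^ 3"
    unfolding xt scaled \<kappa> by (simp_all add: scale)
  have "P $ 2 = t $ 2 - (f $ 2 - h $ 2)" by (simp add: P)
  also have "\<dots> = 144 * (a - y)" unfolding scaled by (simp add: algebra_simps)
  finally have P_nth: "P $ 0 = 0" "P $ 2 = 144 * (a - y)" "P $ 4 = 0"
    by (simp_all add: P)
  let ?G = "f - h - of_int D"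
  have evG: "even_fps ?G"
    using ev by (auto simp: even_fps_def fps_of_int[symmetric])
  have G_nth: "?G $ 0 = 32" "?G $ 2 = 144 * y" "\<And>k. k > 0 \<Longrightarrow> ?G $ k = f $ k - h $ k"
    using D(1) scaled(4) by (simp_all add: 0 fps_of_int[symmetric])
  \<comment> \<open>S^2 F2 is the exterior square of -F2, so the two squares, the mixed product, the
    multiple of \<open>f - h\<close> and N + 2 combine into the exterior square of G. Likewise
    \<open>of_int (D + 1) - f + h\<close> is \<open>1 - ?G\<close>.\<close>
  have W2: "2 * W = ?G * ?G - Abs_fps (\<lambda>k. 2 ^ k * ?G $ k) + 2 * t - 4 + 10 * (xt * xt) + 6 * ((1 - ?G) * xt)"
  proof -
    have "2 * (of_int N :: 'r fps) = of_int (2 * N)" by simp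
    also have "\<dots> = of_int D * (of_int D + 1) - 4" unfolding D(2) by simp
    finally have N: "2 * (of_int N :: 'r fps) = of_int D * (of_int D + 1) - 4" .
    have \<psi>: "Abs_fps (\<lambda>k. 2 ^ k * ?G $ k) = Abs_fps (\<lambda>k. 2 ^ k * f $ k) - Abs_fps (\<lambda>k. 2 ^ k * h $ k) - of_int D"
      by (rule fps_ext) (simp add: algebra_simps fps_of_int[symmetric])
    have "2 * W = 2 * \<omega>1 + 2 * \<omega>2 - 2 * (f * h) + 2 * t + 2 * of_int N - 2 * (of_int D * (f - h)) + 10 * (xt * xt)
        + 6 * ((of_int (D + 1) - f + h) * xt)"
      unfolding W by (simp add: algebra_simps)
    then show ?thesis unfolding \<omega> N \<psi> by (simp add: algebra_simps power2_eq_square)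
  qed
  define g4 g6 where "g4 = ?G $ 4" and "g6 = ?G $ 6"
  note nth = fps_add_nth fps_sub_nth fps_numeral_mult_nth fps_nth_Abs_fps fps_one_nth fps_numeral_nth
  have evW: "even_fps W"
    unfolding even_fps_def
  proof (intro allI impI)
    fix k :: nat assume k: "odd k"
    then have z: "F $ k = 0" if "even_fps F" for F :: "'r fps" using that by (simp add: even_fps_def)
    have "even_fps (1 - ?G)" using evG by (auto simp: even_fps_def)
    then have "(2 * W) $ k = 0"
      unfolding W2 nth z[OF even_fps_mult[OF evG evG]] z[OF even_fps_mult[OF ev(4,4)]] z[OF ev(1)] z[OF evG]
        z[OF even_fps_mult[OF \<open>even_fps (1 - ?G)\<close> ev(4)]]
      using odd_pos[OF k] z[OF ev(2)] z[OF ev(3)] by auto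
    then have "2 * W $ k = 2 * 0" by (simp add: fps_numeral_mult_nth)
    then show "W $ k = 0" by (rule two_mult_cancel)
  qed
  have W2_nth: "2 * W $ k = (?G * ?G) $ k - 2 ^ k * ?G $ k + 2 * t $ k - (if k = 0 then 4 else 0) + 10 * (xt * xt) $ k
      + 6 * (xt * (1 - ?G)) $ k" for k
    using arg_cong[OF W2, of "\<lambda>F. F $ k"] by (simp only: nth mult.commute[of "1 - ?G" xt])
  note Wk = W2_nth even_fps_mult_nth[OF evG] even_fps_mult_nth[OF ev(4)] fps_sub_nth[of 1 ?G] G_nth(1,2)
    g4_def[symmetric] g6_def[symmetric] xt_nth scaled(1-3) 0 fps_one_nth
  have W_nth: "W $ 0 = 504" "W $ 2 = 144 * a + 4320 * y - 22320 * \<rho>"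
    by (rule two_mult_cancel, unfold Wk, simp)+
  \<comment> \<open>The constant 186 is 6 * 31, as \<open>1 - ?G\<close> starts with -31. The
    coefficient \<open>g6\<close> has dropped out because the square and the Adams operation
    contribute it equally.\<close>
  have W_nth': "2 * W $ 4 = 48 * g4 + 20736 * y ^ 2 + 480 * b - 316800 * \<rho> ^ 2 - 207360 * y * \<rho>"
    "2 * W $ 6 = 288 * y * g4 + 1008 * e - 6 * (144 * y * (4800 * \<rho> ^ 2) + g4 * (240 * \<rho>))
        + 20 * 240 * 4800 * \<rho> ^ 3 - 186 * 38400 * \<rho> ^ 3"
    unfolding Wk by (simp_all add: algebra_simps power2_eq_square power3_eq_cube)
  let ?q = "Abs_fps (\<lambda>k. of_real (1 / (24 ^ (k + 1) * fact (k + 1)))) :: 'r fps"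
  let ?Q = "?q oo P"
  let ?E = "fps_const (of_real (1 / 24)) * P"
  have Q_coeff: "?q $ 0 = of_real (1 / 24)"
    "?q $ 1 = of_real (1 / 1152)"
    "?q $ 2 = of_real (1 / 82944)"
    by (simp_all add: fact_numeral)
  have commute: "x * (of_real r * z) = r *\<^sub>R (x * z)" "x * of_real r = r *\<^sub>R x" "of_real r * x = r *\<^sub>R x"
    for x z :: 'r and r
    by (simp_all add: scaleR_conv_of_real mult_ac)
  have \<delta>: "144 * (a - y) * (144 * (a - y)) = 20736 * (a - y) ^ 2"
    "144 * (a - y) * (144 * (a - y)) ^ 2 = 2985984 * (a - y) ^ 3" "(6 * (a - y)) ^ 2 = 36 * (a - y) ^ 2"
    by (simp_all add: algebra_simps power2_eq_square power3_eq_cube)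
  have Q_nth: "P $ 2 * ?Q $ 0 = 6 * (a - y)" "P $ 2 * ?Q $ 2 = 18 * (a - y) ^ 2" "P $ 2 * ?Q $ 4 = 36 * (a - y) ^ 3"
    unfolding even_fps_compose_nth[OF ev'(2) P_nth(1)] P_nth Q_coeff mult_zero_right add_0
    unfolding commute mult_scaleR_right scaleR_zero_right \<delta> by (simp_all add: scale)
  have E_nth': "?E $ 0 = 0" "?E $ 2 = 6 * (a - y)" "?E $ 4 = 0"
    unfolding fps_mult_left_const_nth P_nth commute by (simp_all add: scale)
  have X_nth: "(exp_fps oo ?E) $ 0 = 1" "(exp_fps oo ?E) $ 2 = 6 * (a - y)" "(exp_fps oo ?E) $ 4 = 18 * (a - y) ^ 2"
    unfolding even_fps_compose_nth[OF ev'(3) E_nth'(1)] E_nth' exp_coeff mult_zero_right add_0 \<delta>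
    by (simp_all add: scale fact_numeral)
  show ?thesis
    by (rule two_mult_cancel, rule anomaly_polynomial[OF ev'(1) evW even_fps_compose[OF ev'(3)] even_fps_compose[OF ev'(2)]
      A_nth E_nth W_nth W_nth' P_nth(2) Q_nth X_nth])
qed

section \<open>Return to differential forms\<close>

lemma mapply_eqI_graded:
  assumes "deg_form (2 * k) \<alpha>" "deg_form (2 * k) \<beta>" "graded vs \<alpha> $ k = graded vs \<beta> $ k"
  shows "mapply \<alpha> vs = mapply \<beta> vs"
proof (cases "length vs = 2 * k")
  case True
  have "gcoeff (graded vs \<gamma> $ k) {..<length vs} = mapply \<gamma> vs" for \<gamma>
    using True by (simp add: gcoeff_graded mapply_eq_gcoeff_pull)
  then show ?thesis using assms(3) by metis
next
  case False
  then show ?thesis using assms(1,2) by (simp add: deg_form_def)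
qed

text \<open>Absorbs the factor E = 1 in the second identity: among the shuffles only the one passing
  all arguments to the left factor survives.\<close>

lemma mform_mult_1_right: "\<alpha> * 1 = \<alpha>" for \<alpha> :: "'v mform"
proof (rule mapply_inject[THEN iffD1], rule ext)
  fix vs :: "'v list"
  let ?U = "{..<length vs}"
  have "mapply (\<alpha> * 1) (nths vs ?U)
      = (\<Sum>S\<in>Pow ?U. koszul_sign S (?U - S) * mapply \<alpha> (nths vs S) * mapply 1 (nths vs (?U - S)))"
    by (rule mapply_times_nths) simp
  also have "\<dots> = (\<Sum>S\<in>Pow ?U. if S = ?U then mapply \<alpha> (nths vs ?U) else 0)"
  proof (intro sum.cong refl)
    fix S assume S: "S \<in> Pow ?U"
    show "koszul_sign S (?U - S) * mapply \<alpha> (nths vs S) * mapply 1 (nths vs (?U - S))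
        = (if S = ?U then mapply \<alpha> (nths vs ?U) else 0)"
    proof (cases "S = ?U")
      case False
      then have "?U - S \<noteq> {}" using S by auto
      then have "length (nths vs (?U - S)) \<noteq> 0" by (subst length_nths_subset) auto
      then show ?thesis using False by (auto simp: one_mform.rep_eq)
    qed (simp add: one_mform.rep_eq)
  qed
  also have "\<dots> = mapply \<alpha> (nths vs ?U)" by simp
  finally show "mapply (\<alpha> * 1) vs = mapply \<alpha> vs" by (simp add: nths_all)
qed

lemma mform_mult_0_right: "\<alpha> * 0 = 0" for \<alpha> :: "'v mform"
  by transfer simp

lemma graded_deg_part: "graded vs (deg_part (2 * k) \<alpha>) $ k = graded vs \<alpha> $ k"
proof -
  have "deg_part (2 * k) (deg_part (2 * k) \<alpha>) = deg_part (2 * k) \<alpha>"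
    unfolding deg_part_def by (simp add: Mform_inverse cong: if_cong)
  then show ?thesis by (simp add: graded_nth)
qed

lemma graded_scaleR_nth: "graded vs (r *\<^sub>R \<alpha>) $ k = r *\<^sub>R graded vs \<alpha> $ k"
  by (simp add: scaleR_conv_of_real)

lemma fps_of_int_mult_nth: "(of_int N * F) $ k = of_int N * F $ k" for F :: "'r::comm_ring_1 fps"
  by (simp flip: fps_of_int)

lemma form_exp_graded:
  assumes "even_form \<alpha>" "graded vs \<alpha> $ 0 = 0"
  shows "graded vs (form_exp \<alpha>) = exp_fps oo graded vs \<alpha>"
  unfolding form_exp_def by (rule graded_form_series[OF assms])

context tangent_list
begin

lemma deg_form_pontryagin1: "deg_form 4 (pontryagin1 M A p)"
  using deg_form_scaleR[OF deg_form_trace_power[where k = 2, OF deg_form_norm_curvature]]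
  by (simp add: pontryagin1_def)

text \<open>The first Pontryagin form is half the trace of the squared curvature, which is also the
  degree 4 part of the Chern character.\<close>

lemma graded_pontryagin1: "graded vs (pontryagin1 M A p) $ k = (if k = 2 then chern_conn A $ 2 else 0)"
proof -
  have "graded vs (pontryagin1 M A p) $ k = (if k = 2 then pull vs (pontryagin1 M A p) else 0)"
    using deg_form_pontryagin1 by (intro graded_nth_deg_form) simp
  then show ?thesis
    by (simp add: pontryagin1_def pull_trace_power deg_form_norm_curvature chern_conn_def chern_nth curv_def[abs_def] fact_numeral)
qed

lemma even_form_ahat: "even_form (ahat M A p)"
  unfolding ahat_def form_exp_def
  by (intro even_form_form_series even_form_scaleR even_form_trace_series deg_form_norm_curvature)

text \<open>The factor k! converts components of the Chern character back into power sums.\<close>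

lemma graded_log_ahat:
  "graded vs ((1 / 2) *\<^sub>R trace_series (fps_nth log_ahat_fps) (lrank A) (norm_curvature M A p)) $ k
    = (1 / 2 * (fps_nth log_ahat_fps k * fact k)) *\<^sub>R chern_conn A $ k"
  by (simp add: graded_scaleR_nth graded_trace_series deg_form_norm_curvature chern_conn_def chern_nth curv_def[abs_def]
      del: graded_scaleR)

lemma graded_ahat: "graded vs (ahat M A p) = exp_fps oo
    graded vs ((1 / 2) *\<^sub>R trace_series (fps_nth log_ahat_fps) (lrank A) (norm_curvature M A p))"
  unfolding ahat_def
  by (rule form_exp_graded) (simp_all only: graded_log_ahat log_ahat_nth even_form_scaleR even_form_trace_series
      deg_form_norm_curvature, simp)

text \<open>The form c sits at index 1 alone, so composing the exponential series with it only
  scales the coefficients by powers of c / 2.\<close>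

lemma graded_exp_euler:
  assumes c: "deg_form 2 c"
  shows "graded vs (form_exp ((1 / 2) *\<^sub>R c)) $ k = ((1 / 2) ^ k / fact k) *\<^sub>R pull vs c ^ k"
proof -
  have half: "graded vs ((1 / 2) *\<^sub>R c) = fps_const ((1 / 2) *\<^sub>R pull vs c) * fps_X"
    using graded_nth_deg_form[of 1 c vs] c
    by (intro fps_ext) (simp add: scaleR_conv_of_real fps_X_def)
  have "graded vs (form_exp ((1 / 2) *\<^sub>R c)) = exp_fps oo graded vs ((1 / 2) *\<^sub>R c)"
    using c by (intro form_exp_graded even_form_scaleR deg_form_even_form[of 2]) (simp_all add: half del: graded_scaleR)
  also have "(exp_fps oo graded vs ((1 / 2) *\<^sub>R c)) $ k = ((1 / 2) *\<^sub>R pull vs c) ^ k * of_real (1 / fact k)"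
    by (simp only: half fps_compose_linear fps_nth_Abs_fps)
  also have "\<dots> = (1 / fact k) *\<^sub>R ((1 / 2) *\<^sub>R pull vs c) ^ k"
    by (simp add: scaleR_conv_of_real mult.commute)
  also have "((1 / 2) *\<^sub>R pull vs c) ^ k = (1 / 2) ^ k *\<^sub>R pull vs c ^ k"
    by (induction k) simp_all
  finally show ?thesis by simp
qed

lemma anomaly_graded:
  fixes V :: "'a virt" and xt E :: "even_grassmann fps"
  assumes TZ: "euclidean_bundle M 10 TZ gT DT" and F1: "euclidean_bundle M m F1 g1 D1" and F2: "euclidean_bundle M n F2 g2 D2"
    and xt_even: "even_fps xt"
    and xt: "xt $ 0 = 0" "xt $ 2 = \<kappa>" "xt $ 4 = (1 / 12) *\<^sub>R \<kappa> ^ 2" "xt $ 6 = (1 / 360) *\<^sub>R \<kappa> ^ 3"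
    and E: "E $ 0 = 1" "E $ 2 = (1 / 8) *\<^sub>R \<kappa>" "E $ 4 = (1 / 384) *\<^sub>R \<kappa> ^ 2" "E $ 6 = (1 / 46080) *\<^sub>R \<kappa> ^ 3"
  defines "T \<equiv> local_conn TZ DT" and "f1 \<equiv> local_conn F1 D1" and "f2 \<equiv> local_conn F2 D2" and "d \<equiv> int m - int n"
  defines "P \<equiv> pontryagin1 M T p - pontryagin1 M f1 p + pontryagin1 M f2 p" and "A \<equiv> ahat M T p"
  assumes W: "W = chern_conn (wedge2_conn f1) + chern_conn (sym2_conn f2) - chern_conn f1 * chern_conn f2
      + chern_conn T + of_int ((d - 32) * (d - 31) div 2 - 2) - of_int (d - 32) * (chern_conn f1 - chern_conn f2)
      + 5 * (xt * xt) + 3 * ((of_int (d - 31) - chern_conn f1 + chern_conn f2) * xt)"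
  shows "(graded vs A * E * W) $ 6 = graded vs P $ 2 *
    (- (graded vs (exp_quot P) * graded vs A * E * W) $ 4 + (graded vs (form_exp ((1 / 24) *\<^sub>R P)) * graded vs A * E) $ 4)"
proof -
  have P_nth: "graded vs P $ k = (if k = 2 then chern_conn T $ 2 - chern_conn f1 $ 2 + chern_conn f2 $ 2 else 0)" for k
    by (simp add: P_def graded_pontryagin1)
  have P_even: "even_form P"
    unfolding P_def by (intro even_form_add even_form_diff deg_form_even_form[OF deg_form_pontryagin1]) auto
  have sm: "smooth_conn f1" "smooth_conn f2"
    using F1 F2 unfolding f1_def f2_def euclidean_bundle_def by (auto intro: smooth_conn_local_conn)
  have Q: "graded vs (exp_quot P) = Abs_fps (\<lambda>k. of_real (1 / (24 ^ (k + 1) * fact (k + 1)))) oo graded vs P"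
    unfolding exp_quot_def by (rule graded_form_series[OF P_even]) (simp add: P_nth)
  have X: "graded vs (form_exp ((1 / 24) *\<^sub>R P)) = exp_fps oo (fps_const (of_real (1 / 24)) * graded vs P)"
    unfolding graded_scaleR[symmetric] by (rule form_exp_graded) (simp_all add: P_even P_nth)
  have even: "even_fps (chern_conn T)" "even_fps (chern_conn f1)" "even_fps (chern_conn f2)"
    unfolding even_fps_def T_def f1_def f2_def
    using chern_conn_euclidean(2)[OF TZ] chern_conn_euclidean(2)[OF F1] chern_conn_euclidean(2)[OF F2] by auto
  have rank: "chern_conn T $ 0 = 10" "chern_conn f1 $ 0 = of_nat m" "chern_conn f2 $ 0 = of_nat n"
    unfolding T_def f1_def f2_def
    using chern_conn_euclidean(1)[OF TZ] chern_conn_euclidean(1)[OF F1] chern_conn_euclidean(1)[OF F2] by auto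
  \<comment> \<open>A product of consecutive integers is even, so the integer division in the rank
    term is exact.\<close>
  have "even ((d - 32) * (d - 31))" by auto
  then have N: "2 * ((d - 32) * (d - 31) div 2 - 2) = (d - 32) * ((d - 32) + 1) - 4" by (simp add: algebra_simps)
  show ?thesis
    unfolding Q X
    by (rule anomaly_fps[OF even xt_even rank _ N chern_conn_wedge2[OF sm(1)] chern_conn_sym2[OF sm(2)] _ graded_log_ahat[of T]
          graded_ahat[of T, folded A_def] xt E P_nth])
       (simp_all add: d_def W)
qed

text \<open>Covers both identities: \<open>xt\<close> and \<open>E\<close> are left abstract, and
  \<open>S1\<close>, \<open>S2\<close> stand for the two virtual bundles built from the plane
  bundle. The second identity takes \<open>xt\<close> = 0, \<open>E\<close> = 1 and empty
  \<open>S1\<close>, \<open>S2\<close>.\<close>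

lemma anomaly_forms:
  fixes V :: "'a virt" and xt :: "even_grassmann fps"
  assumes TZ: "euclidean_bundle M 10 TZ gT DT" and F1: "euclidean_bundle M m F1 g1 D1" and F2: "euclidean_bundle M n F2 g2 D2"
    and xt_even: "even_fps xt"
    and xt: "xt $ 0 = 0" "xt $ 2 = \<kappa>" "xt $ 4 = (1 / 12) *\<^sub>R \<kappa> ^ 2" "xt $ 6 = (1 / 360) *\<^sub>R \<kappa> ^ 3"
    and E: "graded vs E $ 0 = 1" "graded vs E $ 2 = (1 / 8) *\<^sub>R \<kappa>" "graded vs E $ 4 = (1 / 384) *\<^sub>R \<kappa> ^ 2"
      "graded vs E $ 6 = (1 / 46080) *\<^sub>R \<kappa> ^ 3" "even_form E"
  defines "T \<equiv> local_conn TZ DT" and "f1 \<equiv> local_conn F1 D1" and "f2 \<equiv> local_conn F2 D2" and "d \<equiv> int m - int n"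
    and "d' \<equiv> real m - real n"
  defines "P \<equiv> pontryagin1 M T p - pontryagin1 M f1 p + pontryagin1 M f2 p" and "A \<equiv> ahat M T p"
  assumes V: "chern_virt V = chern_conn (wedge2_conn f1) + chern_conn (sym2_conn f2) - chern_conn f1 * chern_conn f2
      + chern_conn T + of_int ((d - 32) * (d - 31) div 2 - 2) - of_int (d - 32) * (chern_conn f1 - chern_conn f2)
      + 5 * (xt * xt) + 3 * ((of_int (d - 31) - chern_conn f1 + chern_conn f2) * xt)"
    and S1: "chern_virt S1 = xt * xt" and S2: "chern_virt S2 = (of_int (d - 31) - chern_conn f1 + chern_conn f2) * xt"
  shows "mapply (deg_part 12 (A * E * ch M (vb (wedge2_conn f1)) p)
           + deg_part 12 (A * E * ch M (vb (sym2_conn f2)) p)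
           - deg_part 12 (A * E * ch M (vb f1 * vb f2) p)
           + deg_part 12 (A * E * ch M (vb T) p)
           + ((d' - 32) * (d' - 31) / 2 - 2) *\<^sub>R deg_part 12 (A * E)
           - (d' - 32) *\<^sub>R deg_part 12 (A * E * ch M (vb f1 - vb f2) p)
           + 5 *\<^sub>R deg_part 12 (A * E * ch M S1 p)
           + 3 *\<^sub>R deg_part 12 (A * E * ch M S2 p)) vs
    = mapply (P * deg_part 8 (- (exp_quot P * A * E * ch M V p) + form_exp ((1 / 24) *\<^sub>R P) * A * E)) vs"
    (is "mapply ?L vs = mapply ?R vs")
proof (rule mapply_eqI_graded)
  have sm: "smooth_conn f1" "smooth_conn f2"
    using F1 F2 unfolding f1_def f2_def euclidean_bundle_def by (auto intro: smooth_conn_local_conn)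
  have P4: "deg_form 4 P"
    unfolding P_def by (intro deg_form_add deg_form_diff deg_form_pontryagin1)
  then have evP: "even_form P" by (rule deg_form_even_form) simp
  have evA: "even_form A" unfolding A_def by (rule even_form_ahat)
  have evQ: "even_form (exp_quot P)" "even_form (form_exp ((1 / 24) *\<^sub>R P))"
    unfolding exp_quot_def form_exp_def using evP by (auto intro: even_form_form_series)
  show "deg_form (2 * 6) ?L"
    by (simp add: deg_form_add deg_form_diff deg_form_scaleR deg_form_deg_part)
  have "deg_form (4 + 8) ?R"
    using P4 deg_form_deg_part by (rule deg_form_times)
  then show "deg_form (2 * 6) ?R" by simp
  let ?a = "graded vs A" and ?e = "graded vs E"
  have 12: "graded vs (deg_part 12 \<alpha>) $ 6 = graded vs \<alpha> $ 6" for \<alpha>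
    using graded_deg_part[of vs 6 \<alpha>] by simp
  have 8: "graded vs (deg_part 8 \<alpha>) $ 4 = graded vs \<alpha> $ 4" for \<alpha>
    using graded_deg_part[of vs 4 \<alpha>] by simp
  have "even ((d - 32) * (d - 31))" by auto
  then have "real_of_int ((d - 32) * (d - 31) div 2 - 2) = real_of_int ((d - 32) * (d - 31)) / 2 - 2"
    by (simp add: real_of_int_div)
  then have N: "(d' - 32) * (d' - 31) / 2 - 2 = of_int ((d - 32) * (d - 31) div 2 - 2)"
    by (simp add: d_def d'_def)
  have D: "d' - 32 = of_int (d - 32)" by (simp add: d_def d'_def)
  have scale: "real_of_int k *\<^sub>R x = of_int k * x" "5 *\<^sub>R x = 5 * x" "3 *\<^sub>R x = 3 * x" for k and x :: even_grassmann
    by (simp_all add: scaleR_conv_of_real)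
  have AE: "graded vs (A * E) = ?a * ?e" "graded vs (A * E * \<alpha>) = ?a * ?e * graded vs \<alpha>" for \<alpha>
    by (simp_all add: graded_times evA E(5))
  have "graded vs ?L $ 6 = (?a * ?e * chern_conn (wedge2_conn f1)) $ 6 + (?a * ?e * chern_conn (sym2_conn f2)) $ 6
     - (?a * ?e * (chern_conn f1 * chern_conn f2)) $ 6 + (?a * ?e * chern_conn T) $ 6
     + of_int ((d - 32) * (d - 31) div 2 - 2) * (?a * ?e) $ 6
     - of_int (d - 32) * (?a * ?e * (chern_conn f1 - chern_conn f2)) $ 6
     + 5 * (?a * ?e * (xt * xt)) $ 6
     + 3 * (?a * ?e * ((of_int (d - 31) - chern_conn f1 + chern_conn f2) * xt)) $ 6"
    unfolding N unfolding graded_linear fps_add_nth fps_sub_nth D graded_scaleR_nth 12 AE graded_ch scale S1 S2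
    by (simp add: sm)
  also have "\<dots> = (?a * ?e * chern_virt V) $ 6"
    unfolding V fps_of_int_mult_nth[symmetric] fps_numeral_mult_nth[symmetric] fps_add_nth[symmetric] fps_sub_nth[symmetric]
    by (rule arg_cong[of _ _ "\<lambda>F. F $ 6"]) (simp only: algebra_simps)
  also have "\<dots> = graded vs P $ 2 *
    (- (graded vs (exp_quot P) * ?a * ?e * chern_virt V) $ 4 + (graded vs (form_exp ((1 / 24) *\<^sub>R P)) * ?a * ?e) $ 4)"
    using anomaly_graded[OF TZ F1 F2 xt_even xt E(1-4), of "chern_virt V"] V
    unfolding T_def f1_def f2_def d_def P_def A_def by blast
  also have "\<dots> = graded vs ?R $ 6"
  proof -
    \<comment> \<open>P is concentrated at index 2, so multiplication by it moves index 4 to index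
      6, that is, degree 8 to degree 12.\<close>
    have "graded vs P $ k = 0" if "k \<noteq> 2" for k
      using graded_nth_deg_form[of 2 P vs k] P4 that by simp
    moreover from this have "even_fps (graded vs P)"
      unfolding even_fps_def by (metis even_numeral)
    ultimately have "(graded vs P * F) $ 6 = graded vs P $ 2 * F $ 4" for F
      by (simp add: even_fps_mult_nth)
    then show ?thesis
      by (simp add: graded_times evP 8 evA evQ E(5) graded_ch)
  qed
  finally show "graded vs ?L $ 6 = graded vs ?R $ 6" .
qed

end

theorem theorem1p1:
  fixes Z :: "('z, real ^ 10) manifold"
    and X :: "('a, 'e::real_normed_vector) manifold"
    and B :: "('b, 'f::real_normed_vector) manifold"
    and \<pi> :: "'a \<Rightarrow> 'b"
    and TZ :: "('a, 'a tvec) vbundle" and gTZ DTZ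
    and F1 :: "('a, 'v1::real_vector) vbundle" and gF1 DF1
    and F2 :: "('a, 'v2::real_vector) vbundle" and gF2 DF2
    and \<xi> :: "('a, 'v3::real_vector) vbundle" and g\<xi> D\<xi>
    and m n :: nat
  assumes "smooth_fiber_bundle Z X B \<pi>"
    and "vertical_tangent_bundle X B \<pi> TZ"
    and "euclidean_bundle X 10 TZ gTZ DTZ"
    and "fiberwise_torsion_free X TZ DTZ"
    and "euclidean_bundle X m F1 gF1 DF1"
    and "euclidean_bundle X n F2 gF2 DF2"
    and "euclidean_bundle X 2 \<xi> g\<xi> D\<xi>"
    and "oriented_rank2 \<xi>"
  shows
    "let T = local_conn TZ DTZ; f1 = local_conn F1 DF1; f2 = local_conn F2 DF2;
         x = local_conn \<xi> D\<xi>; c = euler_form X \<xi> g\<xi> D\<xi>;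
         d = int m - int n; d' = real m - real n;
         P = (\<lambda>p. pontryagin1 X T p - pontryagin1 X f1 p + pontryagin1 X f2 p);
         A = ahat X T; E = (\<lambda>p. form_exp ((1 / 2) *\<^sub>R c p))
     in
       forms_eq X
        (\<lambda>p. deg_part 12 (A p * E p * ch X (vb (wedge2_conn f1)) p)
           + deg_part 12 (A p * E p * ch X (vb (sym2_conn f2)) p)
           - deg_part 12 (A p * E p * ch X (vb f1 * vb f2) p)
           + deg_part 12 (A p * E p * ch X (vb T) p)
           + ((d' - 32) * (d' - 31) / 2 - 2) *\<^sub>R deg_part 12 (A p * E p)
           - (d' - 32) *\<^sub>R deg_part 12 (A p * E p * ch X (vb f1 - vb f2) p)
           + 5 *\<^sub>R deg_part 12 (A p * E p * ch X (reduced_vb x * reduced_vb x) p)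
           + 3 *\<^sub>R deg_part 12 (A p * E p *
               ch X ((triv (d - 31) - vb f1 + vb f2) * reduced_vb x) p))
        (\<lambda>p. P p * deg_part 8
           (- (exp_quot (P p) * A p * E p * ch X (virt_A T f1 f2 x) p)
            + form_exp ((1 / 24) *\<^sub>R P p) * A p * E p))
     \<and> (trivial_bundle X \<xi> \<longrightarrow>
       forms_eq X
        (\<lambda>p. deg_part 12 (A p * ch X (vb (wedge2_conn f1)) p)
           + deg_part 12 (A p * ch X (vb (sym2_conn f2)) p)
           - deg_part 12 (A p * ch X (vb f1 * vb f2) p)
           + deg_part 12 (A p * ch X (vb T) p)
           + ((d' - 32) * (d' - 31) / 2 - 2) *\<^sub>R deg_part 12 (A p)
           - (d' - 32) *\<^sub>R deg_part 12 (A p * ch X (vb f1 - vb f2) p))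
        (\<lambda>p. P p * deg_part 8
           (- (exp_quot (P p) * A p * ch X (virt_B T f1 f2) p)
            + form_exp ((1 / 24) *\<^sub>R P p) * A p)))"
  unfolding Let_def forms_eq_def
proof (intro conjI impI ballI allI, goal_cases)
  have X: "smooth_manifold X" using assms(1) unfolding smooth_fiber_bundle_def by blast
  case (1 p vs)
  then interpret tangent_list X p vs using X by unfold_locales
  have sm: "smooth_conn (local_conn TZ DTZ)" "smooth_conn (local_conn F1 DF1)" "smooth_conn (local_conn F2 DF2)"
      "smooth_conn (local_conn \<xi> D\<xi>)"
    using assms(3,5,6,7) unfolding euclidean_bundle_def by (auto intro: smooth_conn_local_conn)
  note rank = assms(5,6,7)[THEN chern_conn_euclidean(3)]
  let ?c = "euler_form X \<xi> g\<xi> D\<xi> p"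
  let ?e = "graded vs (form_exp ((1 / 2) *\<^sub>R ?c))" and ?x = "chern_conn (local_conn \<xi> D\<xi>)"
  have x_odd: "odd k \<Longrightarrow> ?x $ k = 0" for k
    by (rule chern_conn_euclidean(2)[OF assms(7)])
  note x_even = chern_conn_rank2[OF assms(7)]
  \<comment> \<open>These are the coefficients of 2 cosh c - 2 = c^2 + c^4 / 12 + c^6 / 360 + ...,
    with \<kappa> = c^2.\<close>
  have xt: "even_fps (?x - 2)" "(?x - 2) $ 0 = 0" "(?x - 2) $ 2 = pull vs ?c ^ 2"
    "(?x - 2) $ 4 = (1 / 12) *\<^sub>R (pull vs ?c ^ 2) ^ 2" "(?x - 2) $ 6 = (1 / 360) *\<^sub>R (pull vs ?c ^ 2) ^ 3"
    using x_odd x_even[of 0] x_even[of 1] x_even[of 2] x_even[of 3]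
    by (auto simp: even_fps_def fps_numeral_nth fact_numeral scaleR_conv_of_real simp flip: power_mult)
  note e = graded_exp_euler[OF deg_form_euler_form, of \<xi> g\<xi> D\<xi>]
  \<comment> \<open>The coefficients of exp (c / 2) are 1 / (2^k k!); only those with even k
    enter.\<close>
  have E: "?e $ 0 = 1"
    "?e $ 2 = (1 / 8) *\<^sub>R pull vs ?c ^ 2"
    "?e $ 4 = (1 / 384) *\<^sub>R (pull vs ?c ^ 2) ^ 2"
    "?e $ 6 = (1 / 46080) *\<^sub>R (pull vs ?c ^ 2) ^ 3"
    unfolding e power_mult[symmetric] by (simp_all add: fact_numeral power_divide)
  have ev: "even_form (form_exp ((1 / 2) *\<^sub>R ?c))"
    unfolding form_exp_def
    by (intro even_form_form_series even_form_scaleR deg_form_even_form[OF deg_form_euler_form]) simp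
  show ?case
    by (rule anomaly_forms[OF assms(3,5,6) xt E ev])
       (simp_all add: virt_A_def Let_def rank sm)
next
  have X: "smooth_manifold X" using assms(1) unfolding smooth_fiber_bundle_def by blast
  case (2 p vs)
  then interpret tangent_list X p vs using X by unfold_locales
  have sm: "smooth_conn (local_conn TZ DTZ)" "smooth_conn (local_conn F1 DF1)" "smooth_conn (local_conn F2 DF2)"
    using assms(3,5,6) unfolding euclidean_bundle_def by (auto intro: smooth_conn_local_conn)
  note rank = assms(5,6)[THEN chern_conn_euclidean(3)]
  have empty: "chern_virt (Virt []) = 0" "ch X (Virt []) p = 0" by (simp_all add: chern_virt_def ch_def)
  have "even_fps (0 :: even_grassmann fps)" by (simp add: even_fps_def)
  \<comment> \<open>With \<kappa> = 0 and E = 1 the terms of the plane bundle drop out; the empty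
    virtual bundles fill the places of the two summands that the second identity does not
    contain.\<close>
  from anomaly_forms[OF assms(3,5,6) this, of 0 1 "virt_B (local_conn TZ DTZ) (local_conn F1 DF1) (local_conn F2 DF2)" "Virt []" "Virt []"]
  show ?case
    by (simp add: virt_B_def Let_def rank sm empty mform_mult_1_right mform_mult_0_right deg_part_linear)
qed

end
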